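(* Let $G$ be a finite simple graph with vertex set $\{x_1,\ldots,x_n\}$, let $\mathbb{K}$ be a field and $R=\mathbb{K}[x_1,\ldots,x_n]$. Let $b=\nu(G)+1$. Then for all $a\ge 1$ with $a+b\le\operatorname{pd}(R/I(G))$, $$t_{a+b}(G)\le t_a(G)+t_b(G).$$
   Context: The edge ideal of $G$ is $I(G)=(x_ix_j : \{x_i,x_j\}\in E(G))\subset R$. For each $i$, $t_i(G)=\sup\{j : \beta_{i,j}^R(R/I(G))\ne 0\}$, where $\beta^R_{i,j}$ are the graded Betti numbers over the standard graded ring $R$; $\operatorname{pd}$ denotes projective dimension over $R$. A matching is a set of pairwise disjoint edges; an induced matching is a matching which is an induced subgraph of $G$ (i.e. the subgraph induced on its vertices has no other edges); $\nu(G)$ is the largest size of an induced matching in $G$. *)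

theory Defs
  imports "HOL-Library.Poly_Mapping" "HOL-Library.Extended_Nat" "HOL-Library.Extended_Real"
begin

section \<open>Graphs\<close>

text \<open>The vertex set is the whole finite type \<open>'v\<close>; a graph is given by its set of edges.\<close>

definition simple_graph :: "'v::finite set set \<Rightarrow> bool" where
  "simple_graph E \<longleftrightarrow> (\<forall>e\<in>E. card e = 2)"

definition matching :: "'v::finite set set \<Rightarrow> 'v set set \<Rightarrow> bool" where
  "matching E M \<longleftrightarrow> M \<subseteq> E \<and> (\<forall>e\<in>M. \<forall>f\<in>M. e \<noteq> f \<longrightarrow> e \<inter> f = {})"

definition induced_matching :: "'v::finite set set \<Rightarrow> 'v set set \<Rightarrow> bool" where
  "induced_matching E M \<longleftrightarrow> matching E M \<and> {e \<in> E. e \<subseteq> \<Union>M} = M"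

definition induced_matching_number :: "'v::finite set set \<Rightarrow> nat" where
  "induced_matching_number E = Max (card ` {M. induced_matching E M})"


section \<open>The polynomial ring and the edge ideal\<close>

text \<open>Exponent vectors are finitely supported functions \<open>'v \<Rightarrow>\<^sub>0 nat\<close> (written additively), so that
  for a finite type \<open>'v\<close> and a field \<open>'k\<close> the whole type \<open>('v, 'k) mpoly\<close>, with its convolution
  product, is the polynomial ring over \<open>'k\<close> with one variable for each element of \<open>'v\<close>.\<close>

type_synonym ('v, 'k) mpoly = "('v \<Rightarrow>\<^sub>0 nat) \<Rightarrow>\<^sub>0 'k"

definition X :: "'v \<Rightarrow> ('v, 'k::field) mpoly" where
  "X v = Poly_Mapping.single (Poly_Mapping.single v 1) 1"

definition mdeg :: "('v::finite \<Rightarrow>\<^sub>0 nat) \<Rightarrow> nat" where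
  "mdeg m = (\<Sum>v\<in>UNIV. Poly_Mapping.lookup m v)"

definition ideal_gen :: "'r::comm_ring_1 set \<Rightarrow> 'r set" where
  "ideal_gen S = module.span (*) S"

definition max_ideal :: "('v::finite, 'k::field) mpoly set" where
  "max_ideal = ideal_gen (range X)"

definition edge_ideal :: "'v::finite set set \<Rightarrow> ('v, 'k::field) mpoly set" where
  "edge_ideal E = ideal_gen {X u * X v |u v. {u, v} \<in> E}"


section \<open>Resolutions of a cyclic module \<open>R/I\<close>\<close>

text \<open>\<open>nat \<Rightarrow>\<^sub>0 'r\<close> is the free module of countable rank over \<open>'r\<close>. All modules in the resolutions
  below are direct summands of it, so a linear map out of one of them extends to the whole type;
  this is why differentials may be given as total linear maps.\<close>

definition vscale :: "'r::comm_ring_1 \<Rightarrow> (nat \<Rightarrow>\<^sub>0 'r) \<Rightarrow> (nat \<Rightarrow>\<^sub>0 'r)" where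
  "vscale c x = Poly_Mapping.map ((*) c) x"

lemma lookup_vscale: "Poly_Mapping.lookup (vscale c x) k = c * Poly_Mapping.lookup x k"
  by (simp add: vscale_def Poly_Mapping.map.rep_eq when_def)

lemma module_vscale: "module vscale"
  by (unfold_locales; rule poly_mapping_eqI)
    (simp_all add: lookup_vscale lookup_add algebra_simps)

definition unit_vec :: "nat \<Rightarrow> (nat \<Rightarrow>\<^sub>0 'r::comm_ring_1)" where
  "unit_vec k = Poly_Mapping.single k 1"

definition free_mod :: "nat \<Rightarrow> (nat \<Rightarrow>\<^sub>0 'r::comm_ring_1) set" where
  "free_mod r = {x. Poly_Mapping.keys x \<subseteq> {..<r}}"

text \<open>Direct summands of the free module of countable rank, given as images of projections.
  Up to isomorphism these are all countably generated projective modules.\<close>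

definition projective_mod :: "(nat \<Rightarrow>\<^sub>0 'r::comm_ring_1) set \<Rightarrow> bool" where
  "projective_mod P \<longleftrightarrow> (\<exists>e. module_hom vscale vscale e \<and> range e = P \<and> (\<forall>x\<in>P. e x = x))"

text \<open>Exactness of \<open>\<dots> \<rightarrow> P 2 \<rightarrow> P 1 \<rightarrow> P 0 \<rightarrow> R/I \<rightarrow> 0\<close>, where \<open>\<delta> i\<close> is the differential
  \<open>P (Suc i) \<rightarrow> P i\<close> and \<open>P 0 \<rightarrow> R/I\<close> is \<open>\<epsilon>\<close> followed by the quotient map (every linear map from a
  projective module to \<open>R/I\<close> lifts to such an \<open>\<epsilon>\<close>). The first condition on \<open>\<epsilon>\<close> is surjectivity
  modulo \<open>I\<close>, the next one exactness at \<open>P 0\<close>.\<close>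

definition resolution ::
  "'r::comm_ring_1 set \<Rightarrow> (nat \<Rightarrow> (nat \<Rightarrow>\<^sub>0 'r) set) \<Rightarrow> (nat \<Rightarrow> (nat \<Rightarrow>\<^sub>0 'r) \<Rightarrow> (nat \<Rightarrow>\<^sub>0 'r)) \<Rightarrow>
   ((nat \<Rightarrow>\<^sub>0 'r) \<Rightarrow> 'r) \<Rightarrow> bool" where
  "resolution I P \<delta> \<epsilon> \<longleftrightarrow>
     (\<forall>i. module_hom vscale vscale (\<delta> i)) \<and> module_hom vscale (*) \<epsilon> \<and>
     (\<forall>p. \<exists>x\<in>P 0. p - \<epsilon> x \<in> I) \<and>
     \<delta> 0 ` P 1 = {x \<in> P 0. \<epsilon> x \<in> I} \<and>
     (\<forall>i. \<delta> (Suc i) ` P (Suc (Suc i)) = {x \<in> P (Suc i). \<delta> i x = 0})"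

text \<open>The projective dimension of the module \<open>R/I\<close> (\<open>\<infinity>\<close> if there is no finite resolution).\<close>

definition pd_quot :: "'r::comm_ring_1 set \<Rightarrow> enat" where
  "pd_quot I = Inf {enat n |n. \<exists>P \<delta> \<epsilon>. (\<forall>i. projective_mod (P i)) \<and> resolution I P \<delta> \<epsilon> \<and>
                                    (\<forall>i>n. P i = {0})}"


section \<open>Graded Betti numbers\<close>

definition homogeneous :: "int \<Rightarrow> ('v::finite, 'k::field) mpoly \<Rightarrow> bool" where
  "homogeneous d p \<longleftrightarrow> (\<forall>m\<in>Poly_Mapping.keys p. int (mdeg m) = d)"

text \<open>A list of shifts \<open>ds\<close> of length \<open>r\<close> stands for the graded free module
  \<open>R(-ds ! 0) \<oplus> \<dots> \<oplus> R(-ds ! (r - 1))\<close>, whose \<open>k\<close>-th basis vector has degree \<open>ds ! k\<close>.\<close>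

definition homogeneous_vec :: "int list \<Rightarrow> int \<Rightarrow> (nat \<Rightarrow>\<^sub>0 ('v::finite, 'k::field) mpoly) \<Rightarrow> bool" where
  "homogeneous_vec ds d x \<longleftrightarrow>
     x \<in> free_mod (length ds) \<and>
     (\<forall>k<length ds. homogeneous (d - ds ! k) (Poly_Mapping.lookup x k))"

text \<open>The last condition is minimality: the image of each \<open>\<delta> i\<close> lies in \<open>\<mm> F\<^sub>i\<close>.\<close>

definition minimal_graded_free_resolution ::
  "('v::finite, 'k::field) mpoly set \<Rightarrow> (nat \<Rightarrow> int list) \<Rightarrow>
   (nat \<Rightarrow> (nat \<Rightarrow>\<^sub>0 ('v, 'k) mpoly) \<Rightarrow> (nat \<Rightarrow>\<^sub>0 ('v, 'k) mpoly)) \<Rightarrow>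
   ((nat \<Rightarrow>\<^sub>0 ('v, 'k) mpoly) \<Rightarrow> ('v, 'k) mpoly) \<Rightarrow> bool" where
  "minimal_graded_free_resolution I ds \<delta> \<epsilon> \<longleftrightarrow>
     resolution I (\<lambda>i. free_mod (length (ds i))) \<delta> \<epsilon> \<and>
     (\<forall>k<length (ds 0). homogeneous (ds 0 ! k) (\<epsilon> (unit_vec k))) \<and>
     (\<forall>i. \<forall>k<length (ds (Suc i)). homogeneous_vec (ds i) (ds (Suc i) ! k) (\<delta> i (unit_vec k))) \<and>
     (\<forall>i. \<forall>x\<in>free_mod (length (ds (Suc i))). \<forall>k. Poly_Mapping.lookup (\<delta> i x) k \<in> max_ideal)"

text \<open>\<open>graded_betti I i j\<close> is the number of summands \<open>R(-j)\<close> in the \<open>i\<close>-th module of a minimal graded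
  free resolution of \<open>R/I\<close>, for a homogeneous ideal \<open>I\<close>; it does not depend on the resolution chosen.\<close>

definition graded_betti :: "('v::finite, 'k::field) mpoly set \<Rightarrow> nat \<Rightarrow> int \<Rightarrow> nat" where
  "graded_betti I i j =
     (SOME b. \<exists>ds \<delta> \<epsilon>. minimal_graded_free_resolution I ds \<delta> \<epsilon> \<and> b = count_list (ds i) j)"

text \<open>The supremum is taken in the extended reals, so it is \<open>-\<infinity>\<close> when the \<open>i\<close>-th Betti number is 0.\<close>

definition top_degree :: "('v::finite, 'k::field) mpoly set \<Rightarrow> nat \<Rightarrow> ereal" where
  "top_degree I i = (SUP j\<in>{j. graded_betti I i j \<noteq> 0}. ereal (real_of_int j))"

end

theory Submission
  imports Defs "HOL-Library.FuncSet"
begin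

text \<open>By Hochster's formula \<open>\<beta>\<^sub>i\<^sub>,\<^sub>j(R/I(G)) \<noteq> 0\<close> iff some \<open>j\<close> vertices \<open>W\<close> have nonzero reduced cohomology of the
  independence complex of \<open>G[W]\<close> in dimension \<open>j - i - 1\<close>. The complex on \<open>W\<close> is the union of those on
  \<open>W - x\<close> and \<open>W - y\<close> if \<open>xy\<close> is an edge, and of those on \<open>W - x\<close> and \<open>W - {y, z}\<close> if \<open>xy\<close> and \<open>xz\<close> are
  edges. By Mayer--Vietoris the first kind of step decreases \<open>i\<close> by one at the cost of at most two
  vertices, the second kind decreases \<open>i\<close> by one at the cost of one vertex or by two at the cost of at
  most three. If \<open>i = a + b > \<nu>(G)\<close>, then \<open>G[W]\<close> is not a disjoint union of edges, so one step of the
  second kind is possible, and \<open>t\<^sub>a\<^sub>+\<^sub>b \<le> t\<^sub>a + 2b - 1\<close>. A maximum induced matching together with a vertex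
  adjacent to it shows \<open>t\<^sub>b \<ge> 2b - 1\<close>.

  Hochster's formula itself holds for every minimal graded free resolution by dimension shifting in
  Koszul homology; the same argument bounds the degrees of minimal syzygies and hence yields the
  finite generation needed to construct a resolution.\<close>

section \<open>Cochains of simplicial complexes\<close>

text \<open>Edge steps alone would give only t_(a+b) \<le> t_a + 2b, one more than the lower bound
  2b - 1 for t_b allows, so everything turns on saving a single vertex. The value b = \<nu>(G) + 1
  is where two facts meet: homological index above \<nu>(G) forces two edges of G[W] to share a
  vertex, and the 2\<nu>(G) + 1 vertices of the matching and its neighbour carry a class with q =
  \<nu>(G), that is, in index \<nu>(G) + 1. Since \<open>top_degree\<close> depends only on which
  Betti numbers are nonzero, no dimension of a homology group is computed. Cohomology and Koszul
  homology occur only through predicates saying that every cycle of a given degree is a boundary,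
  and quotient modules only through membership in a submodule. The Betti numbers are defined by
  choosing some minimal resolution, so the existence of one belongs to the proof. There is no
  circularity: the Koszul homology of R/I is read off from the complexes \<open>indep E W\<close>
  without any resolution, it vanishes in degrees above the number of vertices, and this bound is
  carried from each syzygy module to the next.\<close>

definition idx :: "'v::finite \<Rightarrow> nat" where
  "idx = (SOME f. inj f)"

lemma inj_idx: "inj (idx :: 'v::finite \<Rightarrow> nat)"
proof -
  obtain f :: "'v \<Rightarrow> nat" where "inj f"
    using finite_imp_inj_to_nat_seg[of "UNIV :: 'v set"] by auto
  then show ?thesis unfolding idx_def by (metis someI)
qed

text \<open>The sign (-1)^k, where k counts the elements of \<open>S\<close> that precede
  \<open>v\<close> in the arbitrary vertex order \<open>idx\<close>. The target ring is left open
  because the same sign occurs among field coefficients in \<open>cobd\<close> and among polynomial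
  scalars in \<open>koszul_d\<close>.\<close>

definition sg :: "'v::finite \<Rightarrow> 'v set \<Rightarrow> 'r::comm_ring_1" where
  "sg v S = (\<Prod>u\<in>S. if idx u < idx v then -1 else 1)"

lemma sg_empty [simp]: "sg v {} = 1"
  by (simp add: sg_def)

lemma sg_insert:
  "u \<notin> S \<Longrightarrow> sg v (insert u S) = (if idx u < idx v then -1 else 1) * sg v S"
  by (simp add: sg_def)

lemma sg_square [simp]: "sg v S * sg v S = 1"
  unfolding sg_def by (simp add: prod.distrib[symmetric] if_distrib cong: if_cong)

lemma sg_square' [simp]: "sg v S * (sg v S * x) = x"
  by (simp add: mult.assoc[symmetric])

text \<open>Exactly one of \<open>u\<close> and \<open>v\<close> precedes the other, so the two
  orders of insertion differ by one sign. This is why \<open>cobd\<close> and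
  \<open>koszul_d\<close> both square to zero.\<close>

lemma sg_swap:
  assumes "u \<noteq> v" "u \<notin> S" "v \<notin> S"
  shows "sg u S * sg v (insert u S) = - (sg v S * sg u (insert v S))"
proof -
  have "idx u \<noteq> idx v" using inj_idx assms(1) by (metis injD)
  then show ?thesis using assms by (auto simp: sg_insert)
qed

lemma sg_mult_swap:
  assumes "u \<noteq> v" "u \<notin> S" "v \<notin> S"
  shows "sg v (insert u S) * sg u (insert v S) = - (sg u S * sg v S)"
proof -
  have "idx u \<noteq> idx v" using inj_idx assms(1) by (metis injD)
  then show ?thesis using assms by (auto simp: sg_insert mult_ac)
qed

lemma sg_union: "S \<inter> T = {} \<Longrightarrow> sg v (S \<union> T) = sg v S * sg v T"
  unfolding sg_def by (rule prod.union_disjoint) auto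

text \<open>The terms for (u, w) and (w, u) cancel. Exchanging the summation variables would only
  show that twice the sum is 0, which says nothing in characteristic 2; the induction cancels the
  pairs themselves.\<close>

lemma sum_antisym:
  fixes F :: "'a \<Rightarrow> 'a \<Rightarrow> 'b::ab_group_add"
  assumes "finite A" "\<And>u w. u \<in> A \<Longrightarrow> w \<in> A \<Longrightarrow> u \<noteq> w \<Longrightarrow> F u w = - F w u"
  shows "(\<Sum>u\<in>A. \<Sum>w\<in>A - {u}. F u w) = 0"
  using assms
proof (induction A rule: finite_induct)
  case (insert a A)
  have *: "(\<Sum>w\<in>insert a A - {u}. F u w) = F u a + (\<Sum>w\<in>A - {u}. F u w)" if "u \<in> A" for u
  proof -
    have "insert a A - {u} = insert a (A - {u})" using that insert.hyps by auto
    then show ?thesis using insert.hyps by simp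
  qed
  have "insert a A - {a} = A" using insert.hyps by auto
  then have "(\<Sum>u\<in>insert a A. \<Sum>w\<in>insert a A - {u}. F u w)
      = (\<Sum>w\<in>A. F a w) + (\<Sum>u\<in>A. F u a + (\<Sum>w\<in>A - {u}. F u w))"
    using insert.hyps * by simp
  also have "\<dots> = (\<Sum>w\<in>A. F a w + F w a)"
  proof -
    have "(\<Sum>u\<in>A. \<Sum>w\<in>A - {u}. F u w) = 0"
      by (rule insert.IH) (rule insert.prems; simp)
    then show ?thesis by (simp add: sum.distrib)
  qed
  also have "\<dots> = 0"
  proof (rule sum.neutral, rule ballI)
    fix w assume "w \<in> A"
    then have "F a w = - F w a" using insert.prems insert.hyps(2) by (intro insert.prems) auto
    then show "F a w + F w a = 0" by simp
  qed
  finally show ?case .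
qed simp

text \<open>Cochains are total functions on vertex sets. At a face of a complex closed under subsets
  only values on faces enter, so a cochain of the complex may be represented by any extension. The
  empty face is included, which makes the cohomology reduced.\<close>

definition cobd :: "('v::finite set \<Rightarrow> 'k::comm_ring_1) \<Rightarrow> 'v set \<Rightarrow> 'k" where
  "cobd g \<sigma> = (\<Sum>v\<in>\<sigma>. sg v (\<sigma> - {v}) * g (\<sigma> - {v}))"

lemma cobd_empty [simp]: "cobd g {} = 0"
  by (simp add: cobd_def)

lemma cobd_add: "cobd (\<lambda>\<tau>. g \<tau> + h \<tau>) \<sigma> = cobd g \<sigma> + cobd h \<sigma>"
  by (simp add: cobd_def algebra_simps sum.distrib)

lemma cobd_diff: "cobd (\<lambda>\<tau>. g \<tau> - h \<tau>) \<sigma> = cobd g \<sigma> - cobd h \<sigma>"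
  by (simp add: cobd_def algebra_simps sum_subtractf)

lemma cobd_cong:
  "(\<And>v. v \<in> \<sigma> \<Longrightarrow> g (\<sigma> - {v}) = h (\<sigma> - {v})) \<Longrightarrow> cobd g \<sigma> = cobd h \<sigma>"
  by (simp add: cobd_def)

lemma cobd_cobd:
  fixes k :: "'v::finite set \<Rightarrow> 'k::comm_ring_1"
  shows "cobd (cobd k) \<sigma> = 0"
proof -
  define F where "F u w = sg u (\<sigma> - {u}) * (sg w (\<sigma> - {u} - {w}) * k (\<sigma> - {u} - {w}))" for u w
  have "cobd (cobd k) \<sigma> = (\<Sum>u\<in>\<sigma>. \<Sum>w\<in>\<sigma> - {u}. F u w)"
    by (simp add: cobd_def F_def sum_distrib_left)
  also have "\<dots> = 0"
  proof (rule sum_antisym)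
    fix u w assume uw: "u \<in> \<sigma>" "w \<in> \<sigma>" "u \<noteq> w"
    define S where "S = \<sigma> - {u} - {w}"
    have S: "\<sigma> - {u} = insert w S" "\<sigma> - {w} = insert u S" "\<sigma> - {w} - {u} = S" "u \<notin> S" "w \<notin> S"
      using uw by (auto simp: S_def)
    have "F u w = sg w S * sg u (insert w S) * k S"
      unfolding F_def S_def[symmetric] unfolding S(1) by (simp add: mult_ac)
    moreover have "F w u = sg u S * sg w (insert u S) * k S"
      unfolding F_def S(3) unfolding S(2) by (simp add: mult_ac)
    moreover have "sg u S * sg w (insert u S) = - (sg w S * sg u (insert w S) :: 'k)"
      using uw S by (intro sg_swap) auto
    ultimately show "F u w = - F w u"
      by simp
  qed simp
  finally show ?thesis .
qed

text \<open>The index \<open>q\<close> is the cardinality of faces, so this is reduced cohomology in dimension \<open>q - 1\<close>.\<close>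

definition cohom_zero :: "'k::field itself \<Rightarrow> 'v::finite set set \<Rightarrow> nat \<Rightarrow> bool" where
  "cohom_zero T \<Gamma> q \<longleftrightarrow> (\<forall>g :: 'v set \<Rightarrow> 'k.
     (\<forall>\<sigma>\<in>\<Gamma>. card \<sigma> = Suc q \<longrightarrow> cobd g \<sigma> = 0) \<longrightarrow>
     (\<exists>h. \<forall>\<sigma>\<in>\<Gamma>. card \<sigma> = q \<longrightarrow> g \<sigma> = cobd h \<sigma>))"

lemma cohom_zeroD:
  fixes g :: "'v::finite set \<Rightarrow> 'k::field"
  assumes "cohom_zero TYPE('k) \<Gamma> q"
    and "\<And>\<sigma>. \<sigma> \<in> \<Gamma> \<Longrightarrow> card \<sigma> = Suc q \<Longrightarrow> cobd g \<sigma> = 0"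
  obtains h where "\<And>\<sigma>. \<sigma> \<in> \<Gamma> \<Longrightarrow> card \<sigma> = q \<Longrightarrow> g \<sigma> = cobd h \<sigma>"
  using assms unfolding cohom_zero_def by blast

text \<open>The contracting homotopy of a cone with apex \<open>v\<close>: for a face without
  \<open>v\<close>, the cocycle condition on \<open>insert v \<sigma>\<close> can be solved for
  \<open>g \<sigma>\<close>.\<close>

lemma cohom_zero_cone:
  fixes v :: "'v::finite"
  assumes cone: "\<And>\<sigma>. \<sigma> \<in> \<Gamma> \<Longrightarrow> insert v \<sigma> \<in> \<Gamma>"
  shows "cohom_zero TYPE('k::field) \<Gamma> q"
  unfolding cohom_zero_def
proof (intro allI impI)
  fix g :: "'v set \<Rightarrow> 'k"
  assume g: "\<forall>\<sigma>\<in>\<Gamma>. card \<sigma> = Suc q \<longrightarrow> cobd g \<sigma> = 0"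
  \<comment> \<open>The value 0 on sets containing \<open>v\<close> makes every term of
    \<open>cobd h \<sigma>\<close> with v \<in> \<sigma> vanish except the one that removes
    \<open>v\<close>, and there the two signs cancel.\<close>
  define h where "h \<tau> = (if v \<in> \<tau> then 0 else sg v \<tau> * g (insert v \<tau>))" for \<tau>
  have "g \<sigma> = cobd h \<sigma>" if \<sigma>: "\<sigma> \<in> \<Gamma>" "card \<sigma> = q" for \<sigma>
  proof (cases "v \<in> \<sigma>")
    case True
    have "cobd h \<sigma> = (\<Sum>u\<in>\<sigma>. if u = v then g \<sigma> else 0)"
      unfolding cobd_def using True by (intro sum.cong) (auto simp: h_def insert_absorb)
    also have "\<dots> = g \<sigma>" using True by simp
    finally show ?thesis by simp
  next
    case False
    have "cobd g (insert v \<sigma>) = 0"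
      using g cone[OF \<sigma>(1)] \<sigma>(2) False by simp
    moreover have "cobd g (insert v \<sigma>) = sg v \<sigma> * g \<sigma> +
        (\<Sum>u\<in>\<sigma>. sg u (insert v (\<sigma> - {u})) * g (insert v (\<sigma> - {u})))"
    proof -
      have "insert v \<sigma> - {v} = \<sigma>" using False by auto
      moreover have "insert v \<sigma> - {u} = insert v (\<sigma> - {u})" if "u \<in> \<sigma>" for u
        using that False by auto
      ultimately show ?thesis using False by (simp add: cobd_def)
    qed
    ultimately have "sg v \<sigma> * g \<sigma> = - (\<Sum>u\<in>\<sigma>. sg u (insert v (\<sigma> - {u})) * g (insert v (\<sigma> - {u})))"
      by (simp add: eq_neg_iff_add_eq_0)
    then have "sg v \<sigma> * (sg v \<sigma> * g \<sigma>)
        = (\<Sum>u\<in>\<sigma>. - (sg v \<sigma> * (sg u (insert v (\<sigma> - {u})) * g (insert v (\<sigma> - {u})))))"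
      by (simp add: sum_distrib_left sum_negf)
    also have "\<dots> = cobd h \<sigma>"
      unfolding cobd_def
    proof (rule sum.cong)
      fix u assume u: "u \<in> \<sigma>"
      define S where "S = \<sigma> - {u}"
      have S: "\<sigma> = insert u S" "u \<notin> S" "v \<notin> S" "u \<noteq> v"
        using u False by (auto simp: S_def)
      have "sg v (insert u S) * (sg u (insert v S) :: 'k) = - (sg u S * sg v S)"
        using S by (intro sg_mult_swap) auto
      then have "- (sg v (insert u S) * (sg u (insert v S) * g (insert v S)))
          = sg u S * (sg v S * g (insert v S))"
        by (metis (no_types, lifting) minus_minus mult.assoc mult_minus_left)
      then show "- (sg v \<sigma> * (sg u (insert v (\<sigma> - {u})) * g (insert v (\<sigma> - {u}))))
          = sg u (\<sigma> - {u}) * h (\<sigma> - {u})"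
        unfolding S_def[symmetric] using S by (simp add: h_def)
    qed simp
    finally show ?thesis by simp
  qed
  then show "\<exists>h. \<forall>\<sigma>\<in>\<Gamma>. card \<sigma> = q \<longrightarrow> g \<sigma> = cobd h \<sigma>" by blast
qed

text \<open>Exactness of the Mayer--Vietoris sequence at the cohomology of the union. Primitives
  \<open>hA\<close> and \<open>hB\<close> on the two parts differ on the intersection by a cocycle;
  writing it as a coboundary makes it possible to correct \<open>hB\<close> and glue.\<close>

lemma cohom_zero_Mayer_Vietoris:
  fixes \<Gamma> :: "'v::finite set set"
  assumes A: "cohom_zero TYPE('k::field) \<Gamma> q" and B: "cohom_zero TYPE('k::field) \<Delta> q"
    and AB: "\<And>q'. q = Suc q' \<Longrightarrow> cohom_zero TYPE('k::field) (\<Gamma> \<inter> \<Delta>) q'"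
    and dA: "\<And>\<sigma> \<tau>. \<sigma> \<in> \<Gamma> \<Longrightarrow> \<tau> \<subseteq> \<sigma> \<Longrightarrow> \<tau> \<in> \<Gamma>"
    and dB: "\<And>\<sigma> \<tau>. \<sigma> \<in> \<Delta> \<Longrightarrow> \<tau> \<subseteq> \<sigma> \<Longrightarrow> \<tau> \<in> \<Delta>"
  shows "cohom_zero TYPE('k::field) (\<Gamma> \<union> \<Delta>) q"
  unfolding cohom_zero_def
proof (intro allI impI)
  fix g :: "'v set \<Rightarrow> 'k"
  assume g: "\<forall>\<sigma>\<in>\<Gamma> \<union> \<Delta>. card \<sigma> = Suc q \<longrightarrow> cobd g \<sigma> = 0"
  obtain hA where hA: "\<And>\<sigma>. \<sigma> \<in> \<Gamma> \<Longrightarrow> card \<sigma> = q \<Longrightarrow> g \<sigma> = cobd hA \<sigma>"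
    using cohom_zeroD[OF A, of g] g by blast
  obtain hB where hB: "\<And>\<sigma>. \<sigma> \<in> \<Delta> \<Longrightarrow> card \<sigma> = q \<Longrightarrow> g \<sigma> = cobd hB \<sigma>"
    using cohom_zeroD[OF B, of g] g by blast
  show "\<exists>h. \<forall>\<sigma>\<in>\<Gamma> \<union> \<Delta>. card \<sigma> = q \<longrightarrow> g \<sigma> = cobd h \<sigma>"
  proof (cases q)
    \<comment> \<open>The only face of cardinality 0 is the empty one, where every coboundary is 0;
      there is no connecting term in this degree.\<close>
    case 0
    then have "\<forall>\<sigma>\<in>\<Gamma> \<union> \<Delta>. card \<sigma> = q \<longrightarrow> g \<sigma> = cobd hA \<sigma>"
      using hA hB by fastforce
    then show ?thesis by blast
  next
    case (Suc q')
    have cocycle: "cobd (\<lambda>\<tau>. hA \<tau> - hB \<tau>) \<sigma> = 0" if "\<sigma> \<in> \<Gamma> \<inter> \<Delta>" "card \<sigma> = Suc q'" for \<sigma>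
      using hA[of \<sigma>] hB[of \<sigma>] that Suc by (simp add: cobd_diff)
    obtain k where k': "\<And>\<sigma>. \<sigma> \<in> \<Gamma> \<inter> \<Delta> \<Longrightarrow> card \<sigma> = q' \<Longrightarrow> hA \<sigma> - hB \<sigma> = cobd k \<sigma>"
      by (rule cohom_zeroD[OF AB[OF Suc] cocycle]) (auto intro: that)
    have k: "hA \<sigma> - hB \<sigma> = cobd k \<sigma>" if "\<sigma> \<in> \<Gamma>" "\<sigma> \<in> \<Delta>" "card \<sigma> = q'" for \<sigma>
      using k' that by simp
    \<comment> \<open>As \<open>k\<close> is a total function, \<open>cobd k\<close> makes sense on
      all of \<open>\<Delta>\<close>; adding it does not change the coboundary of \<open>hB\<close>,
      and on the intersection the corrected function equals \<open>hA\<close>.\<close>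
    define h where "h \<tau> = (if \<tau> \<in> \<Gamma> then hA \<tau> else hB \<tau> + cobd k \<tau>)" for \<tau>
    have "g \<sigma> = cobd h \<sigma>" if "\<sigma> \<in> \<Gamma>" "card \<sigma> = q" for \<sigma>
    proof -
      have "cobd h \<sigma> = cobd hA \<sigma>"
        using dA[OF that(1)] by (intro cobd_cong) (auto simp: h_def)
      then show ?thesis using hA that by simp
    qed
    moreover have "g \<sigma> = cobd h \<sigma>" if "\<sigma> \<in> \<Delta>" "card \<sigma> = q" for \<sigma>
    proof -
      have "cobd h \<sigma> = cobd (\<lambda>\<tau>. hB \<tau> + cobd k \<tau>) \<sigma>"
      proof (rule cobd_cong)
        fix v assume "v \<in> \<sigma>"
        then have "card (\<sigma> - {v}) = q'" "\<sigma> - {v} \<in> \<Delta>"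
          using that Suc dB[OF that(1)] by auto
        then show "h (\<sigma> - {v}) = hB (\<sigma> - {v}) + cobd k (\<sigma> - {v})"
          using k by (auto simp: h_def algebra_simps)
      qed
      then show ?thesis using hB that by (simp add: cobd_add cobd_cobd)
    qed
    ultimately show ?thesis by blast
  qed
qed

section \<open>Independence complexes\<close>

definition indep :: "'v::finite set set \<Rightarrow> 'v set \<Rightarrow> 'v set set" where
  "indep E W = {\<sigma>. \<sigma> \<subseteq> W \<and> (\<forall>e\<in>E. \<not> e \<subseteq> \<sigma>)}"

lemma indep_subset: "\<sigma> \<in> indep E W \<Longrightarrow> \<tau> \<subseteq> \<sigma> \<Longrightarrow> \<tau> \<in> indep E W"
  unfolding indep_def by blast

definition nonzero_cohom :: "'k::field itself \<Rightarrow> 'v::finite set set \<Rightarrow> 'v set \<Rightarrow> nat \<Rightarrow> bool" where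
  "nonzero_cohom T E W q \<longleftrightarrow> \<not> cohom_zero T (indep E W) q"

text \<open>Mayer--Vietoris read backwards: a nonzero class is handed down to one of three induced
  subgraphs, because intersecting vertex sets intersects the independence complexes.\<close>

lemma nonzero_cohom_union:
  assumes nz: "nonzero_cohom TYPE('k::field) E W q"
    and "A \<subseteq> W" "B \<subseteq> W" and cover: "\<And>\<sigma>. \<sigma> \<in> indep E W \<Longrightarrow> \<sigma> \<subseteq> A \<or> \<sigma> \<subseteq> B"
  shows "nonzero_cohom TYPE('k) E A q \<or> nonzero_cohom TYPE('k) E B q \<or>
    (\<exists>q'. q = Suc q' \<and> nonzero_cohom TYPE('k) E (A \<inter> B) q')"
proof (rule ccontr)
  assume neg: "\<not> ?thesis"
  have "indep E W = indep E A \<union> indep E B"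
  proof (intro equalityI subsetI)
    fix \<sigma> assume \<sigma>: "\<sigma> \<in> indep E W"
    then show "\<sigma> \<in> indep E A \<union> indep E B"
      using cover[OF \<sigma>] by (simp add: indep_def)
  next
    fix \<sigma> assume "\<sigma> \<in> indep E A \<union> indep E B"
    then show "\<sigma> \<in> indep E W"
      using assms(2,3) by (auto simp: indep_def)
  qed
  moreover have "indep E (A \<inter> B) = indep E A \<inter> indep E B"
    by (auto simp: indep_def)
  moreover have "cohom_zero TYPE('k) (indep E A \<union> indep E B) q"
  proof (rule cohom_zero_Mayer_Vietoris)
    show "cohom_zero TYPE('k) (indep E A) q" "cohom_zero TYPE('k) (indep E B) q"
      using neg by (auto simp: nonzero_cohom_def)
    show "cohom_zero TYPE('k) (indep E A \<inter> indep E B) q'" if "q = Suc q'" for q'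
      using neg that calculation(2) by (auto simp: nonzero_cohom_def)
  qed (auto intro: indep_subset)
  ultimately have "cohom_zero TYPE('k) (indep E W) q" by simp
  then show False using nz by (simp add: nonzero_cohom_def)
qed

text \<open>A vertex without neighbours in \<open>W\<close> can be added to every independent set,
  so it would be the apex of a cone.\<close>

lemma nonzero_cohom_not_isolated:
  assumes "nonzero_cohom TYPE('k::field) E W q" "v \<in> W"
  shows "\<exists>e\<in>E. v \<in> e \<and> e \<subseteq> W"
proof (rule ccontr)
  assume neg: "\<not> ?thesis"
  have "cohom_zero TYPE('k) (indep E W) q"
  proof (rule cohom_zero_cone)
    fix \<sigma> assume "\<sigma> \<in> indep E W"
    then show "insert v \<sigma> \<in> indep E W"
      using neg assms(2) by (auto simp: indep_def)
  qed
  then show False using assms(1) by (simp add: nonzero_cohom_def)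
qed

text \<open>An independent set misses \<open>x\<close> or \<open>y\<close>. The homological index
  \<open>card W - q\<close> falls by exactly one in each alternative: in the third, two vertices go
  but \<open>q\<close> falls as well.\<close>

lemma nonzero_cohom_edge_step:
  assumes nz: "nonzero_cohom TYPE('k::field) E W q" and e: "{x, y} \<in> E" "{x, y} \<subseteq> W"
  shows "nonzero_cohom TYPE('k) E (W - {x}) q \<or> nonzero_cohom TYPE('k) E (W - {y}) q \<or>
    (\<exists>q'. q = Suc q' \<and> nonzero_cohom TYPE('k) E (W - {x, y}) q')"
proof -
  have "(W - {x}) \<inter> (W - {y}) = W - {x, y}" by auto
  moreover have "\<sigma> \<subseteq> W - {x} \<or> \<sigma> \<subseteq> W - {y}" if "\<sigma> \<in> indep E W" for \<sigma>
    using that e by (auto simp: indep_def)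
  ultimately show ?thesis
    using nonzero_cohom_union[OF nz, of "W - {x}" "W - {y}"] by auto
qed

text \<open>An independent set misses \<open>x\<close>, or it contains \<open>x\<close> and then
  misses both neighbours. The index \<open>card W - q\<close> falls by 1, 2 and 2 in the three
  alternatives, at the price of 1, 2 and 3 vertices.\<close>

lemma nonzero_cohom_path_step:
  assumes nz: "nonzero_cohom TYPE('k::field) E W q"
    and e: "{x, y} \<in> E" "{x, z} \<in> E" "{x, y, z} \<subseteq> W"
  shows "nonzero_cohom TYPE('k) E (W - {x}) q \<or> nonzero_cohom TYPE('k) E (W - {y, z}) q \<or>
    (\<exists>q'. q = Suc q' \<and> nonzero_cohom TYPE('k) E (W - {x, y, z}) q')"
proof -
  have "(W - {x}) \<inter> (W - {y, z}) = W - {x, y, z}" by auto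
  moreover have "\<sigma> \<subseteq> W - {x} \<or> \<sigma> \<subseteq> W - {y, z}" if "\<sigma> \<in> indep E W" for \<sigma>
    using that e by (auto simp: indep_def)
  ultimately show ?thesis
    using nonzero_cohom_union[OF nz, of "W - {x}" "W - {y, z}"] by auto
qed

lemma simple_graph_edgeE:
  assumes "simple_graph E" "e \<in> E" "v \<in> e"
  obtains u where "e = {v, u}" "u \<noteq> v"
proof -
  have "card e = 2" using assms by (simp add: simple_graph_def)
  then obtain x y where "e = {x, y}" "x \<noteq> y" by (auto simp: card_2_iff)
  then show ?thesis using assms(3) that[of x] that[of y] by auto
qed

text \<open>Iteration of \<open>d\<close> edge steps, which are always possible because
  \<open>W\<close> is not empty and has no isolated vertex. In terms of top degrees this is t_(a+d)
  \<le> t_a + 2d.\<close>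

lemma nonzero_cohom_descend:
  assumes sg: "simple_graph E"
  shows "nonzero_cohom TYPE('k::field) E W q \<Longrightarrow> card W = a + d + q \<Longrightarrow>
    \<exists>W' q'. nonzero_cohom TYPE('k) E W' q' \<and> card W' = a + q' \<and> card W \<le> card W' + 2 * d"
proof (induction d arbitrary: W q)
  case 0
  then show ?case by (intro exI[of _ W] exI[of _ q]) simp
next
  case (Suc d)
  obtain v where "v \<in> W" using Suc.prems(2) by fastforce
  then obtain e where e: "e \<in> E" "v \<in> e" "e \<subseteq> W"
    using nonzero_cohom_not_isolated Suc.prems(1) by blast
  obtain u where u: "e = {v, u}" "u \<noteq> v"
    using simple_graph_edgeE[OF sg e(1,2)] .
  have c: "card (W - {v}) = card W - 1" "card (W - {u}) = card W - 1" "card (W - {v, u}) = card W - 2"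
    using u e by (auto simp: card_Diff_subset)
  from nonzero_cohom_edge_step[OF Suc.prems(1)] u e
  consider "nonzero_cohom TYPE('k) E (W - {v}) q" | "nonzero_cohom TYPE('k) E (W - {u}) q"
    | q' where "q = Suc q'" "nonzero_cohom TYPE('k) E (W - {v, u}) q'"
    by blast
  then show ?case
  proof cases
    case 1
    from Suc.IH[OF this] c Suc.prems(2) show ?thesis by fastforce
  next
    case 2
    from Suc.IH[OF this] c Suc.prems(2) show ?thesis by fastforce
  next
    case 3
    from Suc.IH[OF 3(2)] c Suc.prems(2) 3(1) show ?thesis by fastforce
  qed
qed

text \<open>If the edges in \<open>W\<close> are disjoint, deleting one end of an edge isolates the
  other end, so only the third alternative of the edge step survives and each edge accounts for one
  unit of index. The bound reflects that disjoint edges generate a complete intersection, whose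
  projective dimension is their number.\<close>

lemma nonzero_cohom_matching:
  assumes sg: "simple_graph E"
  shows "nonzero_cohom TYPE('k::field) E W q \<Longrightarrow> matching E {e \<in> E. e \<subseteq> W} \<Longrightarrow>
    card W \<le> card {e \<in> E. e \<subseteq> W} + q"
proof (induction "card W" arbitrary: W q rule: less_induct)
  case less
  show ?case
  proof (cases "W = {}")
    case False
    then obtain v where "v \<in> W" by blast
    then obtain e where e: "e \<in> E" "v \<in> e" "e \<subseteq> W"
      using nonzero_cohom_not_isolated less.prems(1) by blast
    obtain u where u: "e = {v, u}" "u \<noteq> v"
      using simple_graph_edgeE[OF sg e(1,2)] .
    have uniq: "f = {v, u}" if "f \<in> E" "f \<subseteq> W" "v \<in> f \<or> u \<in> f" for f
    proof -
      have "e = f \<or> e \<inter> f = {}"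
        using less.prems(2) that(1,2) e(1,3) unfolding matching_def by blast
      then show ?thesis using that(3) u by auto
    qed
    have "\<not> nonzero_cohom TYPE('k) E (W - {v}) q"
    proof
      assume "nonzero_cohom TYPE('k) E (W - {v}) q"
      moreover have "u \<in> W - {v}" using e u by auto
      ultimately obtain f where "f \<in> E" "u \<in> f" "f \<subseteq> W - {v}"
        using nonzero_cohom_not_isolated by blast
      then show False using uniq[of f] by auto
    qed
    moreover have "\<not> nonzero_cohom TYPE('k) E (W - {u}) q"
    proof
      assume "nonzero_cohom TYPE('k) E (W - {u}) q"
      moreover have "v \<in> W - {u}" using e u by auto
      ultimately obtain f where "f \<in> E" "v \<in> f" "f \<subseteq> W - {u}"
        using nonzero_cohom_not_isolated by blast
      then show False using uniq[of f] by auto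
    qed
    ultimately obtain q' where q': "q = Suc q'" "nonzero_cohom TYPE('k) E (W - {v, u}) q'"
      using nonzero_cohom_edge_step[OF less.prems(1)] u e by blast
    define W' where "W' = W - {v, u}"
    have c: "card W' = card W - 2" "card W \<ge> 2"
      using u e card_mono[of W "{v, u}"] by (auto simp: W'_def card_Diff_subset)
    have E': "{e \<in> E. e \<subseteq> W} = insert {v, u} {e \<in> E. e \<subseteq> W'}"
    proof (intro equalityI subsetI)
      fix f assume f: "f \<in> {e \<in> E. e \<subseteq> W}"
      show "f \<in> insert {v, u} {e \<in> E. e \<subseteq> W'}"
      proof (cases "v \<in> f \<or> u \<in> f")
        case True
        then show ?thesis using uniq[of f] f by blast
      next
        case False
        then show ?thesis using f by (auto simp: W'_def)
      qed
    next
      fix f assume "f \<in> insert {v, u} {e \<in> E. e \<subseteq> W'}"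
      then show "f \<in> {e \<in> E. e \<subseteq> W}" using e(1,3) unfolding u(1) W'_def by blast
    qed
    have "{v, u} \<notin> {e \<in> E. e \<subseteq> W'}" by (auto simp: W'_def)
    then have E'': "card {e \<in> E. e \<subseteq> W} = Suc (card {e \<in> E. e \<subseteq> W'})"
      unfolding E' by simp
    have "matching E {e \<in> E. e \<subseteq> W'}"
      using less.prems(2) unfolding E' by (auto simp: matching_def)
    then have "card W' \<le> card {e \<in> E. e \<subseteq> W'} + q'"
      using less.hyps[of W' q'] c q' by (simp add: W'_def)
    then show ?thesis using c E'' q' by simp
  qed simp
qed

lemma card_le_induced_matching_number:
  "induced_matching E M \<Longrightarrow> card M \<le> induced_matching_number E"
  unfolding induced_matching_number_def by (rule Max_ge) auto

lemma maximum_induced_matching: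
  fixes E :: "'v::finite set set"
  obtains M where "induced_matching E M" "card M = induced_matching_number E"
proof (cases "{} \<in> E")
  \<comment> \<open>Here \<open>E\<close> is arbitrary. If the empty set is an edge, the empty
    matching is not induced, since that edge lies within its vertex set; the matching consisting of
    the empty edge takes its place.\<close>
  case True
  then have "induced_matching E {{}}" by (auto simp: induced_matching_def matching_def)
  then have "induced_matching_number E \<in> card ` {M. induced_matching E M}"
    unfolding induced_matching_number_def by (intro Max_in) auto
  then show ?thesis using that by auto
next
  case False
  then have "induced_matching E {}" by (auto simp: induced_matching_def matching_def)
  then have "induced_matching_number E \<in> card ` {M. induced_matching E M}"
    unfolding induced_matching_number_def by (intro Max_in) auto
  then show ?thesis using that by auto
qed

text \<open>If the edges inside \<open>W\<close> formed a matching, it would be an induced one, so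
  it would have at most \<nu>(G) edges, and \<open>nonzero_cohom_matching\<close> would bound
  \<open>card W - q\<close> by \<nu>(G). Hence two distinct edges in \<open>W\<close> share a
  vertex.\<close>

lemma path_of_length_two_exists:
  assumes sg: "simple_graph E" and nz: "nonzero_cohom TYPE('k::field) E W q"
    and p: "induced_matching_number E + q < card W"
  obtains x y z where "{x, y} \<in> E" "{x, z} \<in> E" "{x, y, z} \<subseteq> W" "y \<noteq> z" "x \<noteq> y" "x \<noteq> z"
proof -
  let ?M = "{e \<in> E. e \<subseteq> W}"
  have "\<not> matching E ?M"
  proof
    assume M: "matching E ?M"
    then have "induced_matching E ?M"
      by (auto simp: induced_matching_def)
    from card_le_induced_matching_number[OF this] nonzero_cohom_matching[OF sg nz M] p
    show False by simp
  qed
  then obtain e f x where ef: "e \<in> E" "e \<subseteq> W" "f \<in> E" "f \<subseteq> W" "e \<noteq> f" "x \<in> e" "x \<in> f"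
    unfolding matching_def by blast
  obtain y where "e = {x, y}" "y \<noteq> x" using simple_graph_edgeE[OF sg ef(1,6)] .
  moreover obtain z where "f = {x, z}" "z \<noteq> x" using simple_graph_edgeE[OF sg ef(3,7)] .
  ultimately show ?thesis using ef that[of x y z] by auto
qed

lemma nonzero_cohom_subadditive:
  assumes sg: "simple_graph E" and nz: "nonzero_cohom TYPE('k::field) E W q"
    and b: "b = induced_matching_number E + 1" and p: "card W = a + b + q"
  shows "\<exists>W' q'. nonzero_cohom TYPE('k) E W' q' \<and> card W' = a + q' \<and> card W \<le> card W' + (2 * b - 1)"
proof -
  obtain x y z where xyz: "{x, y} \<in> E" "{x, z} \<in> E" "{x, y, z} \<subseteq> W" "y \<noteq> z" "x \<noteq> y" "x \<noteq> z"
    using path_of_length_two_exists[OF sg nz] b p by auto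
  have "induced_matching_number E \<noteq> 0"
  proof
    have "{e \<in> E. e \<subseteq> {x, y}} = {{x, y}}"
    proof (intro equalityI subsetI)
      fix e assume e: "e \<in> {e \<in> E. e \<subseteq> {x, y}}"
      then have "card e = card {x, y}" using sg xyz by (simp add: simple_graph_def)
      then show "e \<in> {{x, y}}" using e card_subset_eq[of "{x, y}" e] by auto
    qed (use xyz in auto)
    then have "induced_matching E {{x, y}}"
      using xyz by (auto simp: induced_matching_def matching_def)
    moreover assume "induced_matching_number E = 0"
    ultimately show False
      using card_le_induced_matching_number[of E "{{x, y}}"] by simp
  qed
  \<comment> \<open>A path step may use up two of the \<open>b\<close> units of index, so b \<ge> 2
    is required. The rest is done by edge steps, and the vertices lost number at most 1 + 2(b - 1),
    2 + 2(b - 2) or 3 + 2(b - 2), each at most 2b - 1.\<close>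
  then obtain c where c: "b = c + 2" using b by (metis Suc_eq_plus1 add_2_eq_Suc' not0_implies_Suc)
  have card: "card (W - {x}) = card W - 1" "card (W - {y, z}) = card W - 2"
    "card (W - {x, y, z}) = card W - 3"
    using xyz by (auto simp: card_Diff_subset)
  from nonzero_cohom_path_step[OF nz xyz(1-3)]
  consider "nonzero_cohom TYPE('k) E (W - {x}) q" | "nonzero_cohom TYPE('k) E (W - {y, z}) q"
    | q' where "q = Suc q'" "nonzero_cohom TYPE('k) E (W - {x, y, z}) q'"
    by blast
  then show ?thesis
  proof cases
    case 1
    from nonzero_cohom_descend[OF sg this, of a "c + 1"] card p c show ?thesis by fastforce
  next
    case 2
    from nonzero_cohom_descend[OF sg this, of a c] card p c show ?thesis by fastforce
  next
    case 3
    from nonzero_cohom_descend[OF sg 3(2), of a c] card p c 3(1) show ?thesis by fastforce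
  qed
qed


section \<open>Cross-polytopes and a nonzero class on 2\<nu>(G) + 1 vertices\<close>

definition transversals :: "'v::finite set set \<Rightarrow> 'v set set" where
  "transversals M = {\<sigma>. \<sigma> \<subseteq> \<Union>M \<and> (\<forall>e\<in>M. card (\<sigma> \<inter> e) = 1)}"

lemma transversals_insert:
  assumes "x \<notin> \<Union>M" "y \<notin> \<Union>M" "x \<noteq> y"
  shows "transversals (insert {x, y} M) = insert x ` transversals M \<union> insert y ` transversals M"
proof (intro equalityI subsetI)
  fix \<sigma> assume \<sigma>: "\<sigma> \<in> transversals (insert {x, y} M)"
  have "(\<sigma> - {x, y}) \<inter> e = \<sigma> \<inter> e" if "e \<in> M" for e using assms that by auto
  then have t: "\<sigma> - {x, y} \<in> transversals M"
    using \<sigma> by (auto simp: transversals_def)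
  have "card (\<sigma> \<inter> {x, y}) = 1" using \<sigma> by (auto simp: transversals_def)
  then obtain z where "\<sigma> \<inter> {x, y} = {z}" by (auto simp: card_1_singleton_iff)
  then have "\<sigma> = insert z (\<sigma> - {x, y})" "z = x \<or> z = y" by auto
  then have "\<sigma> = insert x (\<sigma> - {x, y}) \<or> \<sigma> = insert y (\<sigma> - {x, y})" by auto
  with t show "\<sigma> \<in> insert x ` transversals M \<union> insert y ` transversals M" by blast
next
  fix \<sigma> assume "\<sigma> \<in> insert x ` transversals M \<union> insert y ` transversals M"
  then obtain \<tau> z where \<tau>: "\<tau> \<in> transversals M" "\<sigma> = insert z \<tau>" "z = x \<or> z = y" by blast
  have sub: "\<tau> \<subseteq> \<Union>M" and c: "\<And>e. e \<in> M \<Longrightarrow> card (\<tau> \<inter> e) = 1"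
    using \<tau>(1) by (auto simp: transversals_def)
  have "\<sigma> \<inter> {x, y} = {z}" using \<tau> sub assms by auto
  then have "card (\<sigma> \<inter> {x, y}) = 1" by simp
  moreover have "\<sigma> \<inter> e = \<tau> \<inter> e" if "e \<in> M" for e using \<tau> assms that by auto
  ultimately show "\<sigma> \<in> transversals (insert {x, y} M)"
    using sub c \<tau> unfolding transversals_def by auto
qed

text \<open>The transversals of a set of disjoint edges are the facets of a sphere (the boundary of a
  cross-polytope), so a coboundary that vanishes on all facets but one vanishes on that facet too.\<close>

lemma cobd_transversals:
  fixes h :: "'v::finite set \<Rightarrow> 'k::comm_ring_1"
  assumes "finite M" "\<forall>e\<in>M. card e = 2" "\<forall>e\<in>M. \<forall>f\<in>M. e \<noteq> f \<longrightarrow> e \<inter> f = {}"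
    and "\<sigma> \<in> transversals M" "\<forall>\<tau>\<in>transversals M. \<tau> \<noteq> \<sigma> \<longrightarrow> cobd h \<tau> = 0"
  shows "cobd h \<sigma> = 0"
  using assms
proof (induction M arbitrary: h \<sigma> rule: finite_induct)
  case empty
  then show ?case by (simp add: transversals_def)
next
  case (insert e M)
  have disj: "e \<inter> \<Union>M = {}" using insert.prems(2) insert.hyps(2) by auto
  have "card e = 2" using insert.prems(1) by simp
  then obtain a b where ab: "e = {a, b}" "a \<noteq> b" by (auto simp: card_2_iff)
  have tr: "transversals (insert e M) = insert a ` transversals M \<union> insert b ` transversals M"
    using disj ab transversals_insert[of a M b] by auto
  obtain x y \<sigma>' where xy: "e = {x, y}" "x \<noteq> y" "\<sigma> = insert x \<sigma>'" "\<sigma>' \<in> transversals M"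
    using insert.prems(3) ab unfolding tr by (auto simp: insert_commute)
  have tr: "insert x \<tau> \<in> transversals (insert e M)" "insert y \<tau> \<in> transversals (insert e M)"
    if "\<tau> \<in> transversals M" for \<tau>
    using that ab xy unfolding tr by (auto simp: doubleton_eq_iff)
  have nin: "x \<notin> \<tau>" "y \<notin> \<tau>" if "\<tau> \<in> transversals M" for \<tau>
    using that disj xy by (auto simp: transversals_def)
  \<comment> \<open>Descends from the sphere of \<open>insert e M\<close> to that of
    \<open>M\<close>: by \<open>key\<close> below, \<open>cobd H \<tau>\<close> is up to sign the
    signed difference of the coboundaries of \<open>h\<close> at the two facets over
    \<open>\<tau>\<close>.\<close>
  define H where "H \<rho> = sg x \<rho> * h (insert x \<rho>) - sg y \<rho> * h (insert y \<rho>)" for \<rho>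
  have step: "sg z \<tau> * cobd h (insert z \<tau>)
      = h \<tau> - (\<Sum>u\<in>\<tau>. sg u (\<tau> - {u}) * (sg z (\<tau> - {u}) * h (insert z (\<tau> - {u}))))"
    if "z \<notin> \<tau>" for z \<tau>
  proof -
    have "cobd h (insert z \<tau>) = sg z \<tau> * h \<tau> +
        (\<Sum>u\<in>\<tau>. sg u (insert z (\<tau> - {u})) * h (insert z (\<tau> - {u})))"
    proof -
      have "insert z \<tau> - {z} = \<tau>" using that by auto
      moreover have "insert z \<tau> - {u} = insert z (\<tau> - {u})" if "u \<in> \<tau>" for u
        using that \<open>z \<notin> \<tau>\<close> by auto
      ultimately show ?thesis using that by (simp add: cobd_def)
    qed
    then have "sg z \<tau> * cobd h (insert z \<tau>) = h \<tau> +
        (\<Sum>u\<in>\<tau>. sg z \<tau> * (sg u (insert z (\<tau> - {u})) * h (insert z (\<tau> - {u}))))"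
      by (simp add: distrib_left sum_distrib_left)
    also have "(\<Sum>u\<in>\<tau>. sg z \<tau> * (sg u (insert z (\<tau> - {u})) * h (insert z (\<tau> - {u}))))
        = (\<Sum>u\<in>\<tau>. - (sg u (\<tau> - {u}) * (sg z (\<tau> - {u}) * h (insert z (\<tau> - {u})))))"
    proof (rule sum.cong)
      fix u assume u: "u \<in> \<tau>"
      define S where "S = \<tau> - {u}"
      have S: "\<tau> = insert u S" "u \<notin> S" "z \<notin> S" "u \<noteq> z"
        using u that by (auto simp: S_def)
      have "sg z (insert u S) * (sg u (insert z S) :: 'k) = - (sg u S * sg z S)"
        by (rule sg_mult_swap) (use S in auto)
      then have "sg z (insert u S) * (sg u (insert z S) * h (insert z S))
          = - (sg u S * (sg z S * h (insert z S)))"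
        by (metis mult.assoc mult_minus_left)
      then show "sg z \<tau> * (sg u (insert z (\<tau> - {u})) * h (insert z (\<tau> - {u})))
          = - (sg u (\<tau> - {u}) * (sg z (\<tau> - {u}) * h (insert z (\<tau> - {u}))))"
        unfolding S_def[symmetric] unfolding S(1) .
    qed simp
    finally show ?thesis by (simp add: sum_negf)
  qed
  have H: "cobd H \<tau> = (\<Sum>u\<in>\<tau>. sg u (\<tau> - {u}) * (sg x (\<tau> - {u}) * h (insert x (\<tau> - {u}))))
      - (\<Sum>u\<in>\<tau>. sg u (\<tau> - {u}) * (sg y (\<tau> - {u}) * h (insert y (\<tau> - {u}))))" for \<tau>
    unfolding cobd_def H_def by (simp add: right_diff_distrib sum_subtractf)
  have key: "sg x \<tau> * cobd h (insert x \<tau>) - sg y \<tau> * cobd h (insert y \<tau>) = - cobd H \<tau>"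
    if "\<tau> \<in> transversals M" for \<tau>
    unfolding step[OF nin(1)[OF that]] step[OF nin(2)[OF that]] H by simp
  \<comment> \<open>The exceptional facet \<open>\<sigma>\<close> contains \<open>x\<close> and not
    \<open>y\<close>, so every facet through \<open>y\<close> is among those on which the coboundary
    is assumed to vanish.\<close>
  have y0: "cobd h (insert y \<tau>) = 0" if "\<tau> \<in> transversals M" for \<tau>
    using insert.prems(4) tr(2)[OF that] nin[OF that] nin[OF xy(4)] xy(2,3) by auto
  have "cobd H \<sigma>' = 0"
  proof (rule insert.IH)
    show "\<forall>\<tau>\<in>transversals M. \<tau> \<noteq> \<sigma>' \<longrightarrow> cobd H \<tau> = 0"
    proof (intro ballI impI)
      fix \<tau> assume \<tau>: "\<tau> \<in> transversals M" "\<tau> \<noteq> \<sigma>'"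
      then have "insert x \<tau> \<noteq> \<sigma>" using nin(1)[OF \<tau>(1)] nin(1)[OF xy(4)] xy(3)
        by (metis insert_ident)
      then have "cobd h (insert x \<tau>) = 0" by (intro insert.prems(4)[rule_format] tr(1) \<tau>(1))
      then show "cobd H \<tau> = 0" using key[OF \<tau>(1)] y0[OF \<tau>(1)] by simp
    qed
  qed (use insert.prems xy in auto)
  then have "sg x \<sigma>' * cobd h \<sigma> = 0" using key[OF xy(4)] y0[OF xy(4)] xy(3) by simp
  then have "sg x \<sigma>' * (sg x \<sigma>' * cobd h \<sigma>) = 0" by simp
  then show ?case by simp
qed

lemma card_transversal:
  assumes "finite M" "\<forall>e\<in>M. \<forall>f\<in>M. e \<noteq> f \<longrightarrow> e \<inter> f = {}" "\<sigma> \<in> transversals M"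
  shows "card \<sigma> = card M"
proof -
  have "card (\<Union>e\<in>M. \<sigma> \<inter> e) = (\<Sum>e\<in>M. card (\<sigma> \<inter> e))"
    using assms by (intro card_UN_disjoint) auto
  moreover have "(\<Union>e\<in>M. \<sigma> \<inter> e) = \<sigma>" using assms(3) by (auto simp: transversals_def)
  ultimately show ?thesis using assms(3) by (simp add: transversals_def)
qed

lemma transversal_exists:
  assumes M: "finite M" "\<forall>e\<in>M. card e = 2" "\<forall>e\<in>M. \<forall>f\<in>M. e \<noteq> f \<longrightarrow> e \<inter> f = {}"
    and x: "x \<in> \<Union>M"
  obtains \<sigma> where "\<sigma> \<in> transversals M" "x \<in> \<sigma>"
proof -
  define c where "c e = (if x \<in> e then x else SOME y. y \<in> e)" for e
  have c: "c e \<in> e" if "e \<in> M" for e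
  proof -
    have "e \<noteq> {}" using M(2) that by auto
    then show ?thesis by (auto simp: c_def some_in_eq)
  qed
  have "c ` M \<inter> e = {c e}" if "e \<in> M" for e
    using c M(3) that by fastforce
  then have "c ` M \<in> transversals M" using c by (fastforce simp: transversals_def)
  moreover have "x \<in> c ` M" using x by (auto simp: c_def image_iff)
  ultimately show ?thesis using that by blast
qed

text \<open>The class is the indicator of one transversal \<open>\<sigma>\<close> through
  \<open>x\<close>. An independent set contains at most one end of each edge of \<open>M\<close>, so
  one with \<open>card M + 1\<close> elements contains \<open>v\<close>, hence not \<open>x\<close>,
  and cannot contain \<open>\<sigma>\<close>: the indicator is a cocycle. All transversals are
  faces, and a coboundary cannot be nonzero on exactly one of them.\<close>

lemma nonzero_cohom_matching_plus_vertex: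
  fixes E :: "'v::finite set set"
  assumes sg: "simple_graph E" and M: "induced_matching E M"
    and v: "v \<notin> \<Union>M" and x: "x \<in> \<Union>M" "{x, v} \<in> E"
  shows "nonzero_cohom TYPE('k::field) E (insert v (\<Union>M)) (card M)"
  unfolding nonzero_cohom_def
proof
  have "M \<subseteq> E" and disj: "\<forall>e\<in>M. \<forall>f\<in>M. e \<noteq> f \<longrightarrow> e \<inter> f = {}"
    and ind: "\<And>e. e \<in> E \<Longrightarrow> e \<subseteq> \<Union>M \<Longrightarrow> e \<in> M"
    using M by (auto simp: induced_matching_def matching_def)
  then have c2: "\<forall>e\<in>M. card e = 2" using sg by (auto simp: simple_graph_def)
  obtain \<sigma> where \<sigma>: "\<sigma> \<in> transversals M" "x \<in> \<sigma>"
    using transversal_exists[OF _ c2 disj x(1)] by auto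
  have tri: "\<tau> \<in> indep E (insert v (\<Union>M))" if "\<tau> \<in> transversals M" for \<tau>
  proof -
    have "\<not> e \<subseteq> \<tau>" if "e \<in> E" for e
    proof
      assume e: "e \<subseteq> \<tau>"
      then have "e \<in> M" using ind[OF that] \<open>\<tau> \<in> _\<close> by (auto simp: transversals_def)
      then have "card (\<tau> \<inter> e) = 1" "card e = 2" using c2 \<open>\<tau> \<in> transversals M\<close> by (auto simp: transversals_def)
      moreover have "\<tau> \<inter> e = e" using e by auto
      ultimately show False by simp
    qed
    then show ?thesis using that by (auto simp: indep_def transversals_def)
  qed
  have cM: "card \<tau> = card M" if "\<tau> \<in> transversals M" for \<tau>
    using card_transversal[OF _ disj that] by simp
  define g :: "'v set \<Rightarrow> 'k" where "g \<tau> = (if \<tau> = \<sigma> then 1 else 0)" for \<tau>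
  have cocycle: "cobd g \<rho> = 0" if \<rho>: "\<rho> \<in> indep E (insert v (\<Union>M))" "card \<rho> = Suc (card M)" for \<rho>
  proof -
    have "\<not> \<rho> \<subseteq> \<Union>M"
    proof
      assume sub: "\<rho> \<subseteq> \<Union>M"
      have "card (\<Union>e\<in>M. \<rho> \<inter> e) \<le> (\<Sum>e\<in>M. card (\<rho> \<inter> e))" by (rule card_UN_le) simp
      also have "\<dots> \<le> (\<Sum>e\<in>M. 1)"
      proof (rule sum_mono)
        fix e assume e: "e \<in> M"
        then have "\<not> e \<subseteq> \<rho>" using \<rho>(1) \<open>M \<subseteq> E\<close> by (auto simp: indep_def)
        then have "card (\<rho> \<inter> e) < card e" by (intro psubset_card_mono) auto
        then show "card (\<rho> \<inter> e) \<le> 1" using c2 e by auto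
      qed
      also have "(\<Union>e\<in>M. \<rho> \<inter> e) = \<rho>" using sub by auto
      finally show False using \<rho>(2) by simp
    qed
    then have v\<rho>: "v \<in> \<rho>" using \<rho>(1) by (auto simp: indep_def)
    have "x \<notin> \<rho>" using \<rho>(1) x(2) v\<rho> by (auto simp: indep_def)
    then have "\<rho> - {u} \<noteq> \<sigma>" for u using \<sigma>(2) by auto
    then show ?thesis by (simp add: cobd_def g_def)
  qed
  assume zero: "cohom_zero TYPE('k) (indep E (insert v (\<Union>M))) (card M)"
  obtain h where h: "\<And>\<tau>. \<tau> \<in> indep E (insert v (\<Union>M)) \<Longrightarrow> card \<tau> = card M \<Longrightarrow> g \<tau> = cobd h \<tau>"
    by (rule cohom_zeroD[OF zero cocycle]) (auto intro: that)
  have "cobd h \<sigma> = 0"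
  proof (rule cobd_transversals[OF _ c2 disj \<sigma>(1)])
    show "\<forall>\<tau>\<in>transversals M. \<tau> \<noteq> \<sigma> \<longrightarrow> cobd h \<tau> = 0"
      using h tri cM by (metis g_def)
  qed simp
  then show False using h[OF tri[OF \<sigma>(1)] cM[OF \<sigma>(1)]] by (simp add: g_def)
qed

text \<open>The vertex to add is a neighbour of a maximum induced matching. If none existed, every
  edge would be in \<open>M\<close> or disjoint from all of it; one of the latter could be added to
  \<open>M\<close>, so by maximality all edges would lie in \<open>M\<close>, contrary to the two
  edges meeting in \<open>x\<close>.\<close>

lemma nonzero_cohom_induced_matching_number:
  assumes sg: "simple_graph E" and xyz: "{x, y} \<in> E" "{x, z} \<in> E" "y \<noteq> z"
  shows "\<exists>W. nonzero_cohom TYPE('k::field) E W (induced_matching_number E) \<and>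
    card W = 2 * induced_matching_number E + 1"
proof -
  obtain M where M: "induced_matching E M" "card M = induced_matching_number E"
    by (rule maximum_induced_matching)
  have "M \<subseteq> E" and disj: "\<And>e f. e\<in>M \<Longrightarrow> f\<in>M \<Longrightarrow> e \<noteq> f \<Longrightarrow> e \<inter> f = {}"
    and ind: "\<And>e. e \<in> E \<Longrightarrow> e \<subseteq> \<Union>M \<Longrightarrow> e \<in> M"
    using M by (auto simp: induced_matching_def matching_def)
  have c2: "card e = 2" if "e \<in> E" for e using sg that by (auto simp: simple_graph_def)
  have "\<exists>u v. u \<in> \<Union>M \<and> v \<notin> \<Union>M \<and> {u, v} \<in> E"
  proof (rule ccontr)
    assume neg: "\<not> ?thesis"
    have in_or_disj: "e \<in> M" if e: "e \<in> E" "e \<inter> \<Union>M \<noteq> {}" for e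
    proof -
      obtain u where u: "u \<in> e" "u \<in> \<Union>M" using e by blast
      obtain w where w: "e = {u, w}" using simple_graph_edgeE[OF sg e(1) u(1)] by blast
      then have "w \<in> \<Union>M" using neg u e by blast
      then show ?thesis using ind[OF e(1)] w u by blast
    qed
    have all: "e \<in> M" if e: "e \<in> E" for e
    proof (rule ccontr)
      assume nM: "e \<notin> M"
      then have d: "e \<inter> \<Union>M = {}" using in_or_disj e by blast
      have "{f \<in> E. f \<subseteq> \<Union>(insert e M)} = insert e M"
      proof (intro equalityI subsetI)
        fix f assume f: "f \<in> {f \<in> E. f \<subseteq> \<Union>(insert e M)}"
        show "f \<in> insert e M"
        proof (cases "f \<inter> \<Union>M = {}")
          case True
          then have "f \<subseteq> e" using f by auto
          then show ?thesis using c2[of f] c2[OF e] f card_subset_eq[of e f] by auto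
        qed (use in_or_disj f in auto)
      qed (use e \<open>M \<subseteq> E\<close> in auto)
      moreover have "matching E (insert e M)"
        using d disj e \<open>M \<subseteq> E\<close> unfolding matching_def by blast
      ultimately have "induced_matching E (insert e M)" by (simp add: induced_matching_def)
      from card_le_induced_matching_number[OF this] M(2) nM show False by simp
    qed
    have "{x, y} \<inter> {x, z} = {}" using disj[of "{x, y}" "{x, z}"] all xyz by (auto simp: doubleton_eq_iff)
    then show False by simp
  qed
  then obtain u v where uv: "u \<in> \<Union>M" "v \<notin> \<Union>M" "{u, v} \<in> E" by blast
  have "card (\<Union>M) = (\<Sum>e\<in>M. card e)"
    using disj by (intro card_Union_disjoint) (auto simp: pairwise_def disjnt_def)
  also have "\<dots> = 2 * card M" using c2 \<open>M \<subseteq> E\<close> by (simp add: subset_eq)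
  finally have "card (insert v (\<Union>M)) = 2 * induced_matching_number E + 1"
    using uv(2) M(2) by simp
  then show ?thesis
    using nonzero_cohom_matching_plus_vertex[OF sg M(1) uv(2,1,3), where 'k='k] M(2) by auto
qed

section \<open>Multidegrees and Koszul homology\<close>

abbreviation "lookup \<equiv> Poly_Mapping.lookup"
abbreviation "keys \<equiv> Poly_Mapping.keys"
abbreviation "single \<equiv> Poly_Mapping.single"

lemma poly_mapping_sum_single: "p = (\<Sum>\<gamma>\<in>keys p. single \<gamma> (lookup p \<gamma>))"
proof (rule poly_mapping_eqI)
  fix k
  have "(\<Sum>\<gamma>\<in>keys p. lookup (single \<gamma> (lookup p \<gamma>)) k)
      = (\<Sum>\<gamma>\<in>keys p. if \<gamma> = k then lookup p k else 0)"
    by (intro sum.cong) (auto simp: lookup_single when_def)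
  also have "\<dots> = lookup p k" by (simp add: in_keys_iff)
  finally show "lookup p k = lookup (\<Sum>\<gamma>\<in>keys p. single \<gamma> (lookup p \<gamma>)) k"
    by (simp add: lookup_sum)
qed

lemma lookup_single_times:
  fixes p :: "('v \<Rightarrow>\<^sub>0 nat) \<Rightarrow>\<^sub>0 'k::comm_ring_1"
  shows "lookup (single k a * p) (k + \<gamma>) = a * lookup p \<gamma>"
proof -
  have "single k a * p = (\<Sum>\<delta>\<in>keys p. single (k + \<delta>) (a * lookup p \<delta>))"
    by (subst (1) poly_mapping_sum_single[of p]) (simp add: sum_distrib_left mult_single)
  then have "lookup (single k a * p) (k + \<gamma>) = (\<Sum>\<delta>\<in>keys p. if \<delta> = \<gamma> then a * lookup p \<gamma> else 0)"
    by (auto simp: lookup_sum lookup_single when_def intro!: sum.cong)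
  then show ?thesis by (simp add: in_keys_iff)
qed

lemma lookup_single_times_eq_0:
  fixes p :: "('v \<Rightarrow>\<^sub>0 nat) \<Rightarrow>\<^sub>0 'k::comm_ring_1"
  assumes "\<And>\<gamma>. \<beta> \<noteq> k + \<gamma>"
  shows "lookup (single k a * p) \<beta> = 0"
proof -
  have "\<beta> \<notin> keys (single k a * p)"
    using keys_mult[of "single k a" p] assms by (auto split: if_splits)
  then show ?thesis by (simp add: in_keys_iff)
qed

lemma lookup_X_times:
  fixes p :: "('v, 'k::field) mpoly"
  shows "lookup (X v * p) \<beta> = (if lookup \<beta> v = 0 then 0 else lookup p (\<beta> - single v 1))"
proof (cases "lookup \<beta> v = 0")
  case True
  have "\<beta> \<noteq> single v 1 + \<gamma>" for \<gamma>
    using True by (auto simp: lookup_add)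
  then show ?thesis using True by (simp add: X_def lookup_single_times_eq_0)
next
  case False
  have "single v 1 + (\<beta> - single v 1) = \<beta>"
    using False by (intro poly_mapping_eqI) (auto simp: lookup_add lookup_minus lookup_single when_def)
  with lookup_single_times[of "single v 1" 1 p "\<beta> - single v 1"] False
  show ?thesis by (simp add: X_def)
qed

definition indicator_exp :: "'v::finite set \<Rightarrow> ('v \<Rightarrow>\<^sub>0 nat)" where
  "indicator_exp T = (\<Sum>v\<in>T. single v 1)"

lemma lookup_indicator_exp [simp]: "lookup (indicator_exp T) v = (if v \<in> T then 1 else 0)"
proof -
  have "lookup (indicator_exp T) v = (\<Sum>u\<in>T. if u = v then 1 else 0)"
    unfolding indicator_exp_def by (auto simp: lookup_sum lookup_single when_def intro!: sum.cong)
  then show ?thesis by simp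
qed

lemma mdeg_indicator_exp [simp]: "mdeg (indicator_exp T) = card T"
  by (simp add: mdeg_def sum.If_cases)

lemma mdeg_add [simp]: "mdeg (\<alpha> + \<beta>) = mdeg \<alpha> + mdeg \<beta>"
  by (simp add: mdeg_def lookup_add sum.distrib)

lemma mdeg_zero [simp]: "mdeg 0 = 0"
  by (simp add: mdeg_def)

lemma mdeg_eq_0_iff: "mdeg \<alpha> = 0 \<longleftrightarrow> \<alpha> = 0"
  by (auto simp: mdeg_def intro: poly_mapping_eqI)

lemma mdeg_single [simp]: "mdeg (single v n) = n"
proof -
  have "mdeg (single v n) = (\<Sum>u\<in>UNIV. if u = v then n else 0)"
    unfolding mdeg_def by (auto simp: lookup_single when_def intro!: sum.cong)
  then show ?thesis by simp
qed

lemma indicator_exp_add_diff: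
  assumes "T \<subseteq> keys \<alpha>"
  shows "\<alpha> - indicator_exp T + indicator_exp T = \<alpha>"
proof (rule poly_mapping_eqI)
  fix v
  show "lookup (\<alpha> - indicator_exp T + indicator_exp T) v = lookup \<alpha> v"
    using assms by (cases "v \<in> T") (auto simp: lookup_add lookup_minus in_keys_iff subset_iff Suc_leI)
qed

lemma mdeg_diff_indicator_exp: "T \<subseteq> keys \<alpha> \<Longrightarrow> int (mdeg (\<alpha> - indicator_exp T)) = int (mdeg \<alpha>) - int (card T)"
  using arg_cong[OF indicator_exp_add_diff, of T \<alpha> mdeg] by simp

lemma finite_mdeg: "finite {\<beta> :: 'v::finite \<Rightarrow>\<^sub>0 nat. int (mdeg \<beta>) = e}"
proof -
  have "lookup ` {\<beta> :: 'v \<Rightarrow>\<^sub>0 nat. int (mdeg \<beta>) = e} \<subseteq> PiE UNIV (\<lambda>_. {..nat e})"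
  proof
    fix f assume "f \<in> lookup ` {\<beta> :: 'v \<Rightarrow>\<^sub>0 nat. int (mdeg \<beta>) = e}"
    then obtain \<beta> where \<beta>: "f = lookup \<beta>" "int (mdeg \<beta>) = e" by auto
    have "lookup \<beta> v \<le> mdeg \<beta>" for v
      unfolding mdeg_def by (rule member_le_sum) auto
    then show "f \<in> PiE UNIV (\<lambda>_. {..nat e})" using \<beta> by (auto simp: PiE_def Pi_def)
  qed
  then have "finite (lookup ` {\<beta> :: 'v \<Rightarrow>\<^sub>0 nat. int (mdeg \<beta>) = e})"
    by (rule finite_subset) (simp add: finite_PiE)
  then show ?thesis
    by (rule finite_imageD) (simp add: inj_on_def poly_mapping.lookup_inject)
qed

text \<open>Fixing the degree makes the sum finite, so coefficients may be prescribed freely.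
  Degrees are integers because expressions like \<open>d - int q\<close> can be negative; the
  polynomial is then 0.\<close>

definition homogeneous_poly :: "int \<Rightarrow> (('v::finite \<Rightarrow>\<^sub>0 nat) \<Rightarrow> 'k) \<Rightarrow> ('v, 'k::field) mpoly" where
  "homogeneous_poly e h = (\<Sum>\<beta>\<in>{\<beta>. int (mdeg \<beta>) = e}. single \<beta> (h \<beta>))"

lemma lookup_homogeneous_poly:
  "lookup (homogeneous_poly e h) \<beta> = (if int (mdeg \<beta>) = e then h \<beta> else 0)"
proof -
  have "lookup (homogeneous_poly e h) \<beta>
      = (\<Sum>\<gamma>\<in>{\<beta>. int (mdeg \<beta>) = e}. if \<gamma> = \<beta> then h \<beta> else 0)"
    unfolding homogeneous_poly_def by (auto simp: lookup_sum lookup_single when_def intro!: sum.cong)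
  then show ?thesis by (simp add: finite_mdeg)
qed

lemma homogeneous_iff: "homogeneous d p \<longleftrightarrow> (\<forall>\<beta>. int (mdeg \<beta>) \<noteq> d \<longrightarrow> lookup p \<beta> = 0)"
  by (auto simp: homogeneous_def in_keys_iff)

lemma homogeneous_homogeneous_poly: "homogeneous e (homogeneous_poly e h)"
  by (simp add: homogeneous_iff lookup_homogeneous_poly)

section \<open>The Koszul complex and its multigraded strands\<close>

lemma sg_cases: "(sg v S = (1::'r::comm_ring_1) \<and> sg v S = (1::'s::comm_ring_1)) \<or>
    (sg v S = (-1::'r) \<and> sg v S = (-1::'s))"
  by (induction S rule: infinite_finite_induct) (auto simp: sg_insert)

lemma lookup_sg_times: "lookup (sg v S * p) \<beta> = sg v S * lookup (p :: ('v::finite, 'k::field) mpoly) \<beta>"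
  using sg_cases[of v S, where 'r="('v, 'k) mpoly" and 's='k] by auto

text \<open>A function \<open>c\<close> stands for the Koszul chain with coefficient
  \<open>c T\<close> at the exterior generator e_T; the value is the coefficient at e_S of its
  boundary. Chains of different lengths share one type, and the length is imposed by looking only at
  sets of one cardinality.\<close>

definition koszul_d ::
  "(('v::finite, 'k::field) mpoly \<Rightarrow> 'm \<Rightarrow> 'm) \<Rightarrow> ('v set \<Rightarrow> 'm) \<Rightarrow> 'v set \<Rightarrow> 'm::ab_group_add" where
  "koszul_d s c S = (\<Sum>v\<in>-S. s (sg v S * X v) (c (insert v S)))"

text \<open>In multidegree \<open>\<alpha>\<close> the coefficient at e_T contributes only its
  monomial with exponent \<open>\<alpha> - indicator_exp T\<close>, so the boundary becomes a signed
  sum of scalars. Variables outside \<open>keys \<alpha>\<close> drop out because they do not divide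
  the monomial.\<close>

lemma lookup_koszul_d:
  fixes c :: "'v::finite set \<Rightarrow> ('v, 'k::field) mpoly"
  assumes S: "S \<subseteq> keys \<alpha>"
  shows "lookup (koszul_d (*) c S) (\<alpha> - indicator_exp S)
    = (\<Sum>v\<in>keys \<alpha> - S. sg v S * lookup (c (insert v S)) (\<alpha> - indicator_exp (insert v S)))"
proof -
  have "lookup (koszul_d (*) c S) (\<alpha> - indicator_exp S)
      = (\<Sum>v\<in>-S. if v \<in> keys \<alpha> then sg v S * lookup (c (insert v S)) (\<alpha> - indicator_exp (insert v S)) else 0)"
    unfolding koszul_d_def lookup_sum
  proof (rule sum.cong)
    fix v assume v: "v \<in> - S"
    have "\<alpha> - indicator_exp S - single v 1 = \<alpha> - indicator_exp (insert v S)"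
      using v by (intro poly_mapping_eqI) (auto simp: lookup_minus lookup_single when_def)
    then show "lookup (sg v S * X v * c (insert v S)) (\<alpha> - indicator_exp S)
        = (if v \<in> keys \<alpha> then sg v S * lookup (c (insert v S)) (\<alpha> - indicator_exp (insert v S)) else 0)"
      using v by (simp add: mult.assoc lookup_sg_times lookup_X_times lookup_minus in_keys_iff)
  qed simp
  also have "\<dots> = (\<Sum>v\<in>keys \<alpha> - S. sg v S * lookup (c (insert v S)) (\<alpha> - indicator_exp (insert v S)))"
    by (intro sum.mono_neutral_cong_right) auto
  finally show ?thesis .
qed

text \<open>The indexing of the Koszul complex in a squarefree multidegree \<open>P\<close>: a set \<open>T\<close> of exterior
  generators corresponds to the face \<open>P - T\<close>.\<close>

definition koszul_zero :: "'k::field itself \<Rightarrow> 'v::finite set \<Rightarrow> 'v set set \<Rightarrow> nat \<Rightarrow> bool" where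
  "koszul_zero K P \<Gamma> q \<longleftrightarrow> (\<forall>f :: 'v set \<Rightarrow> 'k.
     (\<forall>S\<subseteq>P. P - S \<in> \<Gamma> \<and> Suc (card S) = q \<longrightarrow> (\<Sum>v\<in>P - S. sg v S * f (insert v S)) = 0) \<longrightarrow>
     (\<exists>h. \<forall>T\<subseteq>P. P - T \<in> \<Gamma> \<and> card T = q \<longrightarrow> f T = (\<Sum>v\<in>P - T. sg v T * h (insert v T))))"

lemma koszul_zero_trivial: "card P < q \<Longrightarrow> koszul_zero K P \<Gamma> q"
  unfolding koszul_zero_def by (metis card_mono finite not_le)

text \<open>Complements turn the Koszul boundary into the coboundary up to the sign correction
  \<open>\<theta>\<close>. It fits because, for v outside S, the sign of v relative to P - {v} is
  the product of its cochain sign, relative to P - S - {v}, and its Koszul sign, relative to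
  S.\<close>

lemma koszul_zero_iff:
  fixes P :: "'v::finite set"
  assumes \<Gamma>: "\<Gamma> \<subseteq> Pow P" and m: "card P = m + q"
  shows "koszul_zero TYPE('k::field) P \<Gamma> q \<longleftrightarrow> cohom_zero TYPE('k) \<Gamma> m"
proof -
  define \<theta> :: "'v set \<Rightarrow> 'k" where "\<theta> T = (\<Prod>v\<in>T. sg v (P - {v}))" for T
  have \<theta>2: "\<theta> T * \<theta> T = 1" for T
    unfolding \<theta>_def by (simp add: prod.distrib[symmetric])
  have \<theta>2': "\<theta> T * (\<theta> T * x) = x" for T x
    by (simp add: mult.assoc[symmetric] \<theta>2)
  have key: "cobd (\<lambda>\<sigma>. \<theta> (P - \<sigma>) * f (P - \<sigma>)) (P - S)
      = \<theta> S * (\<Sum>v\<in>P - S. sg v S * f (insert v S))" if S: "S \<subseteq> P" for S f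
    unfolding cobd_def sum_distrib_left
  proof (rule sum.cong)
    fix v assume v: "v \<in> P - S"
    have 1: "P - (P - S - {v}) = insert v S" using v S by auto
    have 2: "P - {v} = (P - S - {v}) \<union> S" using v S by auto
    have "sg v (P - {v}) = sg v (P - S - {v}) * (sg v S :: 'k)"
      unfolding 2 by (subst sg_union) auto
    then have "\<theta> (insert v S) = sg v (P - S - {v}) * sg v S * \<theta> S"
      using v by (simp add: \<theta>_def)
    then show "sg v (P - S - {v}) * (\<theta> (P - (P - S - {v})) * f (P - (P - S - {v})))
        = \<theta> S * (sg v S * f (insert v S))"
      unfolding 1 by (simp add: mult.assoc)
  qed simp
  have sub: "P - (P - T) = T" if "T \<subseteq> P" for T using that by auto
  have cardP: "card (P - T) = card P - card T" "card T \<le> card P" if "T \<subseteq> P" for T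
    using that by (auto simp: card_Diff_subset card_mono)
  show ?thesis
  proof
    assume kz: "koszul_zero TYPE('k) P \<Gamma> q"
    show "cohom_zero TYPE('k) \<Gamma> m"
      unfolding cohom_zero_def
    proof (intro allI impI)
      fix g :: "'v set \<Rightarrow> 'k"
      assume g: "\<forall>\<sigma>\<in>\<Gamma>. card \<sigma> = Suc m \<longrightarrow> cobd g \<sigma> = 0"
      define f where "f T = \<theta> T * g (P - T)" for T
      have gf: "\<theta> (P - \<sigma>) * f (P - \<sigma>) = g \<sigma>" if "\<sigma> \<subseteq> P" for \<sigma>
        using that by (simp add: f_def \<theta>2' sub)
      have "\<forall>S\<subseteq>P. P - S \<in> \<Gamma> \<and> Suc (card S) = q \<longrightarrow> (\<Sum>v\<in>P - S. sg v S * f (insert v S)) = 0"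
      proof (intro allI impI)
        fix S assume S: "S \<subseteq> P" "P - S \<in> \<Gamma> \<and> Suc (card S) = q"
        have "card (P - S) = Suc m" using S(2) cardP[OF S(1)] m by auto
        then have "cobd g (P - S) = 0" using g S by blast
        also have "cobd g (P - S) = cobd (\<lambda>\<sigma>. \<theta> (P - \<sigma>) * f (P - \<sigma>)) (P - S)"
        proof (rule cobd_cong)
          fix v show "g (P - S - {v}) = \<theta> (P - (P - S - {v})) * f (P - (P - S - {v}))"
            by (rule gf[symmetric]) auto
        qed
        also have "\<dots> = \<theta> S * (\<Sum>v\<in>P - S. sg v S * f (insert v S))" by (rule key[OF S(1)])
        finally have "\<theta> S * (\<theta> S * (\<Sum>v\<in>P - S. sg v S * f (insert v S))) = 0" by simp
        then show "(\<Sum>v\<in>P - S. sg v S * f (insert v S)) = 0" by (simp only: \<theta>2')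
      qed
      then obtain h where h: "\<forall>T\<subseteq>P. P - T \<in> \<Gamma> \<and> card T = q \<longrightarrow> f T = (\<Sum>v\<in>P - T. sg v T * h (insert v T))"
        using kz unfolding koszul_zero_def by blast
      have "g \<sigma> = cobd (\<lambda>\<sigma>. \<theta> (P - \<sigma>) * h (P - \<sigma>)) \<sigma>" if \<sigma>: "\<sigma> \<in> \<Gamma>" "card \<sigma> = m" for \<sigma>
      proof -
        have P: "\<sigma> \<subseteq> P" using \<sigma> \<Gamma> by auto
        then have "f (P - \<sigma>) = (\<Sum>v\<in>P - (P - \<sigma>). sg v (P - \<sigma>) * h (insert v (P - \<sigma>)))"
          using h[rule_format, of "P - \<sigma>"] \<sigma> cardP[OF P] m by (simp add: sub)
        then show ?thesis using key[of "P - \<sigma>" h] gf[OF P] by (simp add: sub[OF P])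
      qed
      then show "\<exists>h. \<forall>\<sigma>\<in>\<Gamma>. card \<sigma> = m \<longrightarrow> g \<sigma> = cobd h \<sigma>" by blast
    qed
  next
    assume cz: "cohom_zero TYPE('k) \<Gamma> m"
    show "koszul_zero TYPE('k) P \<Gamma> q"
      unfolding koszul_zero_def
    proof (intro allI impI)
      fix f :: "'v set \<Rightarrow> 'k"
      assume f: "\<forall>S\<subseteq>P. P - S \<in> \<Gamma> \<and> Suc (card S) = q \<longrightarrow> (\<Sum>v\<in>P - S. sg v S * f (insert v S)) = 0"
      define g where "g \<sigma> = \<theta> (P - \<sigma>) * f (P - \<sigma>)" for \<sigma>
      have cocycle: "cobd g \<sigma> = 0" if \<sigma>: "\<sigma> \<in> \<Gamma>" "card \<sigma> = Suc m" for \<sigma>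
      proof -
        have P: "\<sigma> \<subseteq> P" using \<sigma> \<Gamma> by auto
        have "Suc (card (P - \<sigma>)) = q" using cardP[OF P] \<sigma> m by auto
        then show ?thesis
          using key[of "P - \<sigma>" f] f[rule_format, of "P - \<sigma>"] \<sigma> by (simp add: sub[OF P] g_def[abs_def])
      qed
      obtain H where H: "\<And>\<sigma>. \<sigma> \<in> \<Gamma> \<Longrightarrow> card \<sigma> = m \<Longrightarrow> g \<sigma> = cobd H \<sigma>"
        by (rule cohom_zeroD[OF cz cocycle]) (auto intro: that)
      define h where "h T = \<theta> T * H (P - T)" for T
      have Hh: "H \<sigma> = \<theta> (P - \<sigma>) * h (P - \<sigma>)" if "\<sigma> \<subseteq> P" for \<sigma>
        using that by (simp add: h_def \<theta>2' sub)
      have "f T = (\<Sum>v\<in>P - T. sg v T * h (insert v T))"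
        if T: "T \<subseteq> P" "P - T \<in> \<Gamma> \<and> card T = q" for T
      proof -
        have "card (P - T) = m" using T cardP[OF T(1)] m by auto
        then have "\<theta> T * f T = cobd H (P - T)" using H[of "P - T"] T by (simp add: g_def sub)
        also have "\<dots> = cobd (\<lambda>\<sigma>. \<theta> (P - \<sigma>) * h (P - \<sigma>)) (P - T)"
          by (rule cobd_cong, rule Hh) auto
        also have "\<dots> = \<theta> T * (\<Sum>v\<in>P - T. sg v T * h (insert v T))" by (rule key[OF T(1)])
        finally have "\<theta> T * (\<theta> T * f T) = \<theta> T * (\<theta> T * (\<Sum>v\<in>P - T. sg v T * h (insert v T)))"
          by simp
        then show ?thesis by (simp only: \<theta>2')
      qed
      then show "\<exists>h. \<forall>T\<subseteq>P. P - T \<in> \<Gamma> \<and> card T = q \<longrightarrow> f T = (\<Sum>v\<in>P - T. sg v T * h (insert v T))"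
        by blast
    qed
  qed
qed

text \<open>Vanishing in degree \<open>d\<close> of the \<open>q\<close>-th Koszul homology of the quotient by \<open>B\<close> of the graded
  module with homogeneous components \<open>G\<close>. Only the values of a chain on sets of the right
  cardinality matter.\<close>

definition koszul_vanishes ::
  "(('v::finite, 'k::field) mpoly \<Rightarrow> 'm \<Rightarrow> 'm) \<Rightarrow> (int \<Rightarrow> 'm set) \<Rightarrow> 'm::ab_group_add set \<Rightarrow> nat \<Rightarrow> int \<Rightarrow> bool" where
  "koszul_vanishes s G B q d \<longleftrightarrow> (\<forall>c :: 'v set \<Rightarrow> 'm.
     (\<forall>T. card T = q \<longrightarrow> c T \<in> G (d - int q)) \<and> (\<forall>S. Suc (card S) = q \<longrightarrow> koszul_d s c S \<in> B) \<longrightarrow>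
     (\<exists>b. (\<forall>T. card T = Suc q \<longrightarrow> b T \<in> G (d - int (Suc q))) \<and>
          (\<forall>T. card T = q \<longrightarrow> c T - koszul_d s b T \<in> B)))"

text \<open>The boundary equation may be solved in each multidegree separately. Exponents in
  \<open>N\<close> are disregarded, which amounts to computing modulo the monomials with exponents
  in \<open>N\<close>.\<close>

lemma koszul_glue:
  fixes c :: "'v::finite set \<Rightarrow> ('v, 'k::field) mpoly"
  assumes c: "\<And>T. card T = q \<Longrightarrow> homogeneous (d - int q) (c T)"
    and loc: "\<And>\<alpha>. int (mdeg \<alpha>) = d \<Longrightarrow> \<exists>h. \<forall>T\<subseteq>keys \<alpha>. \<alpha> - indicator_exp T \<notin> N \<and> card T = q \<longrightarrow>
      lookup (c T) (\<alpha> - indicator_exp T) = (\<Sum>v\<in>keys \<alpha> - T. sg v T * h (insert v T))"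
  obtains b where "\<And>T. homogeneous (d - int (Suc q)) (b T)"
    "\<And>T. card T = q \<Longrightarrow> keys (c T - koszul_d (*) b T) \<subseteq> N"
proof -
  define h where "h \<alpha> = (SOME h. \<forall>T\<subseteq>keys \<alpha>. \<alpha> - indicator_exp T \<notin> N \<and> card T = q \<longrightarrow>
      lookup (c T) (\<alpha> - indicator_exp T) = (\<Sum>v\<in>keys \<alpha> - T. sg v T * h (insert v T)))" for \<alpha>
  have h: "lookup (c T) (\<alpha> - indicator_exp T) = (\<Sum>v\<in>keys \<alpha> - T. sg v T * h \<alpha> (insert v T))"
    if "int (mdeg \<alpha>) = d" "T \<subseteq> keys \<alpha>" "\<alpha> - indicator_exp T \<notin> N" "card T = q" for \<alpha> T
    using someI_ex[OF loc[OF that(1)], folded h_def] that by blast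
  \<comment> \<open>The monomial with exponent \<beta> at e_T has multidegree
    \<open>\<beta> + indicator_exp T\<close>, so its coefficient is taken from the solution
    there.\<close>
  define b where "b T = homogeneous_poly (d - int (Suc q)) (\<lambda>\<beta>. h (\<beta> + indicator_exp T) T)" for T
  have "keys (c T - koszul_d (*) b T) \<subseteq> N" if T: "card T = q" for T
  proof
    fix \<beta> assume \<beta>: "\<beta> \<in> keys (c T - koszul_d (*) b T)"
    define \<alpha> where "\<alpha> = \<beta> + indicator_exp T"
    have "\<beta> + indicator_exp T - indicator_exp T = \<beta>" by simp
    then have \<beta>\<alpha>: "\<beta> = \<alpha> - indicator_exp T" by (simp add: \<alpha>_def)
    have Ta: "T \<subseteq> keys \<alpha>" by (auto simp: \<alpha>_def in_keys_iff lookup_add)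
    have kd: "lookup (koszul_d (*) b T) \<beta>
        = (\<Sum>v\<in>keys \<alpha> - T. sg v T * lookup (b (insert v T)) (\<alpha> - indicator_exp (insert v T)))"
      unfolding \<beta>\<alpha> by (rule lookup_koszul_d[OF Ta])
    have bv: "lookup (b (insert v T)) (\<alpha> - indicator_exp (insert v T))
        = (if int (mdeg \<alpha>) = d then h \<alpha> (insert v T) else 0)" if v: "v \<in> keys \<alpha> - T" for v
    proof -
      have sub: "insert v T \<subseteq> keys \<alpha>" using v Ta by auto
      have "int (mdeg (\<alpha> - indicator_exp (insert v T))) = int (mdeg \<alpha>) - int (Suc q)"
        using v T by (subst mdeg_diff_indicator_exp[OF sub]) simp
      then show ?thesis
        by (simp add: b_def lookup_homogeneous_poly indicator_exp_add_diff[OF sub])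
    qed
    show "\<beta> \<in> N"
    proof (rule ccontr)
      assume N: "\<beta> \<notin> N"
      have "lookup (c T) \<beta> = lookup (koszul_d (*) b T) \<beta>"
      proof (cases "int (mdeg \<alpha>) = d")
        case True
        then show ?thesis using h[OF True Ta _ T] N \<beta>\<alpha> kd bv by simp
      next
        case False
        then have "int (mdeg \<beta>) \<noteq> d - int q" using T by (simp add: \<alpha>_def)
        then have "lookup (c T) \<beta> = 0" using c[OF T] by (simp add: homogeneous_iff)
        moreover have "lookup (koszul_d (*) b T) \<beta> = 0" unfolding kd using bv False by simp
        ultimately show ?thesis by simp
      qed
      then show False using \<beta> by (simp add: in_keys_iff lookup_minus)
    qed
  qed
  then show ?thesis using that[of b] by (simp add: b_def homogeneous_homogeneous_poly)
qed

text \<open>In multidegree \<open>\<alpha>\<close> the Koszul complex of the quotient by the monomial ideal with monomials \<open>N\<close> is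
  the cochain complex of this simplicial complex.\<close>

definition degree_complex :: "('v::finite \<Rightarrow>\<^sub>0 nat) set \<Rightarrow> ('v \<Rightarrow>\<^sub>0 nat) \<Rightarrow> 'v set set" where
  "degree_complex N \<alpha> = {\<sigma>. \<sigma> \<subseteq> keys \<alpha> \<and> \<alpha> - indicator_exp (keys \<alpha> - \<sigma>) \<notin> N}"

lemma degree_complex_complement:
  assumes "T \<subseteq> keys \<alpha>"
  shows "keys \<alpha> - T \<in> degree_complex N \<alpha> \<longleftrightarrow> \<alpha> - indicator_exp T \<notin> N"
proof -
  have "keys \<alpha> - (keys \<alpha> - T) = T" using assms by auto
  then show ?thesis by (simp add: degree_complex_def)
qed

lemma koszul_vanishes_monomial:
  fixes N :: "('v::finite \<Rightarrow>\<^sub>0 nat) set"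
  shows "koszul_vanishes (*) (\<lambda>e. {p :: ('v, 'k::field) mpoly. homogeneous e p}) {p. keys p \<subseteq> N} q d \<longleftrightarrow>
    (\<forall>\<alpha>. int (mdeg \<alpha>) = d \<longrightarrow> koszul_zero TYPE('k) (keys \<alpha>) (degree_complex N \<alpha>) q)"
proof
  assume kz: "\<forall>\<alpha>. int (mdeg \<alpha>) = d \<longrightarrow> koszul_zero TYPE('k) (keys \<alpha>) (degree_complex N \<alpha>) q"
  show "koszul_vanishes (*) (\<lambda>e. {p :: ('v, 'k) mpoly. homogeneous e p}) {p. keys p \<subseteq> N} q d"
    unfolding koszul_vanishes_def
  proof (intro allI impI)
    fix c :: "'v set \<Rightarrow> ('v, 'k) mpoly"
    assume c: "(\<forall>T. card T = q \<longrightarrow> c T \<in> {p. homogeneous (d - int q) p}) \<and>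
      (\<forall>S. Suc (card S) = q \<longrightarrow> koszul_d (*) c S \<in> {p. keys p \<subseteq> N})"
    have loc: "\<exists>h. \<forall>T\<subseteq>keys \<alpha>. \<alpha> - indicator_exp T \<notin> N \<and> card T = q \<longrightarrow>
        lookup (c T) (\<alpha> - indicator_exp T) = (\<Sum>v\<in>keys \<alpha> - T. sg v T * h (insert v T))"
      if "int (mdeg \<alpha>) = d" for \<alpha>
    proof -
      define f where "f T = lookup (c T) (\<alpha> - indicator_exp T)" for T
      have "\<forall>S\<subseteq>keys \<alpha>. keys \<alpha> - S \<in> degree_complex N \<alpha> \<and> Suc (card S) = q \<longrightarrow>
          (\<Sum>v\<in>keys \<alpha> - S. sg v S * f (insert v S)) = 0"
      proof (intro allI impI)
        fix S assume S: "S \<subseteq> keys \<alpha>" "keys \<alpha> - S \<in> degree_complex N \<alpha> \<and> Suc (card S) = q"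
        then have "\<alpha> - indicator_exp S \<notin> N" by (simp add: degree_complex_complement)
        moreover have "keys (koszul_d (*) c S) \<subseteq> N" using c S by blast
        ultimately have "lookup (koszul_d (*) c S) (\<alpha> - indicator_exp S) = 0"
          by (meson in_keys_iff subsetD)
        then show "(\<Sum>v\<in>keys \<alpha> - S. sg v S * f (insert v S)) = 0"
          unfolding f_def lookup_koszul_d[OF S(1)] .
      qed
      moreover have "koszul_zero TYPE('k) (keys \<alpha>) (degree_complex N \<alpha>) q" using kz that by blast
      ultimately obtain h where "\<forall>T\<subseteq>keys \<alpha>. keys \<alpha> - T \<in> degree_complex N \<alpha> \<and> card T = q \<longrightarrow>
          f T = (\<Sum>v\<in>keys \<alpha> - T. sg v T * h (insert v T))"
        unfolding koszul_zero_def by meson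
      then show ?thesis by (auto simp: degree_complex_complement f_def intro!: exI[of _ h])
    qed
    obtain b where b: "\<And>T. homogeneous (d - int (Suc q)) (b T)"
      "\<And>T. card T = q \<Longrightarrow> keys (c T - koszul_d (*) b T) \<subseteq> N"
    proof (rule koszul_glue[of q d c N])
      show "homogeneous (d - int q) (c T)" if "card T = q" for T using c that by blast
    qed (use loc in auto)
    show "\<exists>b. (\<forall>T. card T = Suc q \<longrightarrow> b T \<in> {p. homogeneous (d - int (Suc q)) p}) \<and>
        (\<forall>T. card T = q \<longrightarrow> c T - koszul_d (*) b T \<in> {p. keys p \<subseteq> N})"
      by (rule exI[of _ b]) (use b in blast)
  qed
next
  assume kv: "koszul_vanishes (*) (\<lambda>e. {p :: ('v, 'k) mpoly. homogeneous e p}) {p. keys p \<subseteq> N} q d"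
  show "\<forall>\<alpha>. int (mdeg \<alpha>) = d \<longrightarrow> koszul_zero TYPE('k) (keys \<alpha>) (degree_complex N \<alpha>) q"
    unfolding koszul_zero_def
  proof (intro allI impI)
    fix \<alpha> and f :: "'v set \<Rightarrow> 'k"
    assume \<alpha>: "int (mdeg \<alpha>) = d"
      and f: "\<forall>S\<subseteq>keys \<alpha>. keys \<alpha> - S \<in> degree_complex N \<alpha> \<and> Suc (card S) = q \<longrightarrow>
        (\<Sum>v\<in>keys \<alpha> - S. sg v S * f (insert v S)) = 0"
    \<comment> \<open>For the converse, scalar data in one strand are turned into a chain
      concentrated in multidegree \<open>\<alpha>\<close>. Its boundary also lives in that
      multidegree only, which \<open>cyc\<close> uses.\<close>
    define c :: "'v set \<Rightarrow> ('v, 'k) mpoly"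
      where "c T = (if T \<subseteq> keys \<alpha> then single (\<alpha> - indicator_exp T) (f T) else 0)" for T
    have hom: "homogeneous (d - int q) (c T)" if "card T = q" for T
      using mdeg_diff_indicator_exp[of T \<alpha>] that \<alpha> by (auto simp: c_def homogeneous_def)
    have ckd: "lookup (koszul_d (*) c S) (\<alpha> - indicator_exp S)
        = (\<Sum>v\<in>keys \<alpha> - S. sg v S * f (insert v S))" if "S \<subseteq> keys \<alpha>" for S
      unfolding lookup_koszul_d[OF that] using that by (intro sum.cong) (auto simp: c_def)
    have cyc: "keys (koszul_d (*) c S) \<subseteq> N" if S: "Suc (card S) = q" for S
    proof
      fix \<beta> assume \<beta>: "\<beta> \<in> keys (koszul_d (*) c S)"
      define \<alpha>' where "\<alpha>' = \<beta> + indicator_exp S"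
      have \<beta>': "\<beta> = \<alpha>' - indicator_exp S" by (simp add: \<alpha>'_def)
      have S': "S \<subseteq> keys \<alpha>'" by (auto simp: \<alpha>'_def in_keys_iff lookup_add)
      have "(\<Sum>v\<in>keys \<alpha>' - S. sg v S * lookup (c (insert v S)) (\<alpha>' - indicator_exp (insert v S))) \<noteq> 0"
        using \<beta> lookup_koszul_d[OF S', of c] unfolding \<beta>'[symmetric] by (simp add: in_keys_iff)
      then obtain v where v: "v \<in> keys \<alpha>' - S" "lookup (c (insert v S)) (\<alpha>' - indicator_exp (insert v S)) \<noteq> 0"
        by (metis (no_types, lifting) mult_zero_right sum.neutral)
      then have sub: "insert v S \<subseteq> keys \<alpha>" and eq: "\<alpha> - indicator_exp (insert v S) = \<alpha>' - indicator_exp (insert v S)"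
        by (auto simp: c_def lookup_single when_def split: if_splits)
      have sub': "insert v S \<subseteq> keys \<alpha>'" using v S' by auto
      have "\<alpha>' = \<alpha>"
        using arg_cong[OF eq, of "\<lambda>x. x + indicator_exp (insert v S)"]
        by (simp only: indicator_exp_add_diff[OF sub] indicator_exp_add_diff[OF sub'])
      then have "(\<Sum>v\<in>keys \<alpha> - S. sg v S * f (insert v S)) \<noteq> 0"
        using \<beta> ckd[of S] sub unfolding \<beta>' by (simp add: in_keys_iff)
      then have "keys \<alpha> - S \<notin> degree_complex N \<alpha>" using f sub S by blast
      then show "\<beta> \<in> N" using sub \<open>\<alpha>' = \<alpha>\<close> \<beta>' by (simp add: degree_complex_complement)
    qed
    obtain b where b: "\<And>T. card T = q \<Longrightarrow> keys (c T - koszul_d (*) b T) \<subseteq> N"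
      using kv[unfolded koszul_vanishes_def, rule_format, of c] hom cyc by blast
    have "f T = (\<Sum>v\<in>keys \<alpha> - T. sg v T * lookup (b (insert v T)) (\<alpha> - indicator_exp (insert v T)))"
      if T: "T \<subseteq> keys \<alpha>" "keys \<alpha> - T \<in> degree_complex N \<alpha> \<and> card T = q" for T
    proof -
      have "\<alpha> - indicator_exp T \<notin> N" using T by (simp add: degree_complex_complement)
      then have "lookup (c T - koszul_d (*) b T) (\<alpha> - indicator_exp T) = 0"
        using b[of T] T by (meson in_keys_iff subsetD)
      then show ?thesis using T lookup_koszul_d[OF T(1), of b] by (simp add: lookup_minus c_def)
    qed
    then show "\<exists>h. \<forall>T\<subseteq>keys \<alpha>. keys \<alpha> - T \<in> degree_complex N \<alpha> \<and> card T = q \<longrightarrow>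
        f T = (\<Sum>v\<in>keys \<alpha> - T. sg v T * h (insert v T))"
      by (intro exI[of _ "\<lambda>T. lookup (b T) (\<alpha> - indicator_exp T)"]) blast
  qed
qed

lemma koszul_zero_cone:
  assumes "\<Gamma> \<subseteq> Pow P" "\<And>\<sigma>. \<sigma> \<in> \<Gamma> \<Longrightarrow> insert v \<sigma> \<in> \<Gamma>"
  shows "koszul_zero TYPE('k::field) P \<Gamma> q"
proof (cases "q \<le> card P")
  case True
  then have "card P = (card P - q) + q" by simp
  then show ?thesis using koszul_zero_iff[OF assms(1)] cohom_zero_cone[OF assms(2)] by blast
qed (simp add: koszul_zero_trivial)

text \<open>The Koszul complex of the ring resolves the field. In a multidegree \<alpha> \<noteq> 0
  the strand is that of a full simplex, hence a cone; for \<alpha> = 0 only constants with q = 0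
  remain, and these are excluded by \<open>q0\<close>.\<close>

lemma koszul_exact_ring:
  fixes c :: "'v::finite set \<Rightarrow> ('v, 'k::field) mpoly"
  assumes c: "\<And>T. card T = q \<Longrightarrow> homogeneous (d - int q) (c T)"
    and cyc: "\<And>S. Suc (card S) = q \<Longrightarrow> koszul_d (*) c S = 0"
    and q0: "q = 0 \<Longrightarrow> lookup (c {}) 0 = 0"
  obtains b where "\<And>T. homogeneous (d - int (Suc q)) (b T)"
    "\<And>T. card T = q \<Longrightarrow> c T = koszul_d (*) b T"
proof -
  have loc: "\<exists>h. \<forall>T\<subseteq>keys \<alpha>. \<alpha> - indicator_exp T \<notin> {} \<and> card T = q \<longrightarrow>
      lookup (c T) (\<alpha> - indicator_exp T) = (\<Sum>v\<in>keys \<alpha> - T. sg v T * h (insert v T))"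
    if "int (mdeg \<alpha>) = d" for \<alpha>
  proof (cases "\<alpha> = 0")
    case True
    then show ?thesis using q0 by (auto simp: indicator_exp_def)
  next
    case False
    then obtain u where u: "u \<in> keys \<alpha>" by (metis keys_eq_empty ex_in_conv)
    define f where "f T = lookup (c T) (\<alpha> - indicator_exp T)" for T
    have "koszul_zero TYPE('k) (keys \<alpha>) (Pow (keys \<alpha>)) q"
      using u by (intro koszul_zero_cone[of _ _ u]) auto
    moreover have "\<forall>S\<subseteq>keys \<alpha>. keys \<alpha> - S \<in> Pow (keys \<alpha>) \<and> Suc (card S) = q \<longrightarrow>
        (\<Sum>v\<in>keys \<alpha> - S. sg v S * f (insert v S)) = 0"
      unfolding f_def by (auto simp: lookup_koszul_d[symmetric] cyc)
    ultimately obtain h where "\<forall>T\<subseteq>keys \<alpha>. keys \<alpha> - T \<in> Pow (keys \<alpha>) \<and> card T = q \<longrightarrow>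
          f T = (\<Sum>v\<in>keys \<alpha> - T. sg v T * h (insert v T))"
      unfolding koszul_zero_def by meson
    then show ?thesis by (auto simp: f_def intro!: exI[of _ h])
  qed
  obtain b where "\<And>T. homogeneous (d - int (Suc q)) (b T)"
    "\<And>T. card T = q \<Longrightarrow> keys (c T - koszul_d (*) b T) \<subseteq> {}"
    by (rule koszul_glue[of q d c "{}"]) (use c loc in auto)
  then show ?thesis using that[of b] by (simp add: keys_eq_empty)
qed

section \<open>The edge ideal as a monomial ideal and its Koszul homology\<close>

lemma module_mult: "module ((*) :: 'r::comm_ring_1 \<Rightarrow> 'r \<Rightarrow> 'r)"
  by unfold_locales (simp_all add: algebra_simps)

interpretation mult_module: module "(*) :: 'r::comm_ring_1 \<Rightarrow> 'r \<Rightarrow> 'r"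
  by (rule module_mult)

text \<open>Membership is decided monomial by monomial, by supports alone. The two ends of an edge
  are distinct, so a support containing the edge makes the monomial divisible by the product of two
  different variables.\<close>

lemma edge_ideal_eq:
  fixes E :: "'v::finite set set"
  assumes sg: "simple_graph E"
  shows "(edge_ideal E :: ('v, 'k::field) mpoly set) = {p. keys p \<subseteq> {\<beta>. \<exists>e\<in>E. e \<subseteq> keys \<beta>}}"
proof (intro equalityI)
  let ?N = "{\<beta> :: 'v \<Rightarrow>\<^sub>0 nat. \<exists>e\<in>E. e \<subseteq> keys \<beta>}"
  let ?G = "{X u * X v | u v. {u, v} \<in> E} :: ('v, 'k) mpoly set"
  show "edge_ideal E \<subseteq> {p :: ('v, 'k) mpoly. keys p \<subseteq> ?N}"
    unfolding edge_ideal_def ideal_gen_def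
  proof (rule mult_module.span_minimal)
    show "?G \<subseteq> {p. keys p \<subseteq> ?N}"
    proof
      fix p :: "('v, 'k) mpoly" assume "p \<in> ?G"
      then obtain u v where uv: "p = X u * X v" "{u, v} \<in> E" by blast
      have "{u, v} \<subseteq> keys (single u 1 + single v (1::nat))"
        by (auto simp: in_keys_iff lookup_add)
      then have "single u 1 + single v 1 \<in> ?N" using uv(2) by blast
      then show "p \<in> {p. keys p \<subseteq> ?N}" using uv(1) by (simp add: X_def mult_single)
    qed
    show "mult_module.subspace {p :: ('v, 'k) mpoly. keys p \<subseteq> ?N}"
    proof (rule mult_module.subspaceI)
      show "x + y \<in> {p. keys p \<subseteq> ?N}" if "x \<in> {p. keys p \<subseteq> ?N}" "y \<in> {p. keys p \<subseteq> ?N}"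
        for x y :: "('v, 'k) mpoly"
        using that keys_add[of x y] by auto
      show "r * x \<in> {p. keys p \<subseteq> ?N}" if "x \<in> {p. keys p \<subseteq> ?N}" for r x :: "('v, 'k) mpoly"
      proof
        have up: "\<alpha> + \<beta> \<in> ?N" if "\<beta> \<in> ?N" for \<alpha> \<beta>
        proof -
          have "keys \<beta> \<subseteq> keys (\<alpha> + \<beta>)" by (auto simp: in_keys_iff lookup_add)
          then show ?thesis using that by blast
        qed
        show "keys (r * x) \<subseteq> ?N"
        proof
          fix \<gamma> assume "\<gamma> \<in> keys (r * x)"
          then obtain \<alpha> \<beta> where "\<gamma> = \<alpha> + \<beta>" "\<beta> \<in> keys x" using keys_mult[of r x] by fastforce
          then show "\<gamma> \<in> ?N" using up[of \<beta> \<alpha>] that by fastforce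
        qed
      qed
    qed simp
  qed
  show "{p. keys p \<subseteq> ?N} \<subseteq> (edge_ideal E :: ('v, 'k) mpoly set)"
  proof
    fix p :: "('v, 'k) mpoly" assume p: "p \<in> {p. keys p \<subseteq> ?N}"
    have "single \<beta> (lookup p \<beta>) \<in> edge_ideal E" if \<beta>: "\<beta> \<in> keys p" for \<beta>
    proof -
      obtain e where e: "e \<in> E" "e \<subseteq> keys \<beta>" using p \<beta> by auto
      have "card e = 2" using sg e by (simp add: simple_graph_def)
      then obtain u v where uv: "e = {u, v}" "u \<noteq> v" by (auto simp: card_2_iff)
      have "\<beta> - indicator_exp e + (single u 1 + single v 1) = \<beta>"
        using indicator_exp_add_diff[OF e(2)] uv by (simp add: indicator_exp_def)
      then have "single \<beta> (lookup p \<beta>) = single (\<beta> - indicator_exp e) (lookup p \<beta>) * (X u * X v)"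
        by (simp add: X_def mult_single)
      moreover have "X u * X v \<in> ?G" using e uv by blast
      ultimately show ?thesis
        unfolding edge_ideal_def ideal_gen_def
        by (metis (no_types, lifting) mult_module.span_base mult_module.span_scale)
    qed
    then show "p \<in> edge_ideal E"
      unfolding edge_ideal_def ideal_gen_def
      by (subst poly_mapping_sum_single[of p]) (rule mult_module.span_sum)
  qed
qed

lemma max_ideal_eq: "(max_ideal :: ('v::finite, 'k::field) mpoly set) = {p. lookup p 0 = 0}"
proof (intro equalityI)
  show "max_ideal \<subseteq> {p :: ('v, 'k) mpoly. lookup p 0 = 0}"
    unfolding max_ideal_def ideal_gen_def
  proof (rule mult_module.span_minimal)
    show "range X \<subseteq> {p :: ('v, 'k) mpoly. lookup p 0 = 0}"
    proof -
      have "single v (1::nat) \<noteq> 0" for v :: 'v by (metis lookup_single_eq lookup_zero zero_neq_one)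
      then show ?thesis by (auto simp: X_def lookup_single when_def)
    qed
    show "mult_module.subspace {p :: ('v, 'k) mpoly. lookup p 0 = 0}"
    proof (rule mult_module.subspaceI)
      show "r * x \<in> {p. lookup p 0 = 0}" if x: "x \<in> {p. lookup p 0 = 0}" for r x :: "('v, 'k) mpoly"
      proof -
        have "0 \<notin> keys (r * x)"
        proof
          assume "0 \<in> keys (r * x)"
          then obtain \<alpha> \<beta> where ab: "\<alpha> + \<beta> = 0" "\<beta> \<in> keys x" using keys_mult[of r x] by fastforce
          then have "mdeg \<beta> = 0" by (metis add_is_0 mdeg_add mdeg_zero)
          then show False using ab x by (simp add: mdeg_eq_0_iff in_keys_iff)
        qed
        then show ?thesis by (simp add: in_keys_iff)
      qed
    qed (auto simp: lookup_add)
  qed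
  show "{p :: ('v, 'k) mpoly. lookup p 0 = 0} \<subseteq> max_ideal"
  proof
    fix p :: "('v, 'k) mpoly" assume p: "p \<in> {p. lookup p 0 = 0}"
    have "single \<beta> (lookup p \<beta>) \<in> max_ideal" if \<beta>: "\<beta> \<in> keys p" for \<beta>
    proof -
      have "\<beta> \<noteq> 0" using \<beta> p by (auto simp: in_keys_iff)
      then obtain u where u: "u \<in> keys \<beta>" by (metis keys_eq_empty ex_in_conv)
      then have "\<beta> - indicator_exp {u} + single u 1 = \<beta>"
        using indicator_exp_add_diff[of "{u}" \<beta>] by (simp add: indicator_exp_def)
      then have "single \<beta> (lookup p \<beta>) = single (\<beta> - indicator_exp {u}) (lookup p \<beta>) * X u"
        by (simp add: X_def mult_single)
      then show ?thesis
        unfolding max_ideal_def ideal_gen_def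
        by (metis mult_module.span_base mult_module.span_scale rangeI)
    qed
    then show "p \<in> max_ideal"
      unfolding max_ideal_def ideal_gen_def
      by (subst poly_mapping_sum_single[of p]) (rule mult_module.span_sum)
  qed
qed

text \<open>Hochster's formula. In a multidegree that is not squarefree the degree complex is a cone.\<close>

lemma koszul_vanishes_edge_ideal:
  fixes E :: "'v::finite set set"
  assumes sg: "simple_graph E"
  shows "koszul_vanishes (*) (\<lambda>e. {p :: ('v, 'k::field) mpoly. homogeneous e p}) (edge_ideal E) q d \<longleftrightarrow>
    (\<forall>W m. nonzero_cohom TYPE('k) E W m \<longrightarrow> int (card W) = d \<longrightarrow> card W \<noteq> m + q)"
proof -
  let ?N = "{\<beta> :: 'v \<Rightarrow>\<^sub>0 nat. \<exists>e\<in>E. e \<subseteq> keys \<beta>}"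
  have cone: "koszul_zero TYPE('k) (keys \<alpha>) (degree_complex ?N \<alpha>) q" if u: "lookup \<alpha> u > 1" for \<alpha> u
  proof (rule koszul_zero_cone)
    show "degree_complex ?N \<alpha> \<subseteq> Pow (keys \<alpha>)" by (auto simp: degree_complex_def)
    fix \<sigma> assume \<sigma>: "\<sigma> \<in> degree_complex ?N \<alpha>"
    have "u \<in> keys \<alpha>" using u by (simp add: in_keys_iff)
    \<comment> \<open>An exponent of at least two stays positive when lowered by one, so the support
      is the same whether or not \<open>u\<close> is subtracted: \<open>u\<close> is a cone
      apex.\<close>
    moreover have "keys (\<alpha> - indicator_exp (keys \<alpha> - insert u \<sigma>)) = keys (\<alpha> - indicator_exp (keys \<alpha> - \<sigma>))"
      using u by (auto simp: in_keys_iff lookup_minus split: if_splits)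
    ultimately show "insert u \<sigma> \<in> degree_complex ?N \<alpha>"
      using \<sigma> by (simp add: degree_complex_def)
  qed
  have keysW: "keys (indicator_exp W) = W" for W :: "'v set"
    by (auto simp: in_keys_iff split: if_splits)
  have sqf: "degree_complex ?N (indicator_exp W) = indep E W" for W
  proof -
    have "keys (indicator_exp W - indicator_exp (W - \<sigma>)) = \<sigma>" if "\<sigma> \<subseteq> W" for \<sigma>
      using that by (auto simp: in_keys_iff lookup_minus split: if_splits)
    then show ?thesis by (auto simp: degree_complex_def keysW indep_def)
  qed
  have sqf_eq: "\<alpha> = indicator_exp (keys \<alpha>)" if "\<And>u. lookup \<alpha> u \<le> 1" for \<alpha> :: "'v \<Rightarrow>\<^sub>0 nat"
  proof (rule poly_mapping_eqI)
    fix k show "lookup \<alpha> k = lookup (indicator_exp (keys \<alpha>)) k"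
      using that[of k] by (auto simp: in_keys_iff)
  qed
  have "(\<forall>\<alpha>. int (mdeg \<alpha>) = d \<longrightarrow> koszul_zero TYPE('k) (keys \<alpha>) (degree_complex ?N \<alpha>) q) \<longleftrightarrow>
      (\<forall>W. int (card W) = d \<longrightarrow> koszul_zero TYPE('k) W (indep E W) q)" (is "?A \<longleftrightarrow> ?B")
  proof
    assume A: ?A
    show ?B
    proof (intro allI impI)
      fix W :: "'v set" assume "int (card W) = d"
      then show "koszul_zero TYPE('k) W (indep E W) q"
        using A[rule_format, of "indicator_exp W"] by (simp add: keysW sqf)
    qed
  next
    assume B: ?B
    show ?A
    proof (intro allI impI)
      fix \<alpha> :: "'v \<Rightarrow>\<^sub>0 nat" assume \<alpha>: "int (mdeg \<alpha>) = d"
      show "koszul_zero TYPE('k) (keys \<alpha>) (degree_complex ?N \<alpha>) q"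
      proof (cases "\<exists>u. lookup \<alpha> u > 1")
        case False
        then have eq: "\<alpha> = indicator_exp (keys \<alpha>)" using sqf_eq by (metis not_le)
        have "int (card (keys \<alpha>)) = d" using \<alpha> eq by (metis mdeg_indicator_exp)
        then have "koszul_zero TYPE('k) (keys \<alpha>) (indep E (keys \<alpha>)) q" using B by blast
        then show ?thesis using sqf[of "keys \<alpha>"] eq by simp
      qed (use cone in blast)
    qed
  qed
  also have "\<dots> \<longleftrightarrow> (\<forall>W m. nonzero_cohom TYPE('k) E W m \<longrightarrow> int (card W) = d \<longrightarrow> card W \<noteq> m + q)"
  proof -
    have iff: "koszul_zero TYPE('k) W (indep E W) q \<longleftrightarrow> (\<forall>m. nonzero_cohom TYPE('k) E W m \<longrightarrow> card W \<noteq> m + q)"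
      for W
    proof (cases "q \<le> card W")
      case True
      then have c: "card W = (card W - q) + q" by simp
      have "indep E W \<subseteq> Pow W" by (auto simp: indep_def)
      from koszul_zero_iff[OF this c] have "koszul_zero TYPE('k) W (indep E W) q \<longleftrightarrow>
          \<not> nonzero_cohom TYPE('k) E W (card W - q)"
        by (simp add: nonzero_cohom_def)
      moreover have "card W = m + q \<longleftrightarrow> m = card W - q" for m using True by auto
      ultimately show ?thesis by auto
    qed (simp add: koszul_zero_trivial)
    show ?thesis unfolding iff by blast
  qed
  finally show ?thesis
    unfolding edge_ideal_eq[OF sg] koszul_vanishes_monomial .
qed

section \<open>Graded modules and dimension shifting\<close>

interpretation vscale_module: module vscale
  by (rule module_vscale)

lemma homogeneous_zero [simp]: "homogeneous d 0"
  by (simp add: homogeneous_iff)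

lemma homogeneous_add: "homogeneous d p \<Longrightarrow> homogeneous d q \<Longrightarrow> homogeneous d (p + q)"
  by (simp add: homogeneous_iff lookup_add)

lemma homogeneous_diff: "homogeneous d p \<Longrightarrow> homogeneous d q \<Longrightarrow> homogeneous d (p - q)"
  by (simp add: homogeneous_iff lookup_minus)

lemma homogeneous_mult: "homogeneous c p \<Longrightarrow> homogeneous d q \<Longrightarrow> homogeneous (c + d) (p * q)"
  using keys_mult[of p q] by (fastforce simp: homogeneous_def)

lemma homogeneous_sg_X: "homogeneous 1 (sg v S * X v)"
  by (auto simp: homogeneous_iff lookup_sg_times X_def lookup_single when_def)

definition hcomp :: "int \<Rightarrow> ('v::finite, 'k::field) mpoly \<Rightarrow> ('v, 'k) mpoly" where
  "hcomp e p = homogeneous_poly e (lookup p)"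

lemma lookup_hcomp: "lookup (hcomp e p) \<beta> = (if int (mdeg \<beta>) = e then lookup p \<beta> else 0)"
  by (simp add: hcomp_def lookup_homogeneous_poly)

lemma homogeneous_hcomp: "homogeneous e (hcomp e p)"
  by (simp add: hcomp_def homogeneous_homogeneous_poly)

lemma hcomp_zero [simp]: "hcomp e 0 = 0"
  by (rule poly_mapping_eqI) (simp add: lookup_hcomp)

lemma hcomp_add: "hcomp e (p + q) = hcomp e p + hcomp e q"
  by (rule poly_mapping_eqI) (simp add: lookup_hcomp lookup_add)

lemma hcomp_homogeneous: "homogeneous d p \<Longrightarrow> hcomp e p = (if d = e then p else 0)"
  by (rule poly_mapping_eqI) (auto simp: lookup_hcomp homogeneous_iff)

lemma hcomp_mult:
  assumes q: "homogeneous c q"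
  shows "hcomp e (p * q) = hcomp (e - c) p * q"
proof -
  have "hcomp e (hcomp (e - c) p * q) = hcomp (e - c) p * q"
    using homogeneous_mult[OF homogeneous_hcomp q, of "e - c" p] by (simp add: hcomp_homogeneous)
  moreover have "hcomp e ((p - hcomp (e - c) p) * q) = 0"
  proof (rule poly_mapping_eqI)
    fix \<beta>
    have "\<beta> \<notin> keys ((p - hcomp (e - c) p) * q)" if \<beta>: "int (mdeg \<beta>) = e"
    proof
      assume "\<beta> \<in> keys ((p - hcomp (e - c) p) * q)"
      then obtain a b where ab: "\<beta> = a + b" "a \<in> keys (p - hcomp (e - c) p)" "b \<in> keys q"
        using keys_mult[of "p - hcomp (e - c) p" q] by blast
      then have "int (mdeg b) = c" using q by (auto simp: homogeneous_def)
      then have "int (mdeg a) = e - c" using ab(1) \<beta> by simp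
      then show False using ab(2) by (simp add: in_keys_iff lookup_minus lookup_hcomp)
    qed
    then show "lookup (hcomp e ((p - hcomp (e - c) p) * q)) \<beta> = lookup 0 \<beta>"
      by (auto simp: lookup_hcomp in_keys_iff)
  qed
  moreover have "hcomp e (p * q) = hcomp e (hcomp (e - c) p * q) + hcomp e ((p - hcomp (e - c) p) * q)"
    by (simp add: hcomp_add[symmetric] algebra_simps)
  ultimately show ?thesis by simp
qed

lemma lookup_unit_vec: "lookup (unit_vec k) l = (if l = k then 1 else 0)"
  by (auto simp: unit_vec_def lookup_single when_def)

lemma free_mod_iff: "x \<in> free_mod r \<longleftrightarrow> (\<forall>k\<ge>r. lookup x k = 0)"
  by (auto simp: free_mod_def in_keys_iff subset_iff not_less) (metis not_le)

lemma unit_vec_free: "k < r \<Longrightarrow> unit_vec k \<in> free_mod r"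
  by (auto simp: free_mod_iff lookup_unit_vec)

lemma subspace_free_mod: "vscale_module.subspace (free_mod r)"
  by (rule vscale_module.subspaceI) (auto simp: free_mod_iff lookup_add lookup_vscale)

definition vec :: "nat \<Rightarrow> (nat \<Rightarrow> 'r) \<Rightarrow> (nat \<Rightarrow>\<^sub>0 'r::comm_ring_1)" where
  "vec r f = (\<Sum>k<r. vscale (f k) (unit_vec k))"

lemma lookup_vec: "lookup (vec r f) l = (if l < r then f l else 0)"
proof -
  have "lookup (vec r f) l = (\<Sum>k<r. if k = l then f l else 0)"
    unfolding vec_def lookup_sum by (intro sum.cong) (auto simp: lookup_vscale lookup_unit_vec)
  then show ?thesis by simp
qed

lemma vec_free_mod: "vec r f \<in> free_mod r"
  by (simp add: free_mod_iff lookup_vec)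

lemma vec_lookup: "x \<in> free_mod r \<Longrightarrow> vec r (lookup x) = x"
  by (rule poly_mapping_eqI) (auto simp: lookup_vec free_mod_iff)

lemma homogeneous_vec_iff:
  "homogeneous_vec ds d x \<longleftrightarrow> x \<in> free_mod (length ds) \<and> (\<forall>k<length ds. homogeneous (d - ds ! k) (lookup x k))"
  by (simp add: homogeneous_vec_def)

lemma homogeneous_vec_zero: "homogeneous_vec ds d 0"
  by (simp add: homogeneous_vec_iff free_mod_iff)

lemma homogeneous_vec_add:
  "homogeneous_vec ds d x \<Longrightarrow> homogeneous_vec ds d y \<Longrightarrow> homogeneous_vec ds d (x + y)"
  by (simp add: homogeneous_vec_iff free_mod_iff lookup_add homogeneous_add)

lemma homogeneous_vec_diff:
  "homogeneous_vec ds d x \<Longrightarrow> homogeneous_vec ds d y \<Longrightarrow> homogeneous_vec ds d (x - y)"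
  by (simp add: homogeneous_vec_iff free_mod_iff lookup_minus homogeneous_diff)

lemma homogeneous_vec_vscale:
  assumes "homogeneous c p" "homogeneous_vec ds d x"
  shows "homogeneous_vec ds (c + d) (vscale p x)"
  using assms homogeneous_mult[OF assms(1), of "d - ds ! k" "lookup x k" for k]
  by (simp add: homogeneous_vec_iff free_mod_iff lookup_vscale add_diff_eq)

lemma homogeneous_vec_unit_vec: "k < length ds \<Longrightarrow> homogeneous_vec ds (ds ! k) (unit_vec k)"
  by (auto simp: homogeneous_vec_iff unit_vec_free lookup_unit_vec homogeneous_def)

definition hvcomp :: "int list \<Rightarrow> int \<Rightarrow> (nat \<Rightarrow>\<^sub>0 ('v::finite, 'k::field) mpoly) \<Rightarrow> (nat \<Rightarrow>\<^sub>0 ('v, 'k) mpoly)" where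
  "hvcomp ds e x = vec (length ds) (\<lambda>k. hcomp (e - ds ! k) (lookup x k))"

lemma lookup_hvcomp:
  "lookup (hvcomp ds e x) k = (if k < length ds then hcomp (e - ds ! k) (lookup x k) else 0)"
  by (simp add: hvcomp_def lookup_vec)

lemma homogeneous_hvcomp: "homogeneous_vec ds e (hvcomp ds e x)"
  by (simp add: homogeneous_vec_iff hvcomp_def vec_free_mod lookup_vec homogeneous_hcomp)

lemma hvcomp_zero [simp]: "hvcomp ds e 0 = 0"
  by (rule poly_mapping_eqI) (simp add: lookup_hvcomp)

lemma hvcomp_add: "hvcomp ds e (x + y) = hvcomp ds e x + hvcomp ds e y"
  by (rule poly_mapping_eqI) (simp add: lookup_hvcomp lookup_add hcomp_add)

lemma hvcomp_homogeneous: "homogeneous_vec ds d x \<Longrightarrow> hvcomp ds e x = (if d = e then x else 0)"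
  by (rule poly_mapping_eqI) (auto simp: lookup_hvcomp homogeneous_vec_iff free_mod_iff hcomp_homogeneous)

lemma hvcomp_vscale:
  assumes "homogeneous_vec ds d x"
  shows "hvcomp ds e (vscale p x) = vscale (hcomp (e - d) p) x"
proof (rule poly_mapping_eqI)
  fix k
  show "lookup (hvcomp ds e (vscale p x)) k = lookup (vscale (hcomp (e - d) p) x) k"
  proof (cases "k < length ds")
    case True
    then have "homogeneous (d - ds ! k) (lookup x k)" using assms by (simp add: homogeneous_vec_iff)
    then have "hcomp (e - ds ! k) (p * lookup x k) = hcomp (e - ds ! k - (d - ds ! k)) p * lookup x k"
      by (rule hcomp_mult)
    then show ?thesis using True by (simp add: lookup_hvcomp lookup_vscale)
  next
    case False
    then show ?thesis using assms by (simp add: lookup_hvcomp lookup_vscale homogeneous_vec_iff free_mod_iff)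
  qed
qed

lemma hvcomp_sum:
  assumes x: "x \<in> free_mod (length ds)"
  obtains D where "finite D" "x = (\<Sum>e\<in>D. hvcomp ds e x)"
proof -
  define D where "D = (\<Union>k<length ds. (\<lambda>\<beta>. int (mdeg \<beta>) + ds ! k) ` keys (lookup x k))"
  have fin: "finite D" by (simp add: D_def)
  moreover have "x = (\<Sum>e\<in>D. hvcomp ds e x)"
  proof (rule poly_mapping_eqI, rule poly_mapping_eqI)
    fix k \<beta>
    show "lookup (lookup x k) \<beta> = lookup (lookup (\<Sum>e\<in>D. hvcomp ds e x) k) \<beta>"
    proof (cases "k < length ds")
      case True
      have "lookup (lookup (\<Sum>e\<in>D. hvcomp ds e x) k) \<beta>
          = (\<Sum>e\<in>D. if e = int (mdeg \<beta>) + ds ! k then lookup (lookup x k) \<beta> else 0)"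
        using True by (auto simp: lookup_sum lookup_hvcomp lookup_hcomp intro!: sum.cong)
      also have "\<dots> = (if int (mdeg \<beta>) + ds ! k \<in> D then lookup (lookup x k) \<beta> else 0)"
        using fin by simp
      also have "\<dots> = lookup (lookup x k) \<beta>"
      proof -
        have "int (mdeg \<beta>) + ds ! k \<in> D" if "\<beta> \<in> keys (lookup x k)"
          unfolding D_def using True that by (intro UN_I[of k]) auto
        then show ?thesis by (auto simp: in_keys_iff)
      qed
      finally show ?thesis by simp
    next
      case False
      then show ?thesis using x by (simp add: lookup_sum lookup_hvcomp free_mod_iff)
    qed
  qed
  ultimately show ?thesis by (rule that)
qed

text \<open>Graded maps commute with taking components, since this holds on multiples of basis
  vectors. The projection \<open>pr\<close> of the target is abstract so that maps to a free module
  and to the ring are covered together.\<close>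

lemma graded_hom_comp:
  assumes \<phi>: "module_hom vscale s \<phi>" and x: "x \<in> free_mod (length ds)"
    and zero: "pr 0 = 0" and add: "\<And>y z. pr (y + z) = pr y + pr z"
    and gen: "\<And>k p. k < length ds \<Longrightarrow>
      pr (s p (\<phi> (unit_vec k))) = s (hcomp (e - ds ! k) p) (\<phi> (unit_vec k))"
  shows "pr (\<phi> x) = \<phi> (hvcomp ds e x)"
proof -
  interpret \<phi>: module_hom vscale s \<phi> by (rule \<phi>)
  have csum: "pr (sum f A) = (\<Sum>a\<in>A. pr (f a))" for f and A :: "nat set"
    by (induction A rule: infinite_finite_induct) (auto simp: zero add)
  have "\<phi> x = (\<Sum>k<length ds. s (lookup x k) (\<phi> (unit_vec k)))"
    by (subst (1) vec_lookup[OF x, symmetric]) (simp add: vec_def \<phi>.sum \<phi>.scale)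
  then have "pr (\<phi> x) = (\<Sum>k<length ds. s (hcomp (e - ds ! k) (lookup x k)) (\<phi> (unit_vec k)))"
    by (simp add: csum gen)
  also have "\<dots> = \<phi> (hvcomp ds e x)"
    by (simp add: hvcomp_def vec_def \<phi>.sum \<phi>.scale)
  finally show ?thesis .
qed

lemma hvcomp_graded_hom:
  assumes "module_hom vscale vscale \<delta>" "x \<in> free_mod (length ds)"
    and "\<And>k. k < length ds \<Longrightarrow> homogeneous_vec ds' (ds ! k) (\<delta> (unit_vec k))"
  shows "hvcomp ds' e (\<delta> x) = \<delta> (hvcomp ds e x)"
  by (rule graded_hom_comp[OF assms(1,2)]) (simp_all add: hvcomp_add hvcomp_vscale assms(3))

lemma hcomp_graded_hom:
  assumes "module_hom vscale (*) \<epsilon>" "x \<in> free_mod (length ds)"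
    and "\<And>k. k < length ds \<Longrightarrow> homogeneous (ds ! k) (\<epsilon> (unit_vec k))"
  shows "hcomp e (\<epsilon> x) = \<epsilon> (hvcomp ds e x)"
  by (rule graded_hom_comp[OF assms(1,2)]) (simp_all add: hcomp_add hcomp_mult assms(3))

text \<open>As much grading as Koszul chains need: the boundary multiplies only by signed variables,
  hence the degree 1 in \<open>G_scale\<close>. Components are sets in an ambient module, so a
  graded submodule is obtained by intersecting them with it.\<close>

locale graded_module = module s for s :: "('v::finite, 'k::field) mpoly \<Rightarrow> 'm::ab_group_add \<Rightarrow> 'm" +
  fixes G :: "int \<Rightarrow> 'm set"
  assumes G_zero: "0 \<in> G d" and G_add: "x \<in> G d \<Longrightarrow> y \<in> G d \<Longrightarrow> x + y \<in> G d"
    and G_diff: "x \<in> G d \<Longrightarrow> y \<in> G d \<Longrightarrow> x - y \<in> G d"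
    and G_scale: "homogeneous 1 p \<Longrightarrow> x \<in> G d \<Longrightarrow> s p x \<in> G (d + 1)"
begin

lemma G_sum: "(\<And>a. a \<in> A \<Longrightarrow> f a \<in> G d) \<Longrightarrow> sum f A \<in> G d"
  by (induction A rule: infinite_finite_induct) (auto simp: G_zero G_add)

lemma koszul_d_G:
  assumes "\<And>T. card T = Suc (card S) \<Longrightarrow> c T \<in> G d"
  shows "koszul_d s c S \<in> G (d + 1)"
  unfolding koszul_d_def by (intro G_sum G_scale homogeneous_sg_X assms) simp

lemma koszul_d_diff: "koszul_d s (\<lambda>T. b T - c T) S = koszul_d s b S - koszul_d s c S"
  by (simp add: koszul_d_def scale_right_diff_distrib sum_subtractf)

lemma koszul_d_subspace:
  assumes "subspace B" "\<And>T. card T = Suc (card S) \<Longrightarrow> c T \<in> B"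
  shows "koszul_d s c S \<in> B"
  unfolding koszul_d_def by (intro subspace_sum subspace_scale assms) simp

end

lemma koszul_d_koszul_d:
  fixes s :: "('v::finite, 'k::field) mpoly \<Rightarrow> 'm::ab_group_add \<Rightarrow> 'm"
  assumes "module s"
  shows "koszul_d s (koszul_d s c) S = 0"
proof -
  interpret module s by (rule assms)
  define F where "F u w = s (sg u S * X u) (s (sg w (insert u S) * X w) (c (insert w (insert u S))))" for u w
  have "koszul_d s (koszul_d s c) S = (\<Sum>u\<in>-S. \<Sum>w\<in>-S - {u}. F u w)"
    unfolding koszul_d_def F_def by (intro sum.cong refl) (auto simp: scale_sum_right intro!: sum.cong)
  also have "\<dots> = 0"
  proof (rule sum_antisym)
    fix u w assume uw: "u \<in> - S" "w \<in> - S" "u \<noteq> w"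
    have "sg u S * sg w (insert u S) = - (sg w S * sg u (insert w S) :: ('v, 'k) mpoly)"
      using uw by (intro sg_swap) auto
    then have "sg u S * sg w (insert u S) * (X u * X w)
        = - (sg w S * sg u (insert w S)) * (X u * X w :: ('v, 'k) mpoly)"
      by (rule arg_cong)
    then have "sg u S * X u * (sg w (insert u S) * X w)
        = - (sg w S * X w * (sg u (insert w S) * X u) :: ('v, 'k) mpoly)"
      by (simp only: mult_minus_left mult_minus_right mult_ac)
    then show "F u w = - F w u"
      by (simp add: F_def insert_commute)
  qed simp
  finally show ?thesis .
qed

lemma koszul_d_hom:
  assumes "module_hom s s' \<phi>"
  shows "koszul_d s' (\<lambda>T. \<phi> (c T)) S = \<phi> (koszul_d s c S)"
proof -
  interpret module_hom s s' \<phi> by (rule assms)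
  show ?thesis by (simp add: koszul_d_def sum scale)
qed

text \<open>\<open>lift\<close> and \<open>B\<close> say that \<phi> induces an isomorphism of the
  quotients by \<open>B\<close> and \<open>B'\<close> in each degree, surjective and injective
  respectively; hence the Koszul homologies agree. Chains are moved by applying \<phi> or by
  choosing lifts modulo \<open>B'\<close>.\<close>

lemma koszul_vanishes_transport:
  assumes G: "graded_module s G" and G': "graded_module s' G'" and \<phi>: "module_hom s s' \<phi>"
    and B': "module.subspace s' B'"
    and GG': "\<And>d x. x \<in> G d \<Longrightarrow> \<phi> x \<in> G' d"
    and lift: "\<And>d y. y \<in> G' d \<Longrightarrow> \<exists>x\<in>G d. y - \<phi> x \<in> B'"
    and B: "\<And>d x. x \<in> G d \<Longrightarrow> x \<in> B \<longleftrightarrow> \<phi> x \<in> B'"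
  shows "koszul_vanishes s G B q d \<longleftrightarrow> koszul_vanishes s' G' B' q d"
proof -
  interpret G: graded_module s G by (rule G)
  interpret G': graded_module s' G' by (rule G')
  interpret \<phi>: module_hom s s' \<phi> by (rule \<phi>)
  show ?thesis
  proof
    assume kv: "koszul_vanishes s G B q d"
    show "koszul_vanishes s' G' B' q d"
      unfolding koszul_vanishes_def
    proof (intro allI impI, elim conjE)
      fix c' assume c': "\<forall>T. card T = q \<longrightarrow> c' T \<in> G' (d - int q)"
        and cyc: "\<forall>S. Suc (card S) = q \<longrightarrow> koszul_d s' c' S \<in> B'"
      define c where "c T = (SOME x. x \<in> G (d - int q) \<and> c' T - \<phi> x \<in> B')" for T
      have c: "c T \<in> G (d - int q)" "c' T - \<phi> (c T) \<in> B'" if "card T = q" for T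
      proof -
        have "\<exists>x. x \<in> G (d - int q) \<and> c' T - \<phi> x \<in> B'" using lift c' that by blast
        from someI_ex[OF this, folded c_def]
        show "c T \<in> G (d - int q)" "c' T - \<phi> (c T) \<in> B'" by auto
      qed
      have "koszul_d s c S \<in> B" if S: "Suc (card S) = q" for S
      proof -
        have "koszul_d s' (\<lambda>T. c' T - \<phi> (c T)) S \<in> B'"
          by (rule G'.koszul_d_subspace[OF B']) (use c S in auto)
        then have "koszul_d s' c' S - \<phi> (koszul_d s c S) \<in> B'"
          by (simp add: G'.koszul_d_diff koszul_d_hom[OF \<phi>])
        then have "koszul_d s' c' S - (koszul_d s' c' S - \<phi> (koszul_d s c S)) \<in> B'"
          using cyc S G'.subspace_diff[OF B'] by blast
        moreover have "koszul_d s c S \<in> G (d - int q + 1)"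
          by (rule G.koszul_d_G) (use c S in auto)
        ultimately show ?thesis using B by simp
      qed
      then obtain b where b: "\<And>T. card T = Suc q \<Longrightarrow> b T \<in> G (d - int (Suc q))"
        "\<And>T. card T = q \<Longrightarrow> c T - koszul_d s b T \<in> B"
        using kv[unfolded koszul_vanishes_def, rule_format, of c] c(1) by blast
      have "c' T - koszul_d s' (\<lambda>T. \<phi> (b T)) T \<in> B'" if T: "card T = q" for T
      proof -
        have "koszul_d s b T \<in> G (d - int (Suc q) + 1)"
          by (rule G.koszul_d_G) (use b T in auto)
        then have "c T - koszul_d s b T \<in> G (d - int q)" using c(1)[OF T] G.G_diff by simp
        then have "\<phi> (c T - koszul_d s b T) \<in> B'" using b(2)[OF T] B by blast
        then have "(c' T - \<phi> (c T)) + \<phi> (c T - koszul_d s b T) \<in> B'"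
          using c(2)[OF T] G'.subspace_add[OF B'] by blast
        then show ?thesis by (simp add: koszul_d_hom[OF \<phi>] \<phi>.diff)
      qed
      then show "\<exists>b. (\<forall>T. card T = Suc q \<longrightarrow> b T \<in> G' (d - int (Suc q))) \<and>
          (\<forall>T. card T = q \<longrightarrow> c' T - koszul_d s' b T \<in> B')"
        using b(1) GG' by (intro exI[of _ "\<lambda>T. \<phi> (b T)"]) blast
    qed
  next
    assume kv: "koszul_vanishes s' G' B' q d"
    show "koszul_vanishes s G B q d"
      unfolding koszul_vanishes_def
    proof (intro allI impI, elim conjE)
      fix c assume c: "\<forall>T. card T = q \<longrightarrow> c T \<in> G (d - int q)"
        and cyc: "\<forall>S. Suc (card S) = q \<longrightarrow> koszul_d s c S \<in> B"
      have "koszul_d s' (\<lambda>T. \<phi> (c T)) S \<in> B'" if S: "Suc (card S) = q" for S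
      proof -
        have "koszul_d s c S \<in> G (d - int q + 1)"
          by (rule G.koszul_d_G) (use c S in auto)
        then show ?thesis using B cyc S by (auto simp: koszul_d_hom[OF \<phi>])
      qed
      then obtain b' where b': "\<And>T. card T = Suc q \<Longrightarrow> b' T \<in> G' (d - int (Suc q))"
        "\<And>T. card T = q \<Longrightarrow> \<phi> (c T) - koszul_d s' b' T \<in> B'"
        using kv[unfolded koszul_vanishes_def, rule_format, of "\<lambda>T. \<phi> (c T)"] c GG' by blast
      define b where "b T = (SOME x. x \<in> G (d - int (Suc q)) \<and> b' T - \<phi> x \<in> B')" for T
      have b: "b T \<in> G (d - int (Suc q))" "b' T - \<phi> (b T) \<in> B'" if "card T = Suc q" for T
      proof -
        have "\<exists>x. x \<in> G (d - int (Suc q)) \<and> b' T - \<phi> x \<in> B'" using lift b' that by blast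
        from someI_ex[OF this, folded b_def]
        show "b T \<in> G (d - int (Suc q))" "b' T - \<phi> (b T) \<in> B'" by auto
      qed
      have "c T - koszul_d s b T \<in> B" if T: "card T = q" for T
      proof -
        have "koszul_d s b T \<in> G (d - int (Suc q) + 1)"
          by (rule G.koszul_d_G) (use b T in auto)
        then have mem: "c T - koszul_d s b T \<in> G (d - int q)" using c T G.G_diff by simp
        have "koszul_d s' (\<lambda>T. b' T - \<phi> (b T)) T \<in> B'"
          by (rule G'.koszul_d_subspace[OF B']) (use b T in auto)
        then have "koszul_d s' b' T - \<phi> (koszul_d s b T) \<in> B'"
          by (simp add: G'.koszul_d_diff koszul_d_hom[OF \<phi>])
        from G'.subspace_add[OF B' b'(2)[OF T] this]
        show ?thesis using B[OF mem] by (simp add: \<phi>.diff)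
      qed
      then show "\<exists>b. (\<forall>T. card T = Suc q \<longrightarrow> b T \<in> G (d - int (Suc q))) \<and>
          (\<forall>T. card T = q \<longrightarrow> c T - koszul_d s b T \<in> B)"
        using b(1) by blast
    qed
  qed
qed

section \<open>Graded free modules and the connecting homomorphism\<close>

abbreviation homs :: "int \<Rightarrow> ('v::finite, 'k::field) mpoly set" where
  "homs e \<equiv> {p. homogeneous e p}"

abbreviation vhoms :: "int list \<Rightarrow> int \<Rightarrow> (nat \<Rightarrow>\<^sub>0 ('v::finite, 'k::field) mpoly) set" where
  "vhoms ds e \<equiv> {x. homogeneous_vec ds e x}"

lemma graded_module_ring: "graded_module (*) homs"
  using homogeneous_mult[of 1]
  by unfold_locales (auto simp: homogeneous_add homogeneous_diff add.commute)

lemma graded_module_sub: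
  assumes Z: "vscale_module.subspace Z"
  shows "graded_module vscale (\<lambda>e. vhoms ds e \<inter> Z)"
proof unfold_locales
  fix d
  show "0 \<in> vhoms ds d \<inter> Z"
    using vscale_module.subspace_0[OF Z] by (simp add: homogeneous_vec_zero)
  fix x assume x: "x \<in> vhoms ds d \<inter> Z"
  then show "y \<in> vhoms ds d \<inter> Z \<Longrightarrow> x + y \<in> vhoms ds d \<inter> Z" for y
    using vscale_module.subspace_add[OF Z] by (simp add: homogeneous_vec_add)
  show "y \<in> vhoms ds d \<inter> Z \<Longrightarrow> x - y \<in> vhoms ds d \<inter> Z" for y
    using vscale_module.subspace_diff[OF Z] x by (simp add: homogeneous_vec_diff)
  show "vscale p x \<in> vhoms ds (d + 1) \<inter> Z" if "homogeneous 1 p" for p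
    using vscale_module.subspace_scale[OF Z] homogeneous_vec_vscale[OF that, of ds d x] x
    by (simp add: add.commute)
qed

lemma graded_module_free: "graded_module vscale (vhoms ds)"
  using graded_module_sub[OF vscale_module.subspace_UNIV, of ds] by simp

lemma lookup_koszul_d_vscale:
  "lookup (koszul_d vscale c S) k = koszul_d (*) (\<lambda>T. lookup (c T) k) S"
  by (simp add: koszul_d_def lookup_sum lookup_vscale)

definition no_constant :: "(nat \<Rightarrow>\<^sub>0 ('v::finite, 'k::field) mpoly) \<Rightarrow> bool" where
  "no_constant x \<longleftrightarrow> (\<forall>k. lookup (lookup x k) 0 = 0)"

lemma koszul_exact_free:
  fixes c :: "'v::finite set \<Rightarrow> (nat \<Rightarrow>\<^sub>0 ('v, 'k::field) mpoly)"
  assumes c: "\<And>T. card T = q \<Longrightarrow> c T \<in> vhoms ds (d - int q)"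
    and cyc: "\<And>S. Suc (card S) = q \<Longrightarrow> koszul_d vscale c S = 0"
    and q0: "q = 0 \<Longrightarrow> no_constant (c {})"
  obtains b where "\<And>T. b T \<in> vhoms ds (d - int (Suc q))"
    "\<And>T. card T = q \<Longrightarrow> c T = koszul_d vscale b T"
proof -
  have "\<exists>b. (\<forall>T. homogeneous (d - ds ! k - int (Suc q)) (b T)) \<and>
      (\<forall>T. card T = q \<longrightarrow> lookup (c T) k = koszul_d (*) b T)" if k: "k < length ds" for k
  proof -
    obtain b where "\<And>T. homogeneous (d - ds ! k - int (Suc q)) (b T)"
      "\<And>T. card T = q \<Longrightarrow> lookup (c T) k = koszul_d (*) b T"
    proof (rule koszul_exact_ring[of q "d - ds ! k" "\<lambda>T. lookup (c T) k"])
      show "homogeneous (d - ds ! k - int q) (lookup (c T) k)" if "card T = q" for T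
        using c[OF that] k by (simp add: homogeneous_vec_iff diff_diff_eq add.commute)
      show "koszul_d (*) (\<lambda>T. lookup (c T) k) S = 0" if "Suc (card S) = q" for S
        using cyc[OF that] by (simp add: lookup_koszul_d_vscale[symmetric])
      show "lookup (lookup (c {}) k) 0 = 0" if "q = 0"
        using q0[OF that] by (simp add: no_constant_def)
    qed blast
    then show ?thesis by blast
  qed
  then obtain \<beta> where \<beta>: "\<And>k T. k < length ds \<Longrightarrow> homogeneous (d - ds ! k - int (Suc q)) (\<beta> k T)"
    "\<And>k T. k < length ds \<Longrightarrow> card T = q \<Longrightarrow> lookup (c T) k = koszul_d (*) (\<beta> k) T"
    by metis
  define b where "b T = vec (length ds) (\<lambda>k. \<beta> k T)" for T
  have "b T \<in> vhoms ds (d - int (Suc q))" for T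
    using \<beta>(1) by (simp add: homogeneous_vec_iff b_def vec_free_mod lookup_vec diff_diff_eq add.commute)
  moreover have "c T = koszul_d vscale b T" if T: "card T = q" for T
  proof (rule poly_mapping_eqI)
    fix k
    show "lookup (c T) k = lookup (koszul_d vscale b T) k"
    proof (cases "k < length ds")
      case True
      then show ?thesis using \<beta>(2)[OF True T] by (simp add: lookup_koszul_d_vscale b_def lookup_vec)
    next
      case False
      then have "lookup (c T) k = 0" using c[OF T] by (simp add: homogeneous_vec_iff free_mod_iff)
      moreover have "lookup (koszul_d vscale b T) k = 0"
        using False unfolding lookup_koszul_d_vscale by (simp add: b_def lookup_vec koszul_d_def)
      ultimately show ?thesis by simp
    qed
  qed
  ultimately show ?thesis by (rule that)
qed

text \<open>The connecting homomorphism of \<open>0 \<rightarrow> Z \<rightarrow> F \<rightarrow> F/Z \<rightarrow> 0\<close>; in the lowest degree the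
  minimality of the presentation is needed.\<close>

lemma koszul_vanishes_connecting:
  fixes Z :: "(nat \<Rightarrow>\<^sub>0 ('v::finite, 'k::field) mpoly) set"
  assumes Z: "vscale_module.subspace Z" and min: "\<And>x. x \<in> Z \<Longrightarrow> no_constant x"
  shows "koszul_vanishes vscale (vhoms ds) Z (Suc q) d \<longleftrightarrow>
    koszul_vanishes vscale (\<lambda>e. vhoms ds e \<inter> Z) {0} q d"
proof
  interpret F: graded_module vscale "vhoms ds :: int \<Rightarrow> (nat \<Rightarrow>\<^sub>0 ('v, 'k) mpoly) set"
    by (rule graded_module_free)
  note dd = koszul_d_koszul_d[OF module_vscale]
  assume kv: "koszul_vanishes vscale (vhoms ds) Z (Suc q) d"
  show "koszul_vanishes vscale (\<lambda>e. vhoms ds e \<inter> Z) {0} q d"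
    unfolding koszul_vanishes_def
  proof (intro allI impI, elim conjE)
    fix c :: "'v set \<Rightarrow> (nat \<Rightarrow>\<^sub>0 ('v, 'k) mpoly)"
    assume c: "\<forall>T. card T = q \<longrightarrow> c T \<in> vhoms ds (d - int q) \<inter> Z"
      and cyc: "\<forall>S. Suc (card S) = q \<longrightarrow> koszul_d vscale c S \<in> {0}"
    \<comment> \<open>A cycle in \<open>Z\<close> bounds in the free module; for q = 0 this uses
      that elements of \<open>Z\<close> have no constant terms. The resulting \<open>b\<close> is a
      cycle modulo \<open>Z\<close>, and subtracting a boundary moves it into \<open>Z\<close>
      without changing its own boundary.\<close>
    obtain b where b: "\<And>T. b T \<in> vhoms ds (d - int (Suc q))"
      "\<And>T. card T = q \<Longrightarrow> c T = koszul_d vscale b T"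
      by (rule koszul_exact_free[of q c ds d]) (use c cyc min in auto)
    have "\<forall>S. Suc (card S) = Suc q \<longrightarrow> koszul_d vscale b S \<in> Z"
    proof (intro allI impI)
      fix S :: "'v set" assume "Suc (card S) = Suc q"
      then have "card S = q" by simp
      then show "koszul_d vscale b S \<in> Z" using b(2)[of S] c by (metis IntD2)
    qed
    then obtain e where e: "\<And>T. card T = Suc (Suc q) \<Longrightarrow> e T \<in> vhoms ds (d - int (Suc (Suc q)))"
      "\<And>T. card T = Suc q \<Longrightarrow> b T - koszul_d vscale e T \<in> Z"
      using kv[unfolded koszul_vanishes_def, rule_format, of b] b(1) by blast
    define b' where "b' T = b T - koszul_d vscale e T" for T
    have "b' T \<in> vhoms ds (d - int (Suc q)) \<inter> Z" if T: "card T = Suc q" for T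
    proof -
      have "koszul_d vscale e T \<in> vhoms ds (d - int (Suc (Suc q)) + 1)"
        by (rule F.koszul_d_G) (use e T in auto)
      moreover have "d - int (Suc (Suc q)) + 1 = d - int (Suc q)" by simp
      ultimately have "koszul_d vscale e T \<in> vhoms ds (d - int (Suc q))" by metis
      then have "b' T \<in> vhoms ds (d - int (Suc q))" unfolding b'_def by (rule F.G_diff[OF b(1)])
      then show ?thesis using e(2)[OF T] by (simp add: b'_def)
    qed
    moreover have "c T - koszul_d vscale b' T \<in> {0}" if T: "card T = q" for T
      unfolding b'_def using b(2)[OF T] by (simp add: F.koszul_d_diff dd)
    ultimately show "\<exists>b. (\<forall>T. card T = Suc q \<longrightarrow> b T \<in> vhoms ds (d - int (Suc q)) \<inter> Z) \<and>
        (\<forall>T. card T = q \<longrightarrow> c T - koszul_d vscale b T \<in> {0})"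
      by blast
  qed
next
  interpret F: graded_module vscale "vhoms ds :: int \<Rightarrow> (nat \<Rightarrow>\<^sub>0 ('v, 'k) mpoly) set"
    by (rule graded_module_free)
  note dd = koszul_d_koszul_d[OF module_vscale]
  assume kv: "koszul_vanishes vscale (\<lambda>e. vhoms ds e \<inter> Z) {0} q d"
  show "koszul_vanishes vscale (vhoms ds) Z (Suc q) d"
    unfolding koszul_vanishes_def
  proof (intro allI impI, elim conjE)
    fix c :: "'v set \<Rightarrow> (nat \<Rightarrow>\<^sub>0 ('v, 'k) mpoly)"
    assume c: "\<forall>T. card T = Suc q \<longrightarrow> c T \<in> vhoms ds (d - int (Suc q))"
      and cyc: "\<forall>S. Suc (card S) = Suc q \<longrightarrow> koszul_d vscale c S \<in> Z"
    have "koszul_d vscale c T \<in> vhoms ds (d - int q) \<inter> Z" if T: "card T = q" for T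
    proof -
      have "koszul_d vscale c T \<in> vhoms ds (d - int (Suc q) + 1)"
        by (rule F.koszul_d_G) (use c T in auto)
      then show ?thesis using cyc T by simp
    qed
    moreover have "koszul_d vscale (koszul_d vscale c) S \<in> {0}" for S by (simp add: dd)
    ultimately obtain b where b: "\<And>T. card T = Suc q \<Longrightarrow> b T \<in> vhoms ds (d - int (Suc q)) \<inter> Z"
      "\<And>T. card T = q \<Longrightarrow> koszul_d vscale c T - koszul_d vscale b T \<in> {0}"
      using kv[unfolded koszul_vanishes_def, rule_format, of "koszul_d vscale c"] by blast
    \<comment> \<open>In the other direction \<open>c\<close> and \<open>b\<close> have the same
      boundary, so their difference is a cycle of positive length in the free module and hence a
      boundary; modulo \<open>Z\<close> this difference is \<open>c\<close>.\<close>
    obtain e where e: "\<And>T. e T \<in> vhoms ds (d - int (Suc (Suc q)))"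
      "\<And>T. card T = Suc q \<Longrightarrow> c T - b T = koszul_d vscale e T"
    proof (rule koszul_exact_free[of "Suc q" "\<lambda>T. c T - b T" ds d])
      show "c T - b T \<in> vhoms ds (d - int (Suc q))" if "card T = Suc q" for T
        using c b(1) that by (intro F.G_diff) auto
      show "koszul_d vscale (\<lambda>T. c T - b T) S = 0" if "Suc (card S) = Suc q" for S
        using b(2) that by (simp add: F.koszul_d_diff)
    qed auto
    have "c T - koszul_d vscale e T \<in> Z" if T: "card T = Suc q" for T
    proof -
      have "c T - koszul_d vscale e T = b T" using e(2)[OF T] by (simp add: algebra_simps)
      then show ?thesis using b(1)[OF T] by simp
    qed
    then show "\<exists>b. (\<forall>T. card T = Suc (Suc q) \<longrightarrow> b T \<in> vhoms ds (d - int (Suc (Suc q)))) \<and>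
        (\<forall>T. card T = Suc q \<longrightarrow> c T - koszul_d vscale b T \<in> Z)"
      using e(1) by blast
  qed
qed

lemma no_constant_koszul_d: "no_constant (koszul_d vscale b S)"
proof -
  have "lookup (sg v S * X v * p) 0 = 0" for v and p :: "('a, 'b) mpoly"
    unfolding mult.assoc lookup_sg_times lookup_X_times by simp
  then show ?thesis
    unfolding no_constant_def lookup_koszul_d_vscale unfolding koszul_d_def lookup_sum by simp
qed

text \<open>Homology in position 0 is the quotient of F by Z + mF, with m the maximal ideal. As Z
  lies in mF, this is F/mF, whose degree \<open>d\<close> part has the basis vectors of shift
  \<open>d\<close> as a basis.\<close>

lemma koszul_vanishes_0_iff:
  fixes Z :: "(nat \<Rightarrow>\<^sub>0 ('v::finite, 'k::field) mpoly) set"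
  assumes Z: "vscale_module.subspace Z" and min: "\<And>x. x \<in> Z \<Longrightarrow> no_constant x"
  shows "koszul_vanishes vscale (vhoms ds) Z 0 d \<longleftrightarrow> d \<notin> set ds"
proof
  assume kv: "koszul_vanishes vscale (vhoms ds) Z 0 d"
  show "d \<notin> set ds"
  proof
    assume "d \<in> set ds"
    then obtain k where k: "k < length ds" "ds ! k = d" by (auto simp: in_set_conv_nth)
    then have "unit_vec k \<in> (vhoms ds d :: (nat \<Rightarrow>\<^sub>0 ('v, 'k) mpoly) set)"
      using homogeneous_vec_unit_vec by blast
    then have pre: "(\<forall>T :: 'v set. card T = 0 \<longrightarrow> (unit_vec k :: nat \<Rightarrow>\<^sub>0 ('v, 'k) mpoly) \<in> vhoms ds (d - int 0)) \<and>
        (\<forall>S :: 'v set. Suc (card S) = 0 \<longrightarrow> koszul_d vscale (\<lambda>_. unit_vec k) S \<in> Z)"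
      by simp
    have "\<exists>b. (\<forall>T :: 'v set. card T = Suc 0 \<longrightarrow> b T \<in> vhoms ds (d - int (Suc 0))) \<and>
        (\<forall>T. card T = 0 \<longrightarrow> unit_vec k - koszul_d vscale b T \<in> Z)"
      by (rule kv[unfolded koszul_vanishes_def, THEN spec, THEN mp, OF pre])
    then obtain b :: "'v set \<Rightarrow> (nat \<Rightarrow>\<^sub>0 ('v, 'k) mpoly)"
      where "\<forall>T. card T = 0 \<longrightarrow> unit_vec k - koszul_d vscale b T \<in> Z"
      by (elim exE conjE)
    then have "unit_vec k - koszul_d vscale b {} \<in> Z" by (elim allE[of _ "{}"]) simp
    then have "no_constant (unit_vec k - koszul_d vscale b {})" by (rule min)
    with no_constant_koszul_d[of b "{}"] have "lookup (lookup (unit_vec k :: nat \<Rightarrow>\<^sub>0 ('v, 'k) mpoly) k) 0 = 0"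
      by (simp add: no_constant_def lookup_minus)
    then show False by (simp add: lookup_unit_vec)
  qed
next
  assume d: "d \<notin> set ds"
  show "koszul_vanishes vscale (vhoms ds) Z 0 d"
    unfolding koszul_vanishes_def
  proof (intro allI impI, elim conjE)
    fix c :: "'v set \<Rightarrow> (nat \<Rightarrow>\<^sub>0 ('v, 'k) mpoly)"
    assume c: "\<forall>T. card T = 0 \<longrightarrow> c T \<in> vhoms ds (d - int 0)"
    have nc: "no_constant (c {})"
      unfolding no_constant_def
    proof
      fix k
      have c0: "homogeneous_vec ds d (c {})" using c by simp
      show "lookup (lookup (c {}) k) 0 = 0"
      proof (cases "k < length ds")
        case True
        then have "homogeneous (d - ds ! k) (lookup (c {}) k)" "d - ds ! k \<noteq> 0"
          using c0 d nth_mem[of k ds] by (auto simp: homogeneous_vec_iff)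
        then show ?thesis by (simp add: homogeneous_iff)
      next
        case False
        then show ?thesis using c0 by (simp add: homogeneous_vec_iff free_mod_iff)
      qed
    qed
    obtain b where b: "\<And>T. b T \<in> vhoms ds (d - int (Suc 0))"
      "\<And>T. card T = 0 \<Longrightarrow> c T = koszul_d vscale b T"
      by (rule koszul_exact_free[of 0 c ds d]) (use c nc in auto)
    then show "\<exists>b. (\<forall>T. card T = Suc 0 \<longrightarrow> b T \<in> vhoms ds (d - int (Suc 0))) \<and>
        (\<forall>T. card T = 0 \<longrightarrow> c T - koszul_d vscale b T \<in> Z)"
      using vscale_module.subspace_0[OF Z] by (intro exI[of _ b]) simp
  qed
qed

section \<open>Minimal resolutions\<close>

text \<open>\<open>Z\<close> is the module of \<open>i\<close>-th syzygies (the kernel \<open>F\<^sub>i \<rightarrow> F\<^sub>i\<^sub>-\<^sub>1\<close>) of a minimal resolution, where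
  \<open>F\<^sub>i\<close> has the shifts \<open>ds\<close>. The last condition is dimension shifting along the resolution.\<close>

definition syzygy_stage ::
  "('v::finite, 'k::field) mpoly set \<Rightarrow> nat \<Rightarrow> int list \<Rightarrow> (nat \<Rightarrow>\<^sub>0 ('v, 'k) mpoly) set \<Rightarrow> bool" where
  "syzygy_stage I i ds Z \<longleftrightarrow>
     vscale_module.subspace Z \<and> Z \<subseteq> free_mod (length ds) \<and> (\<forall>x\<in>Z. no_constant x) \<and>
     (\<forall>x\<in>Z. \<forall>e. hvcomp ds e x \<in> Z) \<and>
     (\<forall>q d. koszul_vanishes vscale (vhoms ds) Z q d \<longleftrightarrow> koszul_vanishes (*) homs I (q + i) d)"

text \<open>By surjectivity and the definition of \<open>Z\<close>, the map \<epsilon> identifies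
  F/Z with R/I degree by degree.\<close>

lemma syzygy_stage_0:
  fixes I :: "('v::finite, 'k::field) mpoly set"
  assumes I: "mult_module.subspace I" and I_graded: "\<And>p e. p \<in> I \<Longrightarrow> hcomp e p \<in> I"
    and \<epsilon>: "module_hom vscale (*) \<epsilon>"
    and hom: "\<And>k. k < length ds \<Longrightarrow> homogeneous (ds ! k) (\<epsilon> (unit_vec k))"
    and surj: "\<And>p. \<exists>x\<in>free_mod (length ds). p - \<epsilon> x \<in> I"
    and Z: "Z = {x \<in> free_mod (length ds). \<epsilon> x \<in> I}"
    and min: "\<And>x. x \<in> Z \<Longrightarrow> no_constant x"
  shows "syzygy_stage I 0 ds Z"
proof -
  interpret \<epsilon>: module_hom vscale "(*)" \<epsilon> by (rule \<epsilon>)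
  note comp = hcomp_graded_hom[OF \<epsilon> _ hom]
  have hv: "hvcomp ds e x \<in> free_mod (length ds)" for e and x :: "nat \<Rightarrow>\<^sub>0 ('v, 'k) mpoly"
    by (simp add: hvcomp_def vec_free_mod)
  have sub: "vscale_module.subspace Z"
    unfolding Z using vscale_module.subspace_inter[OF subspace_free_mod \<epsilon>.subspace_linear_preimage[OF I]]
    by (simp add: Int_def)
  have "koszul_vanishes vscale (vhoms ds) Z q d \<longleftrightarrow> koszul_vanishes (*) homs I q d" for q d
  proof (rule koszul_vanishes_transport[OF graded_module_free graded_module_ring \<epsilon> I])
    fix d and x :: "nat \<Rightarrow>\<^sub>0 ('v, 'k) mpoly" assume x: "x \<in> vhoms ds d"
    then have xf: "x \<in> free_mod (length ds)" by (simp add: homogeneous_vec_iff)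
    have "\<epsilon> x = hcomp d (\<epsilon> x)" using comp[OF xf, of d] x by (simp add: hvcomp_homogeneous)
    then show "\<epsilon> x \<in> homs d" using homogeneous_hcomp[of d "\<epsilon> x"] by simp
    show "x \<in> Z \<longleftrightarrow> \<epsilon> x \<in> I" using xf by (simp add: Z)
  next
    fix d and y :: "('v, 'k) mpoly" assume y: "y \<in> homs d"
    obtain x where x: "x \<in> free_mod (length ds)" "y - \<epsilon> x \<in> I" using surj by blast
    have "hcomp d y = hcomp d (y - \<epsilon> x) + hcomp d (\<epsilon> x)" by (simp add: hcomp_add[symmetric])
    moreover have "hcomp d y = y" using y by (simp add: hcomp_homogeneous)
    ultimately have "y - \<epsilon> (hvcomp ds d x) = hcomp d (y - \<epsilon> x)"
      using comp[OF x(1), of d] by (metis add_diff_cancel_right')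
    then have "y - \<epsilon> (hvcomp ds d x) \<in> I" using I_graded[OF x(2)] by simp
    then show "\<exists>x\<in>vhoms ds d. y - \<epsilon> x \<in> I" using homogeneous_hvcomp[of ds d x] by blast
  qed
  moreover have "hvcomp ds e x \<in> Z" if "x \<in> Z" for x e
    using that hv comp[of x e] I_graded[of "\<epsilon> x" e] by (auto simp: Z)
  ultimately show ?thesis
    using sub min by (auto simp: syzygy_stage_def Z)
qed

text \<open>The map \<delta> identifies the quotient of the new free module by Z' with Z, and the
  connecting homomorphism identifies homology of Z in position q with that of F/Z in position q + 1.
  Together they shift the position by one.\<close>

lemma syzygy_stage_Suc:
  fixes I :: "('v::finite, 'k::field) mpoly set"
  assumes stage: "syzygy_stage I i ds Z"
    and \<delta>: "module_hom vscale vscale \<delta>"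
    and hom: "\<And>k. k < length ds' \<Longrightarrow> homogeneous_vec ds (ds' ! k) (\<delta> (unit_vec k))"
    and im: "\<delta> ` free_mod (length ds') = Z"
    and Z': "Z' = {x \<in> free_mod (length ds'). \<delta> x = 0}"
    and min: "\<And>x. x \<in> Z' \<Longrightarrow> no_constant x"
  shows "syzygy_stage I (Suc i) ds' Z'"
proof -
  interpret \<delta>: module_hom vscale vscale \<delta> by (rule \<delta>)
  have Z: "vscale_module.subspace Z" and minZ: "\<And>x. x \<in> Z \<Longrightarrow> no_constant x"
    and kv: "\<And>q d. koszul_vanishes vscale (vhoms ds) Z q d \<longleftrightarrow> koszul_vanishes (*) homs I (q + i) d"
    using stage by (auto simp: syzygy_stage_def)
  note comp = hvcomp_graded_hom[OF \<delta> _ hom]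
  have hv: "hvcomp ds' e x \<in> free_mod (length ds')" for e and x :: "nat \<Rightarrow>\<^sub>0 ('v, 'k) mpoly"
    by (simp add: hvcomp_def vec_free_mod)
  have sub: "vscale_module.subspace Z'"
    unfolding Z' using vscale_module.subspace_inter[OF subspace_free_mod \<delta>.subspace_kernel]
    by (simp add: Int_def)
  have "koszul_vanishes vscale (vhoms ds') Z' q d \<longleftrightarrow> koszul_vanishes vscale (\<lambda>e. vhoms ds e \<inter> Z) {0} q d"
    for q d
  proof (rule koszul_vanishes_transport[OF graded_module_free graded_module_sub[OF Z] \<delta>
        vscale_module.subspace_single_0])
    fix d and x :: "nat \<Rightarrow>\<^sub>0 ('v, 'k) mpoly" assume x: "x \<in> vhoms ds' d"
    then have xf: "x \<in> free_mod (length ds')" by (simp add: homogeneous_vec_iff)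
    have "\<delta> x = hvcomp ds d (\<delta> x)" using comp[OF xf, of d] x by (simp add: hvcomp_homogeneous)
    then show "\<delta> x \<in> vhoms ds d \<inter> Z" using homogeneous_hvcomp[of ds d "\<delta> x"] xf im by auto
    show "x \<in> Z' \<longleftrightarrow> \<delta> x \<in> {0}" using xf by (simp add: Z')
  next
    fix d and y :: "nat \<Rightarrow>\<^sub>0 ('v, 'k) mpoly" assume y: "y \<in> vhoms ds d \<inter> Z"
    then obtain x where x: "x \<in> free_mod (length ds')" "y = \<delta> x" using im by blast
    have "homogeneous_vec ds d y" using y by simp
    then have "y = hvcomp ds d y" by (simp add: hvcomp_homogeneous)
    then have "y = \<delta> (hvcomp ds' d x)" using comp[OF x(1), of d] x(2) by metis
    then show "\<exists>x\<in>vhoms ds' d. y - \<delta> x \<in> {0}"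
      using homogeneous_hvcomp[of ds' d x] by (intro bexI[of _ "hvcomp ds' d x"]) auto
  qed
  then have "koszul_vanishes vscale (vhoms ds') Z' q d \<longleftrightarrow> koszul_vanishes (*) homs I (q + Suc i) d" for q d
    using koszul_vanishes_connecting[OF Z minZ, of ds q d] kv[of "Suc q" d] by simp
  moreover have "hvcomp ds' e x \<in> Z'" if "x \<in> Z'" for x e
    using that hv comp[of x e] by (auto simp: Z')
  ultimately show ?thesis
    using sub min by (auto simp: syzygy_stage_def Z')
qed

lemma syzygy_stage_shift_iff:
  assumes "syzygy_stage I i ds Z"
  shows "d \<in> set ds \<longleftrightarrow> \<not> koszul_vanishes (*) homs I i d"
  using assms koszul_vanishes_0_iff[of Z ds d] by (auto simp: syzygy_stage_def)

text \<open>Valid for every minimal resolution, so the choice made in \<open>graded_betti\<close>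
  has no influence. The images of the differentials serve as the syzygy modules.\<close>

lemma minimal_resolution_shift_iff:
  fixes I :: "('v::finite, 'k::field) mpoly set"
  assumes res: "minimal_graded_free_resolution I ds \<delta> \<epsilon>"
    and I: "mult_module.subspace I" and I_graded: "\<And>p e. p \<in> I \<Longrightarrow> hcomp e p \<in> I"
  shows "d \<in> set (ds i) \<longleftrightarrow> \<not> koszul_vanishes (*) homs I i d"
proof -
  have R: "\<And>i. module_hom vscale vscale (\<delta> i)" "module_hom vscale (*) \<epsilon>"
      "\<And>p. \<exists>x\<in>free_mod (length (ds 0)). p - \<epsilon> x \<in> I"
      "\<delta> 0 ` free_mod (length (ds 1)) = {x \<in> free_mod (length (ds 0)). \<epsilon> x \<in> I}"
      "\<And>i. \<delta> (Suc i) ` free_mod (length (ds (Suc (Suc i)))) = {x \<in> free_mod (length (ds (Suc i))). \<delta> i x = 0}"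
    and H: "\<And>k. k < length (ds 0) \<Longrightarrow> homogeneous (ds 0 ! k) (\<epsilon> (unit_vec k))"
      "\<And>i k. k < length (ds (Suc i)) \<Longrightarrow> homogeneous_vec (ds i) (ds (Suc i) ! k) (\<delta> i (unit_vec k))"
    and M: "\<And>i x. x \<in> free_mod (length (ds (Suc i))) \<Longrightarrow> no_constant (\<delta> i x)"
    using res by (auto simp: minimal_graded_free_resolution_def resolution_def max_ideal_eq no_constant_def)
  have "syzygy_stage I i (ds i) (\<delta> i ` free_mod (length (ds (Suc i))))"
  proof (induction i)
    case 0
    show ?case
    proof (rule syzygy_stage_0[OF I I_graded R(2) H(1) R(3)])
      show "\<delta> 0 ` free_mod (length (ds (Suc 0))) = {x \<in> free_mod (length (ds 0)). \<epsilon> x \<in> I}"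
        using R(4) by simp
    qed (use M in blast)+
  next
    case (Suc i)
    show ?case
      by (rule syzygy_stage_Suc[OF Suc R(1) H(2) refl R(5)]) (use M in blast)+
  qed
  then show ?thesis by (rule syzygy_stage_shift_iff)
qed

section \<open>Finite generation of syzygies and construction of a resolution\<close>

lemma vector_space_vscale:
  "vector_space (\<lambda>(c::'k::field) (x :: nat \<Rightarrow>\<^sub>0 ('v, 'k) mpoly). vscale (single 0 c) x)"
  by unfold_locales
    (simp_all add: vscale_module.scale_right_distrib vscale_module.scale_left_distrib single_add mult_single)

text \<open>Linear algebra over the field of constants: the degree \<open>d\<close> part of the free
  module is spanned by finitely many monomial multiples of basis vectors, so an independent subset
  of it is finite.\<close>

lemma finite_spanning_homogeneous:
  fixes Z :: "(nat \<Rightarrow>\<^sub>0 ('v::finite, 'k::field) mpoly) set"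
  obtains B where "finite B" "B \<subseteq> vhoms ds d \<inter> Z" "vhoms ds d \<inter> Z \<subseteq> vscale_module.span B"
proof -
  interpret V: vector_space "\<lambda>(c::'k) (x :: nat \<Rightarrow>\<^sub>0 ('v, 'k) mpoly). vscale (single 0 c) x"
    by (rule vector_space_vscale)
  define M :: "(nat \<Rightarrow>\<^sub>0 ('v, 'k) mpoly) set"
    where "M = (\<Union>k<length ds. (\<lambda>\<beta>. single k (single \<beta> 1)) ` {\<beta>. int (mdeg \<beta>) = d - ds ! k})"
  have finM: "finite M" by (simp add: M_def finite_mdeg)
  have "x \<in> V.span M" if x: "homogeneous_vec ds d x" for x
  proof -
    have "vscale p (unit_vec k) \<in> V.span M" if k: "k < length ds" and p: "homogeneous (d - ds ! k) p" for k p
    proof -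
      have "vscale p (unit_vec k) = (\<Sum>\<beta>\<in>keys p. vscale (single 0 (lookup p \<beta>)) (single k (single \<beta> 1)))"
      proof -
        have "vscale (single 0 (lookup p \<beta>)) (single k (single \<beta> 1)) = vscale (single \<beta> (lookup p \<beta>)) (unit_vec k)"
          for \<beta>
          by (rule poly_mapping_eqI) (auto simp: lookup_vscale lookup_unit_vec lookup_single when_def mult_single)
        then show ?thesis
          by (subst (1) poly_mapping_sum_single[of p]) (simp add: vscale_module.scale_sum_left)
      qed
      moreover have "single k (single \<beta> 1) \<in> M" if "\<beta> \<in> keys p" for \<beta>
        unfolding M_def using k p that by (intro UN_I[of k]) (auto simp: homogeneous_def)
      ultimately show ?thesis
        by (simp only:) (intro V.span_sum V.span_scale V.span_base)
    qed
    moreover have "x = (\<Sum>k<length ds. vscale (lookup x k) (unit_vec k))"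
      using x vec_lookup[of x "length ds"] by (simp add: homogeneous_vec_iff vec_def)
    ultimately show ?thesis
      using x by (metis (no_types, lifting) V.span_sum homogeneous_vec_iff lessThan_iff)
  qed
  then have sub: "vhoms ds d \<inter> Z \<subseteq> V.span M" by blast
  obtain B where B: "B \<subseteq> vhoms ds d \<inter> Z" "V.independent B" "vhoms ds d \<inter> Z \<subseteq> V.span B"
    by (rule V.maximal_independent_subset)
  have "finite B" using V.independent_span_bound[OF finM B(2)] B(1) sub by blast
  moreover have "V.span B \<subseteq> vscale_module.span B"
    by (intro V.span_minimal V.subspaceI vscale_module.span_superset vscale_module.span_zero
        vscale_module.span_add vscale_module.span_scale)
  ultimately show ?thesis using that B by blast
qed

text \<open>Takes the place of the Hilbert basis theorem. Vanishing in position 0 says that an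
  element of \<open>Z\<close> of degree above \<open>N\<close> is a combination of elements of
  \<open>Z\<close> of one degree less with variables as coefficients, so generators of degree at
  most \<open>N\<close> suffice.\<close>

lemma homogeneous_generators:
  fixes Z :: "(nat \<Rightarrow>\<^sub>0 ('v::finite, 'k::field) mpoly) set"
  assumes Z: "vscale_module.subspace Z" and free: "Z \<subseteq> free_mod (length ds)"
    and graded: "\<And>x e. x \<in> Z \<Longrightarrow> hvcomp ds e x \<in> Z"
    and gen: "\<And>d. d > N \<Longrightarrow> koszul_vanishes vscale (\<lambda>e. vhoms ds e \<inter> Z) {0} 0 d"
  obtains A where "finite A" "\<And>a. a \<in> A \<Longrightarrow> \<exists>e. homogeneous_vec ds e a" "vscale_module.span A = Z"
proof -
  have "\<forall>d. \<exists>B. finite B \<and> B \<subseteq> vhoms ds d \<inter> Z \<and> vhoms ds d \<inter> Z \<subseteq> vscale_module.span B"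
    by (meson finite_spanning_homogeneous)
  then obtain B where B: "\<And>d. finite (B d)" "\<And>d. B d \<subseteq> vhoms ds d \<inter> Z"
      "\<And>d. vhoms ds d \<inter> Z \<subseteq> vscale_module.span (B d)"
    by metis
  \<comment> \<open>Below the least shift the free module is 0, which starts the induction on
    degrees. The extra 0 keeps the set nonempty when \<open>ds\<close> is empty.\<close>
  define lo where "lo = Min (insert 0 (set ds))"
  have lo: "lo \<le> ds ! k" if "k < length ds" for k
    unfolding lo_def using that by (intro Min_le) auto
  define A where "A = (\<Union>d\<in>{lo..N}. B d)"
  have AZ: "A \<subseteq> Z" using B(2) by (auto simp: A_def)
  have deg: "vhoms ds d \<inter> Z \<subseteq> vscale_module.span A" if "d < lo + int n" for d n
    using that
  proof (induction n arbitrary: d)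
    case 0
    have "x = 0" if "homogeneous_vec ds d x" for x :: "nat \<Rightarrow>\<^sub>0 ('v, 'k) mpoly"
    proof (rule poly_mapping_eqI, rule poly_mapping_eqI)
      fix k \<beta>
      show "lookup (lookup x k) \<beta> = lookup (lookup 0 k) \<beta>"
      proof (cases "k < length ds")
        case True
        then have "int (mdeg \<beta>) \<noteq> d - ds ! k" using 0 lo[OF True] by auto
        then show ?thesis using that True by (simp add: homogeneous_vec_iff homogeneous_iff)
      next
        case False
        then show ?thesis using that by (simp add: homogeneous_vec_iff free_mod_iff)
      qed
    qed
    then show ?case using vscale_module.span_zero by blast
  next
    case (Suc n)
    show ?case
    proof (cases "d < lo + int n")
      case True
      then show ?thesis by (rule Suc.IH)
    next
      case ge: False
      show ?thesis
      proof (cases "d \<le> N")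
        case True
        then have "B d \<subseteq> A" unfolding A_def using ge by (intro UN_upper) auto
        then show ?thesis using B(3)[of d] vscale_module.span_mono by blast
      next
        case False
        show ?thesis
        proof
          fix x assume x: "x \<in> vhoms ds d \<inter> Z"
          have pre: "(\<forall>T :: 'v set. card T = 0 \<longrightarrow> x \<in> vhoms ds (d - int 0) \<inter> Z) \<and>
              (\<forall>S :: 'v set. Suc (card S) = 0 \<longrightarrow> koszul_d vscale (\<lambda>_. x) S \<in> {0})"
            using x by simp
          have "\<exists>b. (\<forall>T :: 'v set. card T = Suc 0 \<longrightarrow> b T \<in> vhoms ds (d - int (Suc 0)) \<inter> Z) \<and>
              (\<forall>T. card T = 0 \<longrightarrow> x - koszul_d vscale b T \<in> {0})"
            using False by (intro gen[unfolded koszul_vanishes_def, THEN spec, THEN mp, OF _ pre]) simp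
          then obtain b :: "'v set \<Rightarrow> (nat \<Rightarrow>\<^sub>0 ('v, 'k) mpoly)"
            where b: "\<forall>T. card T = Suc 0 \<longrightarrow> b T \<in> vhoms ds (d - int (Suc 0)) \<inter> Z"
              "\<forall>T. card T = 0 \<longrightarrow> x - koszul_d vscale b T \<in> {0}"
            by (elim exE conjE)
          have "b {v} \<in> vscale_module.span A" for v
            using b(1)[rule_format, of "{v}"] Suc.IH[of "d - int (Suc 0)"] Suc.prems by auto
          then have "koszul_d vscale b {} \<in> vscale_module.span A"
            unfolding koszul_d_def by (intro vscale_module.span_sum vscale_module.span_scale) simp
          moreover have "x = koszul_d vscale b {}" using b(2)[rule_format, of "{}"] by simp
          ultimately show "x \<in> vscale_module.span A" by simp
        qed
      qed
    qed
  qed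
  have deg': "vhoms ds d \<inter> Z \<subseteq> vscale_module.span A" for d
    by (rule deg[of d "nat (d - lo + 1)"]) simp
  have "Z \<subseteq> vscale_module.span A"
  proof
    fix x assume x: "x \<in> Z"
    then obtain D where D: "finite D" "x = (\<Sum>e\<in>D. hvcomp ds e x)"
      using hvcomp_sum free by blast
    have "hvcomp ds e x \<in> vscale_module.span A" for e
      using deg'[of e] graded[OF x] homogeneous_hvcomp[of ds e x] by blast
    then show "x \<in> vscale_module.span A"
      by (subst D(2)) (rule vscale_module.span_sum)
  qed
  then have "vscale_module.span A = Z"
    using vscale_module.span_minimal[OF AZ Z] by blast
  moreover have "finite A" by (simp add: A_def B(1))
  moreover have "\<exists>e. homogeneous_vec ds e a" if "a \<in> A" for a
    using that B(2) unfolding A_def by blast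
  ultimately show ?thesis using that by blast
qed

text \<open>Homogeneous generators of least number have no relation with a unit coefficient.\<close>

lemma minimal_presentation:
  fixes Z :: "(nat \<Rightarrow>\<^sub>0 ('v::finite, 'k::field) mpoly) set"
  assumes fg: "\<exists>A. finite A \<and> (\<forall>a\<in>A. \<exists>e. homogeneous_vec ds e a) \<and> vscale_module.span A = Z"
  obtains ds' \<delta> where "module_hom vscale vscale \<delta>"
    "\<And>k. k < length ds' \<Longrightarrow> homogeneous_vec ds (ds' ! k) (\<delta> (unit_vec k))"
    "\<delta> ` free_mod (length ds') = Z"
    "\<And>x. x \<in> free_mod (length ds') \<Longrightarrow> \<delta> x = 0 \<Longrightarrow> no_constant x"
proof -
  define P where "P A \<longleftrightarrow> finite A \<and> (\<forall>a\<in>A. \<exists>e. homogeneous_vec ds e a) \<and> vscale_module.span A = Z" for A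
  obtain A0 where "P A0" using fg by (auto simp: P_def)
  from ex_has_least_nat[of P A0 card, OF this]
  obtain A where A: "P A" and least: "\<And>A'. P A' \<Longrightarrow> card A \<le> card A'" by blast
  obtain gs where gs: "set gs = A" "distinct gs" using A finite_distinct_list by (auto simp: P_def)
  obtain deg where deg: "\<And>a. a \<in> A \<Longrightarrow> homogeneous_vec ds (deg a) a"
    using A unfolding P_def by metis
  define ds' where "ds' = map deg gs"
  define \<delta> where "\<delta> x = (\<Sum>k<length gs. vscale (lookup x k) (gs ! k))" for x :: "nat \<Rightarrow>\<^sub>0 ('v, 'k) mpoly"
  have len: "length ds' = length gs" by (simp add: ds'_def)
  have hom: "module_hom vscale vscale \<delta>"
    by unfold_locales (simp_all add: \<delta>_def lookup_add lookup_vscale vscale_module.scale_left_distrib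
        sum.distrib vscale_module.scale_sum_right)
  have \<delta>_unit: "\<delta> (unit_vec k) = gs ! k" if "k < length gs" for k
  proof -
    have "\<delta> (unit_vec k) = (\<Sum>l<length gs. if l = k then gs ! k else 0)"
      unfolding \<delta>_def by (intro sum.cong) (auto simp: lookup_unit_vec)
    then show ?thesis using that by simp
  qed
  have homk: "homogeneous_vec ds (ds' ! k) (\<delta> (unit_vec k))" if "k < length ds'" for k
    using that deg[of "gs ! k"] gs(1) by (auto simp: \<delta>_unit len ds'_def)
  have "\<delta> ` free_mod (length ds') = Z"
  proof (intro equalityI subsetI)
    fix y assume "y \<in> \<delta> ` free_mod (length ds')"
    then obtain x where "y = \<delta> x" by blast
    moreover have "gs ! k \<in> vscale_module.span A" if "k < length gs" for k
      using that gs(1) by (intro vscale_module.span_base) auto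
    ultimately have "y \<in> vscale_module.span A"
      by (auto simp: \<delta>_def intro!: vscale_module.span_sum vscale_module.span_scale)
    then show "y \<in> Z" using A by (simp add: P_def)
  next
    fix y assume "y \<in> Z"
    then have "y \<in> vscale_module.span A" using A by (simp add: P_def)
    moreover have "vscale_module.span A \<subseteq> \<delta> ` free_mod (length ds')"
    proof (rule vscale_module.span_minimal)
      show "A \<subseteq> \<delta> ` free_mod (length ds')"
      proof
        fix a assume "a \<in> A"
        then obtain k where "k < length gs" "gs ! k = a" using gs(1) by (metis in_set_conv_nth)
        then show "a \<in> \<delta> ` free_mod (length ds')"
          using \<delta>_unit unit_vec_free[of k "length ds'"] len by (metis image_eqI)
      qed
      show "vscale_module.subspace (\<delta> ` free_mod (length ds'))"
        by (rule module_hom.subspace_image[OF hom subspace_free_mod])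
    qed
    ultimately show "y \<in> \<delta> ` free_mod (length ds')" by blast
  qed
  moreover have "no_constant x" if x: "x \<in> free_mod (length ds')" "\<delta> x = 0" for x
    unfolding no_constant_def
  proof (intro allI, rule ccontr)
    fix k assume c0: "lookup (lookup x k) 0 \<noteq> 0"
    define c where "c = lookup (lookup x k) 0"
    have c: "c \<noteq> 0" using c0 by (simp add: c_def)
    have k: "k < length gs"
    proof (rule ccontr)
      assume "\<not> k < length gs"
      then have "lookup x k = 0" using x(1) len by (simp add: free_mod_iff)
      then show False using c0 by simp
    qed
    define A' where "A' = A - {gs ! k}"
    \<comment> \<open>The component of the relation in the degree of the generator
      \<open>gs ! k\<close> is again a relation, and its coefficient at \<open>k\<close> is exactly
      the nonzero constant \<open>c\<close>. Dividing by it expresses this generator through the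
      others.\<close>
    define y where "y = hvcomp ds' (ds' ! k) x"
    have "\<delta> y = hvcomp ds (ds' ! k) (\<delta> x)"
      unfolding y_def by (rule hvcomp_graded_hom[OF hom x(1) homk, symmetric])
    then have "0 = \<delta> y" by (simp add: x(2))
    also have "\<delta> y = vscale (lookup y k) (gs ! k) + (\<Sum>l\<in>{..<length gs} - {k}. vscale (lookup y l) (gs ! l))"
      unfolding \<delta>_def using k by (intro sum.remove) auto
    also have "lookup y k = single 0 c"
    proof (rule poly_mapping_eqI)
      fix \<beta>
      show "lookup (lookup y k) \<beta> = lookup (single 0 c) \<beta>"
        using k by (auto simp: y_def lookup_hvcomp len lookup_hcomp mdeg_eq_0_iff c_def lookup_single when_def)
    qed
    finally have eq: "vscale (single 0 c) (gs ! k) = - (\<Sum>l\<in>{..<length gs} - {k}. vscale (lookup y l) (gs ! l))"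
      by (simp add: eq_neg_iff_add_eq_0)
    have "gs ! l \<in> A'" if "l \<in> {..<length gs} - {k}" for l
      using that gs k by (auto simp: A'_def nth_eq_iff_index_eq)
    then have "vscale (single 0 c) (gs ! k) \<in> vscale_module.span A'"
      unfolding eq
      by (intro vscale_module.span_neg vscale_module.span_sum vscale_module.span_scale
          vscale_module.span_base) auto
    then have "vscale (single 0 (inverse c)) (vscale (single 0 c) (gs ! k)) \<in> vscale_module.span A'"
      by (rule vscale_module.span_scale)
    then have gk: "gs ! k \<in> vscale_module.span A'"
      using c by (simp add: mult_single)
    have "A \<subseteq> vscale_module.span A'"
      using gk by (auto simp: A'_def intro: vscale_module.span_base)
    then have "vscale_module.span A \<subseteq> vscale_module.span A'"
      by (rule vscale_module.span_minimal) simp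
    moreover have "vscale_module.span A' \<subseteq> vscale_module.span A"
      by (rule vscale_module.span_mono) (auto simp: A'_def)
    ultimately have "P A'" using A by (auto simp: P_def A'_def)
    then have "card A \<le> card A'" by (rule least)
    moreover have "card A' < card A"
      unfolding A'_def using A k gs(1) by (intro card_Diff1_less) (auto simp: P_def)
    ultimately show False by simp
  qed
  ultimately show ?thesis using that[OF hom homk] by blast
qed

text \<open>The single bound \<open>N\<close> for all positions passes through
  \<open>syzygy_stage\<close> to the generators of every syzygy module, so each can be covered by a
  finite free module. Dependent choice builds the stages with \<open>syzygy_stage\<close> as
  invariant.\<close>

lemma minimal_resolution_exists:
  fixes I :: "('v::finite, 'k::field) mpoly set"
  assumes I: "mult_module.subspace I" and I_graded: "\<And>p e. p \<in> I \<Longrightarrow> hcomp e p \<in> I"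
    and proper: "\<And>p. p \<in> I \<Longrightarrow> lookup p 0 = 0"
    and vanish: "\<And>q d. d > N \<Longrightarrow> koszul_vanishes (*) homs I q d"
  shows "\<exists>ds \<delta> \<epsilon>. minimal_graded_free_resolution I ds \<delta> \<epsilon>"
proof -
  define \<epsilon> :: "(nat \<Rightarrow>\<^sub>0 ('v, 'k) mpoly) \<Rightarrow> ('v, 'k) mpoly" where "\<epsilon> x = lookup x 0" for x
  have \<epsilon>: "module_hom vscale (*) \<epsilon>"
    by unfold_locales (simp_all add: \<epsilon>_def lookup_add lookup_vscale)
  define Z0 where "Z0 = {x \<in> free_mod (length [0 :: int]). \<epsilon> x \<in> I}"
  have surj: "\<exists>x\<in>free_mod (length [0 :: int]). p - \<epsilon> x \<in> I" for p
    using mult_module.subspace_0[OF I]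
    by (intro bexI[of _ "vec 1 (\<lambda>_. p)"]) (simp_all add: \<epsilon>_def lookup_vec vec_free_mod[of 1, simplified])
  have hom\<epsilon>: "homogeneous ([0] ! k) (\<epsilon> (unit_vec k))" if "k < length [0 :: int]" for k
    using that by (simp add: \<epsilon>_def lookup_unit_vec homogeneous_def)
  have stage0: "syzygy_stage I 0 [0] Z0"
  proof (rule syzygy_stage_0[OF I I_graded \<epsilon> hom\<epsilon> surj Z0_def])
    fix x assume x: "x \<in> Z0"
    show "no_constant x"
      unfolding no_constant_def
    proof
      fix k
      show "lookup (lookup x k) 0 = 0"
      proof (cases "k = 0")
        case True
        then show ?thesis using x proper by (simp add: Z0_def \<epsilon>_def)
      next
        case False
        then show ?thesis using x by (simp add: Z0_def free_mod_iff)
      qed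
    qed
  qed
  \<comment> \<open>The clause for n = 0 pins the first stage to R and \<epsilon>; dependent choice
    would otherwise return an arbitrary stage 0.\<close>
  define S where "S n s \<longleftrightarrow> syzygy_stage I n (fst s) (snd s) \<and> (n = 0 \<longrightarrow> s = ([0], Z0))" for n s
  define Q where "Q s s' \<delta> \<longleftrightarrow> module_hom vscale vscale \<delta> \<and>
      (\<forall>k<length (fst s'). homogeneous_vec (fst s) (fst s' ! k) (\<delta> (unit_vec k))) \<and>
      \<delta> ` free_mod (length (fst s')) = snd s \<and> snd s' = {x \<in> free_mod (length (fst s')). \<delta> x = 0}"
    for s s' :: "int list \<times> (nat \<Rightarrow>\<^sub>0 ('v, 'k) mpoly) set" and \<delta>
  have "\<exists>f. \<forall>n. S n (f n) \<and> (\<exists>\<delta>. Q (f n) (f (Suc n)) \<delta>)"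
  proof (rule dependent_nat_choice)
    show "\<exists>s. S 0 s" using stage0 by (intro exI[of _ "([0], Z0)"]) (simp add: S_def)
  next
    fix s n assume "S n s"
    then have stage: "syzygy_stage I n (fst s) (snd s)" by (simp add: S_def)
    have Z: "vscale_module.subspace (snd s)" "snd s \<subseteq> free_mod (length (fst s))"
      "\<And>x. x \<in> snd s \<Longrightarrow> no_constant x" "\<And>x e. x \<in> snd s \<Longrightarrow> hvcomp (fst s) e x \<in> snd s"
      "\<And>q d. koszul_vanishes vscale (vhoms (fst s)) (snd s) q d \<longleftrightarrow> koszul_vanishes (*) homs I (q + n) d"
      using stage by (auto simp: syzygy_stage_def)
    have "koszul_vanishes vscale (\<lambda>e. vhoms (fst s) e \<inter> snd s) {0} 0 d" if "d > N" for d
      using koszul_vanishes_connecting[OF Z(1,3), of "fst s" 0 d] Z(5)[of "Suc 0" d] vanish[OF that] by simp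
    then obtain A where "finite A" "\<And>a. a \<in> A \<Longrightarrow> \<exists>e. homogeneous_vec (fst s) e a"
        "vscale_module.span A = snd s"
      using homogeneous_generators[OF Z(1,2,4), of N] by metis
    then have fg: "\<exists>A. finite A \<and> (\<forall>a\<in>A. \<exists>e. homogeneous_vec (fst s) e a) \<and> vscale_module.span A = snd s"
      by blast
    obtain ds' \<delta> where \<delta>: "module_hom vscale vscale \<delta>"
      "\<And>k. k < length ds' \<Longrightarrow> homogeneous_vec (fst s) (ds' ! k) (\<delta> (unit_vec k))"
      "\<delta> ` free_mod (length ds') = snd s"
      "\<And>x. x \<in> free_mod (length ds') \<Longrightarrow> \<delta> x = 0 \<Longrightarrow> no_constant x"
      by (rule minimal_presentation[OF fg]) (rule that)
    have "syzygy_stage I (Suc n) ds' {x \<in> free_mod (length ds'). \<delta> x = 0}"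
      by (rule syzygy_stage_Suc[OF stage \<delta>(1-3) refl]) (use \<delta>(4) in auto)
    then have "S (Suc n) (ds', {x \<in> free_mod (length ds'). \<delta> x = 0}) \<and>
        Q s (ds', {x \<in> free_mod (length ds'). \<delta> x = 0}) \<delta>"
      using \<delta>(1-3) by (simp add: S_def Q_def)
    then show "\<exists>s'. S (Suc n) s' \<and> (\<exists>\<delta>. Q s s' \<delta>)" by blast
  qed
  then obtain f where f: "\<And>n. S n (f n)" "\<And>n. \<exists>\<delta>. Q (f n) (f (Suc n)) \<delta>" by blast
  then obtain \<delta> where \<delta>: "\<And>n. Q (f n) (f (Suc n)) (\<delta> n)" by metis
  define ds where "ds n = fst (f n)" for n
  have f0: "f 0 = ([0], Z0)" using f(1)[of 0] by (simp add: S_def)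
  have nc: "no_constant x" if "x \<in> snd (f n)" for x n
    using f(1)[of n] that by (simp add: S_def syzygy_stage_def)
  have D: "module_hom vscale vscale (\<delta> n)"
    "\<And>k. k < length (ds (Suc n)) \<Longrightarrow> homogeneous_vec (ds n) (ds (Suc n) ! k) (\<delta> n (unit_vec k))"
    "\<delta> n ` free_mod (length (ds (Suc n))) = snd (f n)"
    "snd (f (Suc n)) = {x \<in> free_mod (length (ds (Suc n))). \<delta> n x = 0}" for n
    using \<delta>[of n] by (auto simp: Q_def ds_def)
  have ds0: "ds 0 = [0]" by (simp add: ds_def f0)
  have "resolution I (\<lambda>i. free_mod (length (ds i))) \<delta> \<epsilon>"
    unfolding resolution_def
  proof (intro conjI allI)
    show "module_hom vscale vscale (\<delta> i)" for i by (rule D(1))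
    show "module_hom vscale (*) \<epsilon>" by (rule \<epsilon>)
    show "\<exists>x\<in>free_mod (length (ds 0)). p - \<epsilon> x \<in> I" for p using surj by (simp add: ds0)
    show "\<delta> 0 ` free_mod (length (ds 1)) = {x \<in> free_mod (length (ds 0)). \<epsilon> x \<in> I}"
      using D(3)[of 0] by (simp add: f0 Z0_def ds0)
    show "\<delta> (Suc i) ` free_mod (length (ds (Suc (Suc i)))) = {x \<in> free_mod (length (ds (Suc i))). \<delta> i x = 0}" for i
      using D(3)[of "Suc i"] D(4)[of i] by simp
  qed
  moreover have "lookup (\<delta> i x) k \<in> max_ideal" if "x \<in> free_mod (length (ds (Suc i)))" for i x k
    using nc[of "\<delta> i x" i] D(3)[of i] that by (auto simp: max_ideal_eq no_constant_def)
  ultimately have "minimal_graded_free_resolution I ds \<delta> \<epsilon>"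
    using hom\<epsilon> D(2) by (simp add: minimal_graded_free_resolution_def ds0)
  then show ?thesis by blast
qed

text \<open>Existence makes the choice in \<open>graded_betti\<close> refer to an actual minimal
  resolution, in which the shifts at position \<open>i\<close> are the degrees of nonvanishing
  Koszul homology.\<close>

lemma graded_betti_nonzero_iff:
  fixes I :: "('v::finite, 'k::field) mpoly set"
  assumes I: "mult_module.subspace I" and I_graded: "\<And>p e. p \<in> I \<Longrightarrow> hcomp e p \<in> I"
    and proper: "\<And>p. p \<in> I \<Longrightarrow> lookup p 0 = 0"
    and vanish: "\<And>q d. d > N \<Longrightarrow> koszul_vanishes (*) homs I q d"
  shows "graded_betti I i j \<noteq> 0 \<longleftrightarrow> \<not> koszul_vanishes (*) homs I i j"
proof -
  have "\<exists>b ds \<delta> \<epsilon>. minimal_graded_free_resolution I ds \<delta> \<epsilon> \<and> b = count_list (ds i) j"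
    using minimal_resolution_exists[OF I I_graded proper vanish] by metis
  from someI_ex[OF this, folded graded_betti_def]
  obtain ds \<delta> \<epsilon> where res: "minimal_graded_free_resolution I ds \<delta> \<epsilon>"
    and b: "graded_betti I i j = count_list (ds i) j" by blast
  have "graded_betti I i j \<noteq> 0 \<longleftrightarrow> j \<in> set (ds i)" by (simp add: b count_list_0_iff)
  then show ?thesis using minimal_resolution_shift_iff[OF res I I_graded] by simp
qed

text \<open>The degrees in Hochster's formula are cardinalities of vertex sets, so the number of
  vertices serves as the degree bound. The ideal contains no constant terms because edges are
  nonempty.\<close>

lemma graded_betti_edge_ideal:
  fixes E :: "'v::finite set set"
  assumes sg: "simple_graph E"
  shows "graded_betti (edge_ideal E :: ('v, 'k::field) mpoly set) i j \<noteq> 0 \<longleftrightarrow>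
    (\<exists>W m. nonzero_cohom TYPE('k) E W m \<and> int (card W) = j \<and> card W = m + i)"
proof -
  let ?I = "edge_ideal E :: ('v, 'k) mpoly set"
  have sub: "mult_module.subspace ?I" by (simp add: edge_ideal_def ideal_gen_def)
  have graded: "hcomp e p \<in> ?I" if "p \<in> ?I" for p e
  proof -
    have "keys (hcomp e p) \<subseteq> keys p" by (auto simp: in_keys_iff lookup_hcomp split: if_splits)
    then show ?thesis using that by (auto simp: edge_ideal_eq[OF sg])
  qed
  have proper: "lookup p 0 = 0" if p: "p \<in> ?I" for p
  proof (rule ccontr)
    assume "lookup p 0 \<noteq> 0"
    then have "0 \<in> keys p" by (simp add: in_keys_iff)
    then have "\<exists>e\<in>E. e \<subseteq> keys (0 :: 'v \<Rightarrow>\<^sub>0 nat)" using p unfolding edge_ideal_eq[OF sg] by blast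
    then show False using sg by (auto simp: simple_graph_def)
  qed
  have vanish: "koszul_vanishes (*) homs ?I q d" if "d > int (card (UNIV :: 'v set))" for q d
  proof -
    have "int (card W) \<noteq> d" for W :: "'v set" using that card_mono[of "UNIV :: 'v set" W] by auto
    then show ?thesis by (simp add: koszul_vanishes_edge_ideal[OF sg])
  qed
  show ?thesis
    using graded_betti_nonzero_iff[OF sub graded proper vanish, where i = i and j = j]
    unfolding koszul_vanishes_edge_ideal[OF sg] by blast
qed

theorem proposition2p9:
  fixes E :: "'v::finite set set" and I :: "('v, 'k::field) mpoly set" and a b :: nat
  assumes "simple_graph E"
    and "I = edge_ideal E"
    and "b = induced_matching_number E + 1"
    and "a \<ge> 1"
    and "enat (a + b) \<le> pd_quot I"
  shows "top_degree I (a + b) \<le> top_degree I a + top_degree I b"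
proof -
  note betti = graded_betti_edge_ideal[OF assms(1), where 'k='k, folded assms(2)]
  have top: "ereal (real (card W)) \<le> top_degree I i"
    if "nonzero_cohom TYPE('k) E W m" "card W = m + i" for W m i
  proof -
    have "graded_betti I i (int (card W)) \<noteq> 0" unfolding betti using that by blast
    then show ?thesis unfolding top_degree_def by (intro SUP_upper2[of "int (card W)"]) auto
  qed
  \<comment> \<open>It suffices to bound each degree that occurs; if none occurs, the supremum on
    the left is -\<infinity>.\<close>
  have "ereal (real_of_int j) \<le> top_degree I a + top_degree I b" if j: "graded_betti I (a + b) j \<noteq> 0" for j
  proof -
    obtain W m where W: "nonzero_cohom TYPE('k) E W m" "int (card W) = j" "card W = m + (a + b)"
      using j unfolding betti by blast
    obtain W' m' where W': "nonzero_cohom TYPE('k) E W' m'" "card W' = a + m'" "card W \<le> card W' + (2 * b - 1)"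
      using nonzero_cohom_subadditive[OF assms(1) W(1) assms(3), of a] W(3) by auto
    have "induced_matching_number E + m < card W" using W(3) assms(3) by simp
    then obtain x y z where "{x, y} \<in> E" "{x, z} \<in> E" "y \<noteq> z"
      using path_of_length_two_exists[OF assms(1) W(1)] by metis
    then obtain W0 where W0: "nonzero_cohom TYPE('k) E W0 (induced_matching_number E)"
        "card W0 = 2 * induced_matching_number E + 1"
      using nonzero_cohom_induced_matching_number[OF assms(1), where 'k='k] by blast
    \<comment> \<open>The two constants agree: the descent costs at most 2b - 1 vertices, and
      \<open>W0\<close> has 2\<nu>(G) + 1 = 2b - 1 vertices. The index of \<open>W0\<close> is
      \<nu>(G) + 1 = b.\<close>
    have "ereal (real_of_int j) \<le> ereal (real (card W')) + ereal (real (card W0))"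
      using W(2) W'(3) W0(2) assms(3) by auto
    also have "\<dots> \<le> top_degree I a + top_degree I b"
      using top[OF W'(1)] top[OF W0(1)] W'(2) W0(2) assms(3) by (intro add_mono) auto
    finally show ?thesis .
  qed
  then show ?thesis unfolding top_degree_def[of I "a + b"] by (intro SUP_least) auto
qed

end
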